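(* Let $n\ge 2$ and let $\theta$ be a non-empty partial commutation relation on $\{1,\ldots,n\}$. Let $F_{n+1}$ be the free group on $\{f_1,\ldots,f_n,t\}$, let $M$ be the normal closure in $F_{n+1}$ of $$\mathcal R=\{[f_a,f_b],\ [t,f_i,f_j],\ [[t,f_a],[t,f_b]] : i,j\in\{1,\ldots,n\};\ a>b;\ (a,b)\in\theta\},$$ and let $\mathrm{FP(H)}=F_{n+1}/M$. Let $J$ be the ideal of the free Lie algebra $\operatorname{gr}(F_{n+1})$ (free on $y_i=f_iF_{n+1}'$, $1\le i\le n$, and $\overline t=tF_{n+1}'$) generated by $$\mathcal R_L=\{[y_a,y_b],\ [\overline t,y_i,y_j],\ [[\overline t,y_a],[\overline t,y_b]] : i,j\in\{1,\ldots,n\};\ a>b;\ (a,b)\in\theta\}.$$ Then $\operatorname{gr}(\mathrm{FP(H)})\cong \operatorname{gr}(F_{n+1})/J$ as Lie algebras in a natural way, i.e. the Lie algebra homomorphism $\operatorname{gr}(F_{n+1})\to\operatorname{gr}(\mathrm{FP(H)})$ induced by the projection $F_{n+1}\to F_{n+1}/M$ induces an isomorphism $\operatorname{gr}(F_{n+1})/J\to\operatorname{gr}(\mathrm{FP(H)})$. Moreover, $\mathrm{FP(H)}$ is a Magnus group.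
   Context: Group commutators are $[x,y]=x^{-1}y^{-1}xy$; group and Lie commutators are left-normed, $[x,y,z]=[[x,y],z]$. A partial commutation relation on $\{1,\ldots,n\}$ is a subset $\theta$ of $\{(a,b): a,b\in\{1,\ldots,n\}, a\ne b\}$ with $(a,b)\in\theta$ if and only if $(b,a)\in\theta$. For a group $G$, $\gamma_1(G)=G$, $\gamma_{c+1}(G)=[\gamma_c(G),G]$, $G'=\gamma_2(G)$, and $\operatorname{gr}(G)=\bigoplus_{c\ge1}\gamma_c(G)/\gamma_{c+1}(G)$ is the graded Lie algebra over $\mathbb Z$ with bracket induced by the group commutator. The group $\mathrm{FP(H)}$ is (a presentation of) the Formanek–Procesi group, the HNN-extension $\langle b, H\times H : b(g,g)b^{-1}=(1,g),\ g\in H\rangle$, with base the right-angled Artin group $H=\langle a_1,\ldots,a_n : [a_k,a_l]=1,\ k>l,\ (k,l)\in\theta\rangle$. A group $G$ is residually nilpotent if $\bigcap_{c\ge1}\gamma_c(G)=\{1\}$; $G$ is a Magnus group if it is residually nilpotent and every quotient $\gamma_c(G)/\gamma_{c+1}(G)$, $c\ge1$, is torsion-free. *)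

theory Defs
  imports "HOL-Algebra.Product_Groups" "HOL-Algebra.FiniteProduct" "HOL-Algebra.Generated_Groups"
begin

section \<open>Free groups\<close>

text \<open>
  A letter \<open>(True, x)\<close> stands for \<open>x\<close> and \<open>(False, x)\<close> for its inverse. The free group on \<open>X\<close>
  consists of the freely reduced words over \<open>X\<close>, multiplied by concatenation and free reduction.
\<close>

type_synonym 'a letter = "bool \<times> 'a"

definition inv_letter :: "'a letter \<Rightarrow> 'a letter" where
  "inv_letter l = (\<not> fst l, snd l)"

definition reduced :: "'a letter list \<Rightarrow> bool" where
  "reduced w \<longleftrightarrow> successively (\<lambda>k l. l \<noteq> inv_letter k) w"

definition reduced_Cons :: "'a letter \<Rightarrow> 'a letter list \<Rightarrow> 'a letter list" where
  "reduced_Cons l w = (if w \<noteq> [] \<and> hd w = inv_letter l then tl w else l # w)"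

definition free_group :: "'a set \<Rightarrow> 'a letter list monoid" where
  "free_group X =
    \<lparr>carrier = {w. reduced w \<and> snd ` set w \<subseteq> X}, monoid.mult = foldr reduced_Cons, one = []\<rparr>"

definition free_gen :: "'a \<Rightarrow> 'a letter list" where
  "free_gen x = [(True, x)]"

lemma inv_letter_inv_letter [simp]: "inv_letter (inv_letter l) = l"
  by (simp add: inv_letter_def)

lemma snd_inv_letter [simp]: "snd (inv_letter l) = snd l"
  by (simp add: inv_letter_def)

lemma inv_letter_neq [simp]: "inv_letter l \<noteq> l" "l \<noteq> inv_letter l"
  by (cases l; simp add: inv_letter_def)+

lemma reduced_Nil [simp]: "reduced []"
  by (simp add: reduced_def)

lemma reduced_Cons_iff: "reduced (l # w) \<longleftrightarrow> (w = [] \<or> hd w \<noteq> inv_letter l) \<and> reduced w"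
  by (auto simp: reduced_def successively_Cons)

lemma reduced_tl: "reduced w \<Longrightarrow> reduced (tl w)"
  by (cases w) (auto simp: reduced_Cons_iff)

lemma reduced_reduced_Cons: "reduced w \<Longrightarrow> reduced (reduced_Cons l w)"
  by (auto simp: reduced_Cons_def reduced_Cons_iff reduced_tl)

lemma reduced_foldr: "reduced w \<Longrightarrow> reduced (foldr reduced_Cons v w)"
  by (induction v) (auto simp: reduced_reduced_Cons)

lemma letters_reduced_Cons:
  "snd l \<in> X \<Longrightarrow> snd ` set w \<subseteq> X \<Longrightarrow> snd ` set (reduced_Cons l w) \<subseteq> X"
  by (cases w) (auto simp: reduced_Cons_def)

lemma letters_foldr:
  "snd ` set v \<subseteq> X \<Longrightarrow> snd ` set w \<subseteq> X \<Longrightarrow> snd ` set (foldr reduced_Cons v w) \<subseteq> X"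
  by (induction v) (simp_all add: letters_reduced_Cons)

lemma reduced_Cons_cancel: "reduced w \<Longrightarrow> reduced_Cons l (reduced_Cons (inv_letter l) w) = w"
  by (cases w) (auto simp: reduced_Cons_def reduced_Cons_iff)

lemma foldr_reduced_Cons:
  assumes "reduced w"
  shows "foldr reduced_Cons (reduced_Cons l v) w = reduced_Cons l (foldr reduced_Cons v w)"
proof (cases "v \<noteq> [] \<and> hd v = inv_letter l")
  case True
  then obtain v' where "v = inv_letter l # v'" by (cases v) auto
  then show ?thesis
    using assms by (simp add: reduced_Cons_def[of l v] reduced_Cons_def[of l "inv_letter l # v'"]
        reduced_Cons_cancel reduced_foldr)
next
  case False
  then have "reduced_Cons l v = l # v" unfolding reduced_Cons_def by (rule if_not_P)
  then show ?thesis by simp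
qed

lemma foldr_reduced_Cons_assoc:
  assumes "reduced w"
  shows "foldr reduced_Cons (foldr reduced_Cons u v) w = foldr reduced_Cons u (foldr reduced_Cons v w)"
  using assms by (induction u) (auto simp: foldr_reduced_Cons)

lemma foldr_reduced_Nil: "reduced w \<Longrightarrow> foldr reduced_Cons w [] = w"
  by (induction w) (auto simp: reduced_Cons_iff reduced_Cons_def)

lemma reduced_append_single:
  "reduced (w @ [l]) \<longleftrightarrow> reduced w \<and> (w = [] \<or> l \<noteq> inv_letter (last w))"
  by (auto simp: reduced_def successively_append_iff)

lemma reduced_rev: "reduced w \<Longrightarrow> reduced (map inv_letter (rev w))"
proof (induction w)
  case (Cons l w)
  have "last (map inv_letter (rev w)) = inv_letter (hd w)" if "w \<noteq> []"
    using that by (simp add: last_map last_rev)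
  then have "reduced (map inv_letter (rev w) @ [inv_letter l])"
    using Cons by (auto simp: reduced_append_single reduced_Cons_iff)
  then show ?case by simp
qed simp

lemma foldr_inverse: "foldr reduced_Cons (map inv_letter (rev w)) w = []"
  by (induction w) (simp_all add: reduced_Cons_def)

theorem group_free_group: "group (free_group X)"
proof (rule groupI)
  fix w assume w: "w \<in> carrier (free_group X)"
  show "\<exists>v\<in>carrier (free_group X). v \<otimes>\<^bsub>free_group X\<^esub> w = \<one>\<^bsub>free_group X\<^esub>"
    using w by (intro bexI[of _ "map inv_letter (rev w)"])
      (auto simp: free_group_def foldr_inverse reduced_rev)
qed (simp_all add: free_group_def reduced_foldr foldr_reduced_Cons_assoc letters_foldr)

lemma free_gen_closed: "x \<in> X \<Longrightarrow> free_gen x \<in> carrier (free_group X)"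
  by (simp add: free_group_def free_gen_def reduced_Cons_iff)

theorem free_group_extend:
  assumes "group G" and \<phi>: "\<And>x. x \<in> X \<Longrightarrow> \<phi> x \<in> carrier G"
  shows "\<exists>h \<in> hom (free_group X) G. \<forall>x\<in>X. h (free_gen x) = \<phi> x"
proof -
  interpret group G by fact
  define val where "val l = (if fst l then \<phi> (snd l) else inv\<^bsub>G\<^esub> \<phi> (snd l))" for l
  define h where "h w = foldr (\<lambda>l g. val l \<otimes>\<^bsub>G\<^esub> g) w \<one>\<^bsub>G\<^esub>" for w
  have val_closed: "val l \<in> carrier G" if "snd l \<in> X" for l
    using that \<phi> by (simp add: val_def)
  have val_inv: "val (inv_letter l) = inv\<^bsub>G\<^esub> val l" if "snd l \<in> X" for l
    using that \<phi> by (simp add: val_def inv_letter_def)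
  have closed: "h w \<in> carrier G" if "snd ` set w \<subseteq> X" for w
    using that by (induction w) (simp_all add: h_def val_closed)
  have h_Cons: "h (reduced_Cons l w) = val l \<otimes>\<^bsub>G\<^esub> h w" if "snd l \<in> X" "snd ` set w \<subseteq> X" for l w
  proof (cases "w \<noteq> [] \<and> hd w = inv_letter l")
    case True
    then obtain w' where w: "w = inv_letter l # w'" by (cases w) auto
    then have "h w' \<in> carrier G" using that closed by simp
    then have "val l \<otimes>\<^bsub>G\<^esub> h w = h w'"
      using that by (simp add: w h_def val_closed val_inv flip: m_assoc)
    then show ?thesis by (simp add: w reduced_Cons_def)
  next
    case False
    then have "reduced_Cons l w = l # w" unfolding reduced_Cons_def by (rule if_not_P)
    then show ?thesis by (simp add: h_def)
  qed
  have mult: "h (foldr reduced_Cons u w) = h u \<otimes>\<^bsub>G\<^esub> h w"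
    if "snd ` set u \<subseteq> X" "snd ` set w \<subseteq> X" for u w
    using that(1)
  proof (induction u)
    case Nil
    then show ?case using closed that(2) by (simp add: h_def[of "[]"])
  next
    case (Cons l u)
    then have "h (foldr reduced_Cons (l # u) w) = val l \<otimes>\<^bsub>G\<^esub> (h u \<otimes>\<^bsub>G\<^esub> h w)"
      using that(2) by (simp add: h_Cons letters_foldr)
    also have "\<dots> = h (l # u) \<otimes>\<^bsub>G\<^esub> h w"
      using Cons.prems that(2) val_closed closed by (simp add: m_assoc h_def[of "l # u"] flip: h_def[of u])
    finally show ?case .
  qed
  have "h \<in> hom (free_group X) G"
    using closed mult by (auto intro!: homI simp: free_group_def)
  moreover have "h (free_gen x) = \<phi> x" if "x \<in> X" for x
    using that \<phi> by (simp add: h_def free_gen_def val_def)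
  ultimately show ?thesis by blast
qed

theorem free_group_generate: "carrier (free_group X) = generate (free_group X) (free_gen ` X)"
proof
  interpret group "free_group X" by (rule group_free_group)
  show "generate (free_group X) (free_gen ` X) \<subseteq> carrier (free_group X)"
    by (rule generate_incl) (auto simp: free_gen_closed)
  show "carrier (free_group X) \<subseteq> generate (free_group X) (free_gen ` X)"
  proof
    fix w assume "w \<in> carrier (free_group X)"
    then have "reduced w" "snd ` set w \<subseteq> X" by (auto simp: free_group_def)
    then show "w \<in> generate (free_group X) (free_gen ` X)"
    proof (induction w)
      case Nil
      then show ?case using generate.one[of "free_group X"] by (simp add: free_group_def)
    next
      case (Cons l w)
      obtain b x where l: "l = (b, x)" by (cases l)
      then have x: "x \<in> X" using Cons.prems by simp
      have "inv\<^bsub>free_group X\<^esub> free_gen x = [(False, x)]"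
        using x by (intro inv_equality) (simp_all add: free_gen_def free_group_def
          reduced_Cons_iff reduced_Cons_def inv_letter_def)
      then have "[l] \<in> generate (free_group X) (free_gen ` X)"
        using x generate.incl[of "free_gen x" "free_gen ` X" "free_group X"]
          generate.inv[of "free_gen x" "free_gen ` X" "free_group X"]
        by (cases b) (simp_all add: l free_gen_def)
      moreover have "w \<in> generate (free_group X) (free_gen ` X)"
        using Cons by (auto simp: reduced_Cons_iff)
      ultimately have "[l] \<otimes>\<^bsub>free_group X\<^esub> w \<in> generate (free_group X) (free_gen ` X)"
        by (rule generate.eng)
      moreover have "[l] \<otimes>\<^bsub>free_group X\<^esub> w = l # w"
        using Cons.prems(1) by (auto simp: free_group_def reduced_Cons_def reduced_Cons_iff)
      ultimately show ?case by simp
    qed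
  qed
qed


section \<open>Group-theoretic notions\<close>

definition commutator :: "('a, 'b) monoid_scheme \<Rightarrow> 'a \<Rightarrow> 'a \<Rightarrow> 'a" where
  "commutator G x y = inv\<^bsub>G\<^esub> x \<otimes>\<^bsub>G\<^esub> inv\<^bsub>G\<^esub> y \<otimes>\<^bsub>G\<^esub> x \<otimes>\<^bsub>G\<^esub> y"

definition normal_closure :: "('a, 'b) monoid_scheme \<Rightarrow> 'a set \<Rightarrow> 'a set" where
  "normal_closure G S = \<Inter> {N. N \<lhd> G \<and> S \<subseteq> N}"

text \<open>The lower central series is indexed from 1; the value at 0 is a dummy.\<close>

fun lower_central :: "('a, 'b) monoid_scheme \<Rightarrow> nat \<Rightarrow> 'a set" where
  "lower_central G 0 = carrier G"
| "lower_central G (Suc 0) = carrier G"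
| "lower_central G (Suc (Suc c)) =
     generate G {commutator G x y | x y. x \<in> lower_central G (Suc c) \<and> y \<in> carrier G}"

definition lower_central_quotient :: "('a, 'b) monoid_scheme \<Rightarrow> nat \<Rightarrow> 'a set monoid" where
  "lower_central_quotient G c = G\<lparr>carrier := lower_central G c\<rparr> Mod lower_central G (Suc c)"

definition torsion_free :: "('a, 'b) monoid_scheme \<Rightarrow> bool" where
  "torsion_free G \<longleftrightarrow> (\<forall>x\<in>carrier G. \<forall>k::nat. k > 0 \<longrightarrow> x [^]\<^bsub>G\<^esub> k = \<one>\<^bsub>G\<^esub> \<longrightarrow> x = \<one>\<^bsub>G\<^esub>)"

definition residually_nilpotent :: "('a, 'b) monoid_scheme \<Rightarrow> bool" where
  "residually_nilpotent G \<longleftrightarrow> (\<Inter>c\<in>{1..}. lower_central G c) = {\<one>\<^bsub>G\<^esub>}"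

definition magnus_group :: "('a, 'b) monoid_scheme \<Rightarrow> bool" where
  "magnus_group G \<longleftrightarrow>
     group G \<and> residually_nilpotent G \<and> (\<forall>c\<ge>1. torsion_free (lower_central_quotient G c))"


section \<open>Lie rings\<close>

text \<open>
  A Lie algebra over the integers is an abelian group with a bracket. Its additive group is the
  underlying \<open>monoid\<close> record (hence written multiplicatively), so that \<open>hom\<close>, \<open>iso\<close> and \<open>Mod\<close>
  refer to the additive structure.
\<close>

record 'a lie_ring = "'a monoid" +
  bracket :: "'a \<Rightarrow> 'a \<Rightarrow> 'a"

definition lie_ideal :: "'a set \<Rightarrow> ('a, 'b) lie_ring_scheme \<Rightarrow> bool" where
  "lie_ideal I L \<longleftrightarrow> subgroup I L \<and> (\<forall>x\<in>I. \<forall>y\<in>carrier L. bracket L x y \<in> I \<and> bracket L y x \<in> I)"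

definition gen_lie_ideal :: "('a, 'b) lie_ring_scheme \<Rightarrow> 'a set \<Rightarrow> 'a set" where
  "gen_lie_ideal L S = \<Inter> {I. lie_ideal I L \<and> S \<subseteq> I}"

definition lie_quotient :: "('a, 'b) lie_ring_scheme \<Rightarrow> 'a set \<Rightarrow> 'a set lie_ring" where
  "lie_quotient L I =
    \<lparr>carrier = carrier (L Mod I), monoid.mult = monoid.mult (L Mod I), one = one (L Mod I),
     bracket = (\<lambda>X Y. \<Union>x\<in>X. \<Union>y\<in>Y. I #>\<^bsub>L\<^esub> bracket L x y)\<rparr>"

definition lie_hom :: "('a, 'c) lie_ring_scheme \<Rightarrow> ('b, 'd) lie_ring_scheme \<Rightarrow> ('a \<Rightarrow> 'b) set" where
  "lie_hom L K = {h \<in> hom L K. \<forall>x\<in>carrier L. \<forall>y\<in>carrier L. h (bracket L x y) = bracket K (h x) (h y)}"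

definition lie_iso :: "('a, 'c) lie_ring_scheme \<Rightarrow> ('b, 'd) lie_ring_scheme \<Rightarrow> ('a \<Rightarrow> 'b) set" where
  "lie_iso L K = {h \<in> lie_hom L K. bij_betw h (carrier L) (carrier K)}"


section \<open>The graded Lie ring of a group\<close>

text \<open>
  The bracket of the homogeneous components of degrees \<open>i\<close> and \<open>j\<close>, sending the cosets of \<open>x\<close> and
  \<open>y\<close> to the coset of their commutator in degree \<open>i + j\<close>. As for \<open>rcoset_mult\<close>, the union
  is over equal cosets.
\<close>

definition gr_bracket :: "('a, 'b) monoid_scheme \<Rightarrow> nat \<Rightarrow> nat \<Rightarrow> 'a set \<Rightarrow> 'a set \<Rightarrow> 'a set" where
  "gr_bracket G i j X Y = (\<Union>x\<in>X. \<Union>y\<in>Y. lower_central G (Suc (i + j)) #>\<^bsub>G\<^esub> commutator G x y)"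

definition gr :: "('a, 'b) monoid_scheme \<Rightarrow> (nat \<Rightarrow> 'a set) lie_ring" where
  "gr G =
    (let S = sum_group {1..} (lower_central_quotient G) in
     \<lparr>carrier = carrier S, monoid.mult = monoid.mult S, one = one S,
      bracket = (\<lambda>u v. \<lambda>k\<in>{1..}. finprod (lower_central_quotient G k)
                          (\<lambda>i. gr_bracket G i (k - i) (u i) (v (k - i))) {1..<k})\<rparr>)"

text \<open>For \<open>x\<close> in the \<open>c\<close>-th term of the lower central series, its class as a homogeneous element of degree \<open>c\<close>.\<close>

definition gr_class :: "('a, 'b) monoid_scheme \<Rightarrow> nat \<Rightarrow> 'a \<Rightarrow> nat \<Rightarrow> 'a set" where
  "gr_class G c x = (\<lambda>k\<in>{1..}. if k = c then lower_central G (Suc c) #>\<^bsub>G\<^esub> x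
                                else \<one>\<^bsub>lower_central_quotient G k\<^esub>)"

text \<open>The map of graded Lie rings induced by a group homomorphism \<open>h\<close>.\<close>

definition gr_map :: "('a, 'c) monoid_scheme \<Rightarrow> ('b, 'd) monoid_scheme \<Rightarrow> ('a \<Rightarrow> 'b) \<Rightarrow> 
    (nat \<Rightarrow> 'a set) \<Rightarrow> (nat \<Rightarrow> 'b set)" where
  "gr_map G H h u = (\<lambda>c\<in>{1..}. \<Union>x\<in>u c. lower_central H (Suc c) #>\<^bsub>H\<^esub> h x)"


section \<open>The Formanek--Procesi group\<close>

definition partial_commutation :: "nat \<Rightarrow> (nat \<times> nat) set \<Rightarrow> bool" where
  "partial_commutation n \<theta> \<longleftrightarrow>
     \<theta> \<subseteq> {(a, b). a \<in> {1..n} \<and> b \<in> {1..n} \<and> a \<noteq> b} \<and> (\<forall>a b. (a, b) \<in> \<theta> \<longleftrightarrow> (b, a) \<in> \<theta>)"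

datatype fp_gen = F nat | T

definition fp_free :: "nat \<Rightarrow> fp_gen letter list monoid" where
  "fp_free n = free_group (insert T (F ` {1..n}))"

text \<open>
  The relators, for an arbitrary commutator operation \<open>br\<close> and elements \<open>f i\<close> and \<open>t\<close>; used both
  with the group commutator and with the Lie bracket.
\<close>

definition fp_relators ::
    "('a \<Rightarrow> 'a \<Rightarrow> 'a) \<Rightarrow> (nat \<Rightarrow> 'a) \<Rightarrow> 'a \<Rightarrow> nat \<Rightarrow> (nat \<times> nat) set \<Rightarrow> 'a set" where
  "fp_relators br f t n \<theta> =
     {br (f a) (f b) | a b. a > b \<and> (a, b) \<in> \<theta>} \<union>
     {br (br t (f i)) (f j) | i j. i \<in> {1..n} \<and> j \<in> {1..n}} \<union>
     {br (br t (f a)) (br t (f b)) | a b. a > b \<and> (a, b) \<in> \<theta>}"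

definition fp_normal :: "nat \<Rightarrow> (nat \<times> nat) set \<Rightarrow> fp_gen letter list set" where
  "fp_normal n \<theta> = normal_closure (fp_free n)
     (fp_relators (commutator (fp_free n)) (\<lambda>i. free_gen (F i)) (free_gen T) n \<theta>)"

definition FP :: "nat \<Rightarrow> (nat \<times> nat) set \<Rightarrow> fp_gen letter list set monoid" where
  "FP n \<theta> = fp_free n Mod fp_normal n \<theta>"

definition fp_lie_ideal :: "nat \<Rightarrow> (nat \<times> nat) set \<Rightarrow> (nat \<Rightarrow> fp_gen letter list set) set" where
  "fp_lie_ideal n \<theta> = gen_lie_ideal (gr (fp_free n))
     (fp_relators (bracket (gr (fp_free n)))
        (\<lambda>i. gr_class (fp_free n) 1 (free_gen (F i))) (gr_class (fp_free n) 1 (free_gen T)) n \<theta>)"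

end

theory Submission
  imports Defs "HOL-Library.Poly_Mapping" "HOL-Library.Countable" "HOL-Library.Function_Algebras"
    "HOL-Computational_Algebra.Primes" "HOL-Algebra.Free_Abelian_Groups" "HOL-Combinatorics.Permutations"
begin

text \<open>
  Let \<open>L\<close> be the Lie ring presented by \<open>\<R>\<^sub>L\<close>. Its enveloping ring, as a right module over the free
  ring, is the free abelian group on the traces (partially commutative words) in letters \<open>t\<close>,
  \<open>x\<^sub>i = [t, y\<^sub>i]\<close> and \<open>y\<^sub>i\<close>, where letters commute as the relators prescribe; in particular it is
  torsion-free. Dynkin's operator and a part of the Poincare--Birkhoff--Witt theorem modulo each prime
  then show that a homogeneous Lie polynomial vanishing in this ring already vanishes in \<open>L\<close>.

  The group acts on the additive functionals of bounded degree on the traces, dually to the following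
  operations: \<open>t\<close> is right multiplication with \<open>1 + t\<close>, and \<open>f\<^sub>i\<close> is the substitution
  \<open>1 + t \<mapsto> (1 + t)(1 + x\<^sub>i)\<close> followed by right multiplication with \<open>1 + y\<^sub>i\<close>. This action is unipotent,
  and an element of \<open>\<gamma>\<^sub>c(F\<^bsub>n+1\<^esub>)\<close> acts with leading term the action of its class in \<open>gr(F\<^bsub>n+1\<^esub>)\<close> on the
  enveloping ring. If the image in \<open>FP(H)\<close> of some positive power of the element lies in
  \<open>\<gamma>\<^bsub>c+1\<^esub>(FP(H))\<close>, then that leading term is zero and the class lies in \<open>J\<close>. This gives both
  \<open>gr(FP(H)) \<cong> gr(F\<^bsub>n+1\<^esub>)/J\<close> and torsion-freeness. The action of \<open>FP(H)\<close> is faithful, by the argument of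
  Magnus: the coefficient of a square-free trace in a product of factors \<open>1 + e l\<close> is the product of
  the exponents. A faithful unipotent action gives residual nilpotence.
\<close>

section \<open>Integral combinations of words and straightening modulo a prime\<close>

text \<open>The group is a semidirect product in disguise. With
  \<open>x\<^sub>i = [t, f\<^sub>i]\<close>, the relators say that \<open>f\<^sub>i\<close>
  conjugates \<open>t\<close> to \<open>t x\<^sub>i\<close> and centralizes every
  \<open>x\<^sub>j\<close>, so the subgroup generated by \<open>t\<close> and the
  \<open>x\<^sub>i\<close> is normalized by the \<open>f\<^sub>i\<close>. This dictates the
  substitution attached to \<open>f\<^sub>i\<close> and the three kinds of letters. Functionals of
  bounded degree take the place of a completion by power series: \<open>1 + t\<close> has no inverse
  on finite sums, but its dual is the identity plus a locally nilpotent operator. Dualizing also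
  turns right operations into a left action. The obstacle on the Lie side is that nothing is known
  in advance about the additive group of \<open>L\<close>, whereas straightening requires a basis.
  Dynkin's operator alone shows only that \<open>c P\<close> vanishes in \<open>L\<close> when
  \<open>P\<close> has degree \<open>c\<close>. Modulo a prime a basis can be chosen, and since the
  enveloping ring is torsion-free the factor \<open>c\<close> can then be removed prime by
  prime.\<close>

instantiation list :: (type) monoid_add
begin

definition zero_list :: "'a list" where "zero_list = []"
definition plus_list :: "'a list \<Rightarrow> 'a list \<Rightarrow> 'a list" where "plus_list = (@)"

instance
  by standard (simp_all add: zero_list_def plus_list_def)

end

text \<open>\<open>poly_mapping\<close> multiplies by convolution over the addition of the index
  type. With concatenation as the addition of lists,
  \<open>'a list \<Rightarrow>\<^sub>0 int\<close> is the free associative ring on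
  \<open>'a\<close>.\<close>

lemma frag_of_append: "frag_of (u @ v) = frag_of u * frag_of v"
  by (simp add: mult_single plus_list_def)

lemma frag_of_Cons: "frag_of (a # v) = frag_of [a] * frag_of v"
  using frag_of_append[of "[a]" v] by simp

lemma frag_of_Nil: "frag_of [] = 1"
  by (metis single_one zero_list_def)

lemmas frag_ind = frag_induction[OF subset_UNIV, case_names zero one diff]

lemma frag_cmul_of_int: "frag_cmul c x = of_int c * x" for x :: "'a list \<Rightarrow>\<^sub>0 int"
proof -
  have "frag_cmul (int m) x = of_nat m * x" for m
    by (induction m) (simp_all add: frag_cmul_distrib algebra_simps)
  then show ?thesis
    by (cases c rule: int_cases2) (simp_all flip: minus_frag_cmul)
qed

lemma frag_cmul_diff: "frag_cmul c (x - y) = frag_cmul c x - frag_cmul c y"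
  using frag_cmul_distrib2[of c "x - y" y] by simp

lemma frag_cmul_mult_left: "frag_cmul c x * y = frag_cmul c (x * y)" for x :: "'a list \<Rightarrow>\<^sub>0 int"
  by (simp add: frag_cmul_of_int mult.assoc)

lemma frag_cmul_mult_right: "x * frag_cmul c y = frag_cmul c (x * y)" for x :: "'a list \<Rightarrow>\<^sub>0 int"
  by (metis Ints_of_int frag_cmul_of_int mult.assoc mult_of_int_commute)

definition add_subgroup :: "'a::ab_group_add set \<Rightarrow> bool" where
  "add_subgroup H \<longleftrightarrow> 0 \<in> H \<and> (\<forall>x\<in>H. \<forall>y\<in>H. x - y \<in> H)"

lemma add_subgroup_zero: "add_subgroup H \<Longrightarrow> 0 \<in> H"
  and add_subgroup_diff: "add_subgroup H \<Longrightarrow> x \<in> H \<Longrightarrow> y \<in> H \<Longrightarrow> x - y \<in> H"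
  by (simp_all add: add_subgroup_def)

lemma add_subgroup_uminus: "add_subgroup H \<Longrightarrow> x \<in> H \<Longrightarrow> - x \<in> H"
  by (metis add_subgroup_def diff_0)

lemma add_subgroup_add: "add_subgroup H \<Longrightarrow> x \<in> H \<Longrightarrow> y \<in> H \<Longrightarrow> x + y \<in> H"
  by (metis add_subgroup_diff add_subgroup_uminus diff_minus_eq_add)

lemma add_subgroup_cmul: "add_subgroup H \<Longrightarrow> x \<in> H \<Longrightarrow> frag_cmul c x \<in> H"
  by (rule frag_closure_minus_cmul[where P = "\<lambda>x. x \<in> H"]) (simp_all add: add_subgroup_def)

lemma add_subgroup_sum: "add_subgroup H \<Longrightarrow> (\<And>i. i \<in> I \<Longrightarrow> f i \<in> H) \<Longrightarrow> sum f I \<in> H"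
  by (induction I rule: infinite_finite_induct) (simp_all add: add_subgroup_zero add_subgroup_add)

lemma add_subgroup_cmul_range: "add_subgroup (range (frag_cmul p))"
proof -
  have "frag_cmul p x - frag_cmul p y = frag_cmul p (x - y)" for x y :: "'a \<Rightarrow>\<^sub>0 int"
    using frag_cmul_distrib2[of p "x - y" y] by simp
  moreover have "0 = frag_cmul p (0 :: 'a \<Rightarrow>\<^sub>0 int)" by simp
  ultimately show ?thesis unfolding add_subgroup_def by blast
qed

text \<open>Most membership proofs below are instances of this: an additive map into a subgroup is
  checked on basis elements.\<close>

lemma add_subgroup_linear:
  assumes "add_subgroup H" "\<And>x y. f (x - y) = f x - f y" "\<And>c. f (frag_of c) \<in> H"
  shows "f x \<in> H"
proof -
  have "f 0 = 0" using assms(2)[of 0 0] by simp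
  then show ?thesis
    by (induction x rule: frag_ind) (simp_all add: assms add_subgroup_zero add_subgroup_diff)
qed

lemma frag_extend_cmul_range: "x \<in> range (frag_cmul p) \<Longrightarrow> frag_extend f x \<in> range (frag_cmul p)"
  by (auto simp: frag_extend_cmul)

section \<open>Straightening of words along descents\<close>

fun invs :: "('a \<Rightarrow> nat) \<Rightarrow> 'a list \<Rightarrow> nat" where
  "invs k [] = 0"
| "invs k (x # xs) = length (filter (\<lambda>y. k y < k x) xs) + invs k xs"

lemma invs_swap: "k a < k b \<Longrightarrow> invs k (u @ a # b # v) < invs k (u @ b # a # v)"
  by (induction u) auto

lemma descent_exists:
  assumes "\<not> sorted (map k w)"
  shows "\<exists>u b a v. w = u @ b # a # v \<and> (k a :: nat) < k b \<and> sorted (map k (u @ [b]))"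
  using assms
proof (induction w rule: rev_induct)
  case (snoc x w)
  show ?case
  proof (cases "sorted (map k w)")
    case True
    then have "w \<noteq> []" using snoc.prems by auto
    then obtain u b where w: "w = u @ [b]" by (metis append_butlast_last_id)
    have "k x < k b"
      using snoc.prems True w by (auto simp: sorted_append not_le dest: le_less_trans)
    then show ?thesis using True w by (metis append.assoc append_Cons append_Nil)
  next
    case False
    then show ?thesis using snoc.IH by fastforce
  qed
qed simp

text \<open>Sortedness of \<open>u @ [b]\<close> makes this the leftmost descent.
  \<open>good_all\<close> relies on that: any other descent overlaps it or lies to its
  right.\<close>

definition first_descent :: "('a \<Rightarrow> nat) \<Rightarrow> 'a list \<Rightarrow> 'a list \<times> 'a \<times> 'a \<times> 'a list" where
  "first_descent k w = (SOME (u, b, a, v). w = u @ b # a # v \<and> k a < k b \<and> sorted (map k (u @ [b])))"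

lemma first_descent:
  assumes "\<not> sorted (map k w)" "first_descent k w = (u, b, a, v)"
  shows "w = u @ b # a # v" "k a < k b" "sorted (map k (u @ [b]))"
proof -
  let ?P = "\<lambda>(u, b, a, v). w = u @ b # a # v \<and> k a < k b \<and> sorted (map k (u @ [b]))"
  have "?P (first_descent k w)"
    unfolding first_descent_def by (rule someI_ex[of ?P]) (use descent_exists[OF assms(1)] in auto)
  then show "w = u @ b # a # v" "k a < k b" "sorted (map k (u @ [b]))" using assms(2) by auto
qed

definition letters :: "('a \<Rightarrow>\<^sub>0 int) \<Rightarrow> ('a list \<Rightarrow>\<^sub>0 int)" where
  "letters = frag_extend (\<lambda>c. frag_of [c])"

lemma letters_simps [simp]: "letters 0 = 0" "letters (frag_of c) = frag_of [c]"
  "letters (x - y) = letters x - letters y" "letters (x + y) = letters x + letters y"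
  "letters (- x) = - letters x"
  by (simp_all add: letters_def frag_extend_diff frag_extend_add frag_extend_minus)

lemma letters_cmul: "letters (frag_cmul p x) = frag_cmul p (letters x)"
  by (simp add: letters_def frag_extend_cmul)

lemma straighten_measures:
  assumes "\<not> sorted (map k w)" "first_descent k w = (u, b, a, v)"
  shows "(u @ a # b # v, w) \<in> measures [length, invs k]" "(u @ c # v, w) \<in> measures [length, invs k]"
  using first_descent[OF assms] invs_swap[of k a b u v] by simp_all

text \<open>
  \<open>\<beta>\<close> gives the brackets of basis elements ordered by \<open>k\<close>, the Lie laws holding modulo \<open>p\<close> only.
  Straightening a word and keeping the part of length one is, modulo \<open>p\<close>, a retraction of the
  enveloping algebra onto the Lie ring (\<open>good_all\<close>); this is all of the Poincare--Birkhoff--Witt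
  theorem that is needed.
\<close>

locale lie_constants =
  fixes k :: "'a \<Rightarrow> nat" and \<beta> :: "'a \<Rightarrow> 'a \<Rightarrow> ('a \<Rightarrow>\<^sub>0 int)" and p :: int
  assumes inj_k: "inj k"
    and alt: "\<beta> a a \<in> range (frag_cmul p)"
    and anti: "\<beta> a b + \<beta> b a \<in> range (frag_cmul p)"
    and jacobi: "frag_extend (\<lambda>x. \<beta> x c) (\<beta> a b) + frag_extend (\<lambda>x. \<beta> x a) (\<beta> b c)
      + frag_extend (\<lambda>x. \<beta> x b) (\<beta> c a) \<in> range (frag_cmul p)"
begin

abbreviation "D \<equiv> range (frag_cmul p)"
abbreviation "ad c \<equiv> frag_extend (\<lambda>x. \<beta> x c)"

function straighten :: "'a list \<Rightarrow> 'a \<Rightarrow>\<^sub>0 int" where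
  "straighten w = (if sorted (map k w) then (case w of [c] \<Rightarrow> frag_of c | _ \<Rightarrow> 0)
     else (case first_descent k w of (u, b, a, v) \<Rightarrow> straighten (u @ a # b # v) +
       (\<Sum>c\<in>Poly_Mapping.keys (\<beta> b a). frag_cmul (Poly_Mapping.lookup (\<beta> b a) c) (straighten (u @ c # v)))))"
  by auto
termination
\<comment> \<open>Swapping the descent keeps the length and removes an inversion; bracketing it
  shortens the word.\<close>
proof (relation "measures [length, invs k]", goal_cases)
  case prems: (2 w)
  then show ?case using straighten_measures[OF prems(1)] by metis
next
  case prems: (3 w)
  then show ?case using straighten_measures[OF prems(1)] by metis
qed simp

declare straighten.simps [simp del]

lemma straighten_descent:
  assumes "\<not> sorted (map k w)" "first_descent k w = (u, b, a, v)"
  shows "straighten w = straighten (u @ a # b # v) + frag_extend (\<lambda>c. straighten (u @ c # v)) (\<beta> b a)"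
  using assms by (simp add: straighten.simps[of w] frag_extend_def)

lemma straighten_singleton: "straighten [c] = frag_of c"
  by (simp add: straighten.simps)

definition L :: "('a list \<Rightarrow>\<^sub>0 int) \<Rightarrow> ('a \<Rightarrow>\<^sub>0 int)" where
  "L = frag_extend straighten"

lemma L_simps [simp]: "L 0 = 0" "L (x - y) = L x - L y" "L (x + y) = L x + L y" "L (- x) = - L x"
  by (simp_all add: L_def frag_extend_diff frag_extend_add frag_extend_minus)

lemma L_frag_of [simp]: "L (frag_of w) = straighten w"
  by (simp add: L_def)

lemma L_cmul: "L (frag_cmul c x) = frag_cmul c (L x)"
  by (simp add: L_def frag_extend_cmul)

lemma L_letters: "L (letters x) = x"
  by (induction x rule: frag_ind) (simp_all add: straighten_singleton)

lemma L_letters_mid: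
  "L (frag_of u * letters x * frag_of v) = frag_extend (\<lambda>c. straighten (u @ c # v)) x"
  by (induction x rule: frag_ind)
    (simp_all add: frag_extend_diff ring_distribs flip: frag_of_append L_frag_of)

abbreviation "Z a b \<equiv> frag_of [a] * frag_of [b] - frag_of [b] * frag_of [a] - letters (\<beta> a b)"

text \<open>\<open>n\<close> is the length of the two leading words of \<open>Z a b\<close> in its
  context. The bracket term is one letter shorter, which is what the induction on \<open>n\<close>
  exploits.\<close>

definition good :: "nat \<Rightarrow> bool" where
  "good n \<longleftrightarrow> (\<forall>u v a b. length u + length v + 2 = n \<longrightarrow> L (frag_of u * Z a b * frag_of v) \<in> D)"

lemmas D_group = add_subgroup_cmul_range[of p]
lemmas D_intros = add_subgroup_add[OF D_group] add_subgroup_diff[OF D_group] add_subgroup_zero[OF D_group]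
  add_subgroup_uminus[OF D_group]

text \<open>Applied with \<open>x\<close> the bracket of two letters of a longer word: the word has
  become shorter, so a relator elsewhere in it falls under the induction hypothesis.\<close>

lemma good_letters_left:
  assumes "\<And>m. m < n \<Longrightarrow> good m" "length u + length m + length v + 3 < n"
  shows "L (frag_of u * letters x * frag_of m * Z a b * frag_of v) \<in> D"
proof (rule add_subgroup_linear[OF D_group, where f = "\<lambda>x. L (frag_of u * letters x * frag_of m * Z a b * frag_of v)"])
  fix c
  have "L (frag_of (u @ c # m) * Z a b * frag_of v) \<in> D"
    using assms(1)[of "length (u @ c # m) + length v + 2"] assms(2) unfolding good_def by auto
  then show "L (frag_of u * letters (frag_of c) * frag_of m * Z a b * frag_of v) \<in> D"
    by (simp add: frag_of_append frag_of_Cons[of c m] mult.assoc)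
qed (simp add: algebra_simps)

lemma good_letters_right:
  assumes "\<And>m. m < n \<Longrightarrow> good m" "length u + length m + length v + 3 < n"
  shows "L (frag_of u * Z a b * frag_of m * letters x * frag_of v) \<in> D"
proof (rule add_subgroup_linear[OF D_group, where f = "\<lambda>x. L (frag_of u * Z a b * frag_of m * letters x * frag_of v)"])
  fix c
  have "L (frag_of u * Z a b * frag_of (m @ c # v)) \<in> D"
    using assms(1)[of "length u + length (m @ c # v) + 2"] assms(2) unfolding good_def by auto
  then show "L (frag_of u * Z a b * frag_of m * letters (frag_of c) * frag_of v) \<in> D"
    by (simp add: frag_of_append frag_of_Cons[of c v] mult.assoc)
qed (simp add: algebra_simps)

text \<open>The counterpart for a bracket next to the third letter of an overlap: the relator
  \<open>Z\<close>, extended linearly in its first argument.\<close>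

lemma good_ad:
  assumes "\<And>m. m < n \<Longrightarrow> good m" "length u + length v + 2 < n"
  shows "L (frag_of u * (letters x * frag_of [a] - frag_of [a] * letters x - letters (ad a x)) * frag_of v) \<in> D"
proof (rule add_subgroup_linear[OF D_group,
    where f = "\<lambda>x. L (frag_of u * (letters x * frag_of [a] - frag_of [a] * letters x - letters (ad a x)) * frag_of v)"])
  fix c
  show "L (frag_of u * (letters (frag_of c) * frag_of [a] - frag_of [a] * letters (frag_of c)
      - letters (ad a (frag_of c))) * frag_of v) \<in> D"
    using assms(1)[of "length u + length v + 2"] assms(2) unfolding good_def by auto
qed (simp add: algebra_simps frag_extend_diff)

lemma L_D: "y \<in> D \<Longrightarrow> L (x * letters y * z) \<in> D"
  by (auto simp: letters_cmul frag_cmul_mult_left frag_cmul_mult_right L_cmul)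

text \<open>The diamond lemma. The outer induction is on the length, the inner one on the number of
  inversions. \<open>straighten\<close> resolves only the leftmost descent; a relator at another
  descent is rewritten through the relator at the leftmost one, relators in words with fewer
  inversions, and relators in shorter words.\<close>

lemma good_all: "good n"
proof (induction n rule: less_induct)
  case (less n)
  have desc: "L (frag_of u * Z b a * frag_of v) \<in> D" if "length u + length v + 2 = n" "k a < k b"
    for u v :: "'a list" and a b
    using that
  proof (induction "invs k (u @ b # a # v)" arbitrary: u v a b rule: less_induct)
    case less_invs: less
    let ?w = "u @ b # a # v"
    have "\<not> sorted (map k ?w)" using less_invs.prems(2) by (simp add: sorted_append)
    moreover obtain u' d c v' where fd: "first_descent k ?w = (u', d, c, v')" by (metis prod_cases4)
    ultimately have w: "?w = u' @ d # c # v'" and dc: "k c < k d" and srt: "sorted (map k (u' @ [d]))"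
      by (rule first_descent)+
    \<comment> \<open>At the leftmost descent the relation is the defining equation of
      \<open>straighten\<close>.\<close>
    have first: "L (frag_of u' * Z d c * frag_of v') \<in> D"
    proof -
      have "frag_of u' * Z d c * frag_of v' = frag_of (u' @ d # c # v') - frag_of (u' @ c # d # v')
          - frag_of u' * letters (\<beta> d c) * frag_of v'"
        by (simp add: ring_distribs mult.assoc flip: frag_of_append)
      then have "L (frag_of u' * Z d c * frag_of v') = straighten (u' @ d # c # v') - straighten (u' @ c # d # v')
          - frag_extend (\<lambda>x. straighten (u' @ x # v')) (\<beta> d c)"
        by (simp add: L_letters_mid)
      also have "\<dots> = 0"
        using straighten_descent[OF \<open>\<not> sorted (map k ?w)\<close> fd] w by simp
      finally show ?thesis by (simp add: D_intros)
    qed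
    \<comment> \<open>Otherwise \<open>b a\<close> would be a descent inside the sorted prefix
      \<open>u' @ [d]\<close>.\<close>
    have "length u' \<le> length u"
    proof (rule ccontr)
      assume "\<not> length u' \<le> length u"
      then obtain j where "Suc (length u') = length u + Suc (Suc j)"
        by (metis add_Suc_right less_imp_Suc_add not_le)
      moreover have "u' @ [d] = take (Suc (length u')) ?w" unfolding w by simp
      ultimately have "u' @ [d] = u @ b # a # take j v" by simp
      then have "sorted (map k (u @ b # a # take j v))" using srt by metis
      then show False using less_invs.prems(2) by (simp add: sorted_append)
    qed
    then consider "length u = length u'" | "length u = Suc (length u')" | "length u \<ge> length u' + 2" by linarith
    then show ?case
    proof cases
      case 1
      then have "u = u'" "b = d" "a = c" "v = v'" using w by auto
      then show ?thesis using first by simp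
    next
      \<comment> \<open>The two descents share the letter \<open>c\<close>: the critical subword is
        \<open>d c a\<close> with decreasing keys.\<close>
      case 2
      then have "take (Suc (length u')) ?w = u" by simp
      then have u: "u = u' @ [d]" unfolding w by simp
      then have eq: "b = c" "v' = a # v" using w by auto
      have inv1: "L (frag_of (u' @ [c]) * Z d a * frag_of v) \<in> D"
        using less_invs.hyps[of "u' @ [c]" d a v] less_invs.prems invs_swap[of k c d u' "a # v"] dc u eq by simp
      have inv2: "L (frag_of u' * Z c a * frag_of (d # v)) \<in> D"
        using less_invs.hyps[of u' c a "d # v"] less_invs.prems
          invs_swap[of k c d u' "a # v"] invs_swap[of k a d "u' @ [c]" v] dc u eq by simp
      have inv3: "L (frag_of u' * Z d a * frag_of (c # v)) \<in> D"
        using less_invs.hyps[of u' d a "c # v"] less_invs.prems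
          invs_swap[of k a c "u' @ [d]" v] dc u eq by simp
      have inv4: "L (frag_of (u' @ [a]) * Z d c * frag_of v) \<in> D"
        using less_invs.hyps[of "u' @ [a]" d c v] less_invs.prems
          invs_swap[of k a c "u' @ [d]" v] invs_swap[of k a d u' "c # v"] dc u eq by simp
      have low: "length u' + length v + 2 < n" using less_invs.prems(1) u by simp
      note ads = good_ad[OF less.IH low, of "\<beta> d c" a] good_ad[OF less.IH low, of "\<beta> d a" c]
        good_ad[OF less.IH low, of "\<beta> c a" d]
      have an: "ad c (\<beta> d a) + ad c (\<beta> a d) \<in> D"
        using frag_extend_cmul_range[OF anti[of d a]] by (simp add: frag_extend_add)
      have jac: "ad a (\<beta> d c) - ad c (\<beta> d a) + ad d (\<beta> c a) \<in> D"
      proof -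
        have "ad a (\<beta> d c) - ad c (\<beta> d a) + ad d (\<beta> c a)
           = (ad a (\<beta> d c) + ad d (\<beta> c a) + ad c (\<beta> a d)) - (ad c (\<beta> d a) + ad c (\<beta> a d))"
          by simp
        then show ?thesis using jacobi[of a d c] an D_intros(2) by metis
      qed
      define U V A C E where "U = frag_of u'" "V = frag_of v" "A = frag_of [a]" "C = frag_of [c]" "E = frag_of [d]"
      note abb = U_V_A_C_E_def
      have Lw: "frag_of (u' @ [d]) = U * E" "frag_of (u' @ [c]) = U * C" "frag_of (u' @ [a]) = U * A"
        "frag_of (d # v) = E * V" "frag_of (c # v) = C * V" "frag_of (a # v) = A * V"
        by (simp_all add: abb frag_of_append frag_of_Cons[of _ v])
      \<comment> \<open>The identity compares the two ways of reversing \<open>d c a\<close>. Its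
        \<open>Z\<close> terms are covered by \<open>first\<close> and the inner induction, the
        terms with one bracket by \<open>good_ad\<close>, and the last term is the Jacobi
        sum.\<close>
      have "U * E * Z c a * V = U * Z d c * (A * V) + U * C * Z d a * V + U * Z c a * (E * V)
          - U * Z d a * (C * V) - U * A * Z d c * V
          + U * (letters (\<beta> d c) * A - A * letters (\<beta> d c) - letters (ad a (\<beta> d c))) * V
          - U * (letters (\<beta> d a) * C - C * letters (\<beta> d a) - letters (ad c (\<beta> d a))) * V
          + U * (letters (\<beta> c a) * E - E * letters (\<beta> c a) - letters (ad d (\<beta> c a))) * V
          + U * letters (ad a (\<beta> d c) - ad c (\<beta> d a) + ad d (\<beta> c a)) * V"
        by (simp add: abb(3-5)[symmetric] algebra_simps)
      then have "L (U * E * Z c a * V) = L (U * Z d c * (A * V)) + L (U * C * Z d a * V) + L (U * Z c a * (E * V))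
          - L (U * Z d a * (C * V)) - L (U * A * Z d c * V)
          + L (U * (letters (\<beta> d c) * A - A * letters (\<beta> d c) - letters (ad a (\<beta> d c))) * V)
          - L (U * (letters (\<beta> d a) * C - C * letters (\<beta> d a) - letters (ad c (\<beta> d a))) * V)
          + L (U * (letters (\<beta> c a) * E - E * letters (\<beta> c a) - letters (ad d (\<beta> c a))) * V)
          + L (U * letters (ad a (\<beta> d c) - ad c (\<beta> d a) + ad d (\<beta> c a)) * V)"
        by (simp only: L_simps)
      moreover have "\<dots> \<in> D"
        unfolding abb by (intro D_intros(1,2) L_D[OF jac] first[unfolded eq(2) Lw abb] inv1[unfolded Lw abb]
            inv2[unfolded Lw abb] inv3[unfolded Lw abb] inv4[unfolded Lw abb] ads)
      ultimately show ?thesis using eq u Lw abb by simp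
    next
      \<comment> \<open>The descents are disjoint, with \<open>m\<close> between them, and can be
        resolved in either order.\<close>
      case 3
      have "take (length u) ?w = u" by simp
      then have "u = u' @ d # c # take (length u - length u' - 2) v'"
        unfolding w using 3 by (simp add: take_Cons')
      then obtain m where u: "u = u' @ d # c # m" by blast
      then have v': "v' = m @ b # a # v" using w by simp
      have low: "length u' + length m + length v + 3 < n" using less_invs.prems(1) u by simp
      have inv1: "L (frag_of u' * Z d c * frag_of (m @ a # b # v)) \<in> D"
        using less_invs.hyps[of u' d c "m @ a # b # v"] less_invs.prems
          invs_swap[of k a b "u' @ d # c # m" v] dc u by simp
      have inv2: "L (frag_of (u' @ c # d # m) * Z b a * frag_of v) \<in> D"
        using less_invs.hyps[of "u' @ c # d # m" b a v] less_invs.prems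
          invs_swap[of k c d u' "m @ b # a # v"] dc u by simp
      note lows = good_letters_left[OF less.IH low, of "\<beta> d c" b a] good_letters_right[OF less.IH low, of d c "\<beta> b a"]
      define U V M A B C E where "U = frag_of u'" "V = frag_of v" "M = frag_of m"
        "A = frag_of [a]" "B = frag_of [b]" "C = frag_of [c]" "E = frag_of [d]"
      note abb = U_V_M_A_B_C_E_def
      have Lw: "frag_of u = U * E * C * M" "frag_of v' = M * B * A * V" "frag_of (m @ a # b # v) = M * A * B * V"
          "frag_of (u' @ c # d # m) = U * C * E * M"
        unfolding u v' by (simp_all add: abb frag_of_append frag_of_Cons[of _ "_ # _"] frag_of_Cons[of _ m]
          frag_of_Cons[of _ v] mult.assoc)
      have "U * E * C * M * Z b a * V = U * Z d c * (M * B * A * V) - U * Z d c * (M * A * B * V)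
         - U * Z d c * M * letters (\<beta> b a) * V
         + U * C * E * M * Z b a * V + U * letters (\<beta> d c) * M * Z b a * V"
        by (simp add: abb(4-7)[symmetric] algebra_simps)
      then have "L (U * E * C * M * Z b a * V) = L (U * Z d c * (M * B * A * V)) - L (U * Z d c * (M * A * B * V))
         - L (U * Z d c * M * letters (\<beta> b a) * V)
         + L (U * C * E * M * Z b a * V) + L (U * letters (\<beta> d c) * M * Z b a * V)"
        by (simp only: L_simps)
      moreover have "\<dots> \<in> D"
        unfolding abb by (intro D_intros(1,2) first[unfolded Lw abb] inv1[unfolded Lw abb]
            inv2[unfolded Lw abb] lows)
      ultimately show ?thesis using Lw abb by simp
    qed
  qed
  show ?case
    unfolding good_def
  proof (intro allI impI)
    fix u v :: "'a list" and a b assume n: "length u + length v + 2 = n"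
    consider "k b < k a" | "a = b" | "k a < k b" using inj_k by (metis injD linorder_neqE_nat)
    then show "L (frag_of u * Z a b * frag_of v) \<in> D"
    proof cases
      case 1
      then show ?thesis using desc n by blast
    next
      case 2
      then show ?thesis using L_D[OF alt[of b], of "frag_of u" "frag_of v"]
        by (simp add: ring_distribs D_intros)
    next
      case 3
      have "frag_of u * Z a b * frag_of v = - (frag_of u * Z b a * frag_of v)
          - frag_of u * letters (\<beta> a b + \<beta> b a) * frag_of v"
        by (simp add: algebra_simps)
      then have "L (frag_of u * Z a b * frag_of v) = - L (frag_of u * Z b a * frag_of v)
          - L (frag_of u * letters (\<beta> a b + \<beta> b a) * frag_of v)"
        by (simp only: L_simps)
      then show ?thesis using D_intros(2) D_intros(4) L_D[OF anti] desc[OF n 3] by metis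
    qed
  qed
qed

lemma pbw: "L (x * Z a b * y) \<in> D"
proof (rule add_subgroup_linear[OF D_group, where f = "\<lambda>x. L (x * Z a b * y)"])
  fix u :: "'a list"
  show "L (frag_of u * Z a b * y) \<in> D"
  proof (rule add_subgroup_linear[OF D_group, where f = "\<lambda>y. L (frag_of u * Z a b * y)"])
    show "L (frag_of u * Z a b * frag_of v) \<in> D" for v :: "'a list"
      using good_all by (simp add: good_def)
  qed (simp add: algebra_simps)
qed (simp add: algebra_simps)

end

section \<open>Lie polynomials\<close>

text \<open>Formal bracketings without any Lie law. Their combinations form the free nonassociative
  ring, so evaluation in a graded Lie ring can be defined tree by tree; the laws enter through
  \<open>lie_span\<close>.\<close>

datatype 'g lie_tree = Leaf 'g | Br "'g lie_tree" "'g lie_tree"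

text \<open>The codes order the trees when a basis modulo \<open>p\<close> is chosen.\<close>

instance lie_tree :: (countable) countable
  by countable_datatype

primrec deg :: "'g lie_tree \<Rightarrow> nat" where
  "deg (Leaf g) = 1"
| "deg (Br a b) = deg a + deg b"

primrec assoc :: "'g lie_tree \<Rightarrow> ('g list \<Rightarrow>\<^sub>0 int)" where
  "assoc (Leaf g) = frag_of [g]"
| "assoc (Br a b) = assoc a * assoc b - assoc b * assoc a"

abbreviation "assocs \<equiv> frag_extend assoc"

definition adr :: "'g lie_tree \<Rightarrow> ('g lie_tree \<Rightarrow>\<^sub>0 int) \<Rightarrow> ('g lie_tree \<Rightarrow>\<^sub>0 int)" where
  "adr a = frag_extend (\<lambda>x. frag_of (Br x a))"

definition adl :: "'g lie_tree \<Rightarrow> ('g lie_tree \<Rightarrow>\<^sub>0 int) \<Rightarrow> ('g lie_tree \<Rightarrow>\<^sub>0 int)" where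
  "adl a = frag_extend (\<lambda>x. frag_of (Br a x))"

lemma adr_simps [simp]: "adr a 0 = 0" "adr a (frag_of x) = frag_of (Br x a)"
  "adr a (P - Q) = adr a P - adr a Q" "adr a (P + Q) = adr a P + adr a Q"
  by (simp_all add: adr_def frag_extend_diff frag_extend_add)

lemma adl_simps [simp]: "adl a 0 = 0" "adl a (frag_of x) = frag_of (Br a x)"
  "adl a (P - Q) = adl a P - adl a Q" "adl a (P + Q) = adl a P + adl a Q"
  by (simp_all add: adl_def frag_extend_diff frag_extend_add)

definition lbr :: "('g lie_tree \<Rightarrow>\<^sub>0 int) \<Rightarrow> ('g lie_tree \<Rightarrow>\<^sub>0 int) \<Rightarrow> ('g lie_tree \<Rightarrow>\<^sub>0 int)" where
  "lbr P Q = frag_extend (\<lambda>a. adl a Q) P"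

lemma lbr_simps [simp]: "lbr 0 Q = 0" "lbr (P - P') Q = lbr P Q - lbr P' Q" "lbr (frag_of a) Q = adl a Q"
  by (simp_all add: lbr_def frag_extend_diff)

lemma lbr_diff_right: "lbr P (Q - Q') = lbr P Q - lbr P Q'"
  by (induction P rule: frag_ind) simp_all

lemma lbr_frag_of: "lbr P (frag_of a) = adr a P"
  by (simp add: lbr_def adr_def)

lemma assocs_lbr: "assocs (lbr P Q) = assocs P * assocs Q - assocs Q * assocs P"
proof (induction P rule: frag_ind)
  case (one a)
  show ?case by (induction Q rule: frag_ind) (simp_all add: frag_extend_diff ring_distribs)
qed (simp_all add: frag_extend_diff ring_distribs)

lemma deg_keys_lbr:
  assumes "\<forall>\<tau>\<in>Poly_Mapping.keys P. deg \<tau> = c" "\<forall>\<tau>\<in>Poly_Mapping.keys Q. deg \<tau> = d"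
  shows "\<forall>\<tau>\<in>Poly_Mapping.keys (lbr P Q). deg \<tau> = c + d"
proof
  fix \<tau> assume "\<tau> \<in> Poly_Mapping.keys (lbr P Q)"
  then obtain a where a: "a \<in> Poly_Mapping.keys P" "\<tau> \<in> Poly_Mapping.keys (adl a Q)"
    using keys_frag_extend[of "\<lambda>a. adl a Q" P] by (auto simp: lbr_def)
  then obtain b where "b \<in> Poly_Mapping.keys Q" "\<tau> = Br a b"
    using keys_frag_extend[of "\<lambda>x. frag_of (Br a x)" Q] by (auto simp: adl_def)
  then show "deg \<tau> = c + d" using a assms by simp
qed

text \<open>Modulo this subgroup the combinations of trees form the Lie ring presented by
  \<open>R\<close>. Closure under \<open>adr\<close> is enough for an ideal: \<open>anti\<close>
  supplies the left brackets.\<close>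

inductive_set lie_span :: "'g lie_tree set \<Rightarrow> ('g lie_tree \<Rightarrow>\<^sub>0 int) set" for R where
  zero: "0 \<in> lie_span R"
| diff: "P \<in> lie_span R \<Longrightarrow> Q \<in> lie_span R \<Longrightarrow> P - Q \<in> lie_span R"
| alt: "frag_of (Br a a) \<in> lie_span R"
| anti: "frag_of (Br a b) + frag_of (Br b a) \<in> lie_span R"
| jacobi: "frag_of (Br (Br a b) c) + frag_of (Br (Br b c) a) + frag_of (Br (Br c a) b) \<in> lie_span R"
| rel: "\<rho> \<in> R \<Longrightarrow> frag_of \<rho> \<in> lie_span R"
| adr: "P \<in> lie_span R \<Longrightarrow> adr a P \<in> lie_span R"

lemma lie_span_subgroup: "add_subgroup (lie_span R)"
  by (simp add: add_subgroup_def lie_span.zero lie_span.diff)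

lemmas lie_span_add = add_subgroup_add[OF lie_span_subgroup]
  and lie_span_cmul = add_subgroup_cmul[OF lie_span_subgroup]
  and lie_span_linear = add_subgroup_linear[OF lie_span_subgroup]

lemma adl_adr: "adl a P + adr a P \<in> lie_span R"
  by (rule lie_span_linear[where f = "\<lambda>P. adl a P + adr a P"]) (simp_all add: lie_span.anti)

lemma lie_span_adl:
  assumes "P \<in> lie_span R"
  shows "adl a P \<in> lie_span R"
  using lie_span.diff[OF adl_adr[of a P R] lie_span.adr[OF assms, of a]] by simp

text \<open>Jacobi in operator form: right brackets represent the Lie ring on itself, with products
  of operators read from left to right.\<close>

lemma adr_Br: "adr b (adr a P) - adr a (adr b P) - adr (Br a b) P \<in> lie_span R"
proof (rule lie_span_linear[where f = "\<lambda>P. adr b (adr a P) - adr a (adr b P) - adr (Br a b) P"])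
  fix x
  have "adr a (frag_of (Br b x) + frag_of (Br x b)) \<in> lie_span R"
    by (intro lie_span.adr lie_span.anti)
  then have "(frag_of (Br (Br x a) b) + frag_of (Br (Br a b) x) + frag_of (Br (Br b x) a))
      - (frag_of (Br (Br a b) x) + frag_of (Br x (Br a b))) - (frag_of (Br (Br b x) a) + frag_of (Br (Br x b) a))
      \<in> lie_span R"
    by (intro lie_span.diff lie_span.jacobi lie_span.anti) simp
  then show "adr b (adr a (frag_of x)) - adr a (adr b (frag_of x)) - adr (Br a b) (frag_of x) \<in> lie_span R"
    by (simp add: algebra_simps)
qed (simp add: algebra_simps)

text \<open>The quotient of the free ring by this two-sided ideal is the enveloping ring of the Lie
  ring presented by \<open>R\<close>.\<close>

inductive_set assoc_ideal :: "'g lie_tree set \<Rightarrow> ('g list \<Rightarrow>\<^sub>0 int) set" for R where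
  zero: "0 \<in> assoc_ideal R"
| diff: "x \<in> assoc_ideal R \<Longrightarrow> y \<in> assoc_ideal R \<Longrightarrow> x - y \<in> assoc_ideal R"
| rel: "\<rho> \<in> R \<Longrightarrow> u * assoc \<rho> * v \<in> assoc_ideal R"

lemma assoc_ideal_subgroup: "add_subgroup (assoc_ideal R)"
  by (simp add: add_subgroup_def assoc_ideal.zero assoc_ideal.diff)

lemma assoc_ideal_mult: "x \<in> assoc_ideal R \<Longrightarrow> u * x * v \<in> assoc_ideal R"
proof (induction rule: assoc_ideal.induct)
  case (rel \<rho> u' v')
  have "u * (u' * assoc \<rho> * v') * v = (u * u') * assoc \<rho> * (v' * v)" by (simp add: mult.assoc)
  then show ?case using assoc_ideal.rel[OF rel] by metis
qed (simp_all add: assoc_ideal.zero assoc_ideal.diff ring_distribs)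

lemma assocs_adr: "assocs (adr a P) = assocs P * assoc a - assoc a * assocs P"
  by (induction P rule: frag_ind) (simp_all add: frag_extend_diff ring_distribs)

lemma assocs_lie_span: "P \<in> lie_span R \<Longrightarrow> assocs P \<in> assoc_ideal R"
proof (induction rule: lie_span.induct)
  case (rel \<rho>)
  then show ?case using assoc_ideal.rel[of \<rho> R 1 1] by simp
next
  case (adr P a)
  then show ?case
    using assoc_ideal_mult[of "assocs P" R 1 "assoc a"] assoc_ideal_mult[of "assocs P" R "assoc a" 1]
    by (simp add: assocs_adr assoc_ideal.diff)
next
  case (jacobi a b c)
  have "assocs (frag_of (Br (Br a b) c) + frag_of (Br (Br b c) a) + frag_of (Br (Br c a) b)) = 0"
    by (simp add: frag_extend_add algebra_simps)
  then show ?case by (simp add: assoc_ideal.zero)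
qed (simp_all add: frag_extend_add frag_extend_diff assoc_ideal.zero assoc_ideal.diff)

subsection \<open>The Dynkin operator\<close>

text \<open>A right module over the free ring, given by one operator per generator. It serves twice:
  with right brackets for Dynkin's operator, and with \<open>gen_act\<close> for the enveloping
  ring.\<close>

definition word_act :: "('g \<Rightarrow> ('v \<Rightarrow>\<^sub>0 int) \<Rightarrow> ('v \<Rightarrow>\<^sub>0 int)) \<Rightarrow> ('g list \<Rightarrow>\<^sub>0 int) \<Rightarrow> ('v \<Rightarrow>\<^sub>0 int) \<Rightarrow> ('v \<Rightarrow>\<^sub>0 int)" where
  "word_act f x P = frag_extend (\<lambda>w. fold f w P) x"

lemma word_act_simps [simp]: "word_act f 0 P = 0" "word_act f (x - y) P = word_act f x P - word_act f y P"
  "word_act f (frag_of w) P = fold f w P"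
  by (simp_all add: word_act_def frag_extend_diff)

lemma word_act_diff:
  assumes "\<And>g P Q. f g (P - Q) = f g P - f g Q"
  shows "word_act f x (P - Q) = word_act f x P - word_act f x Q"
proof -
  have "fold f w (P - Q) = fold f w P - fold f w Q" for w
    by (induction w arbitrary: P Q) (simp_all add: assms)
  then show ?thesis by (induction x rule: frag_ind) simp_all
qed

lemma word_act_mult:
  assumes "\<And>g P Q. f g (P - Q) = f g P - f g Q"
  shows "word_act f (x * y) P = word_act f y (word_act f x P)"
proof (induction x rule: frag_ind)
  case zero
  show ?case using word_act_diff[of f y 0 0] assms by simp
next
  case (one u)
  show ?case
    by (induction y rule: frag_ind) (simp_all add: ring_distribs flip: frag_of_append)
qed (simp add: ring_distribs word_act_diff assms)

lemma word_act_closed: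
  assumes "add_subgroup H" "\<And>g P. P \<in> H \<Longrightarrow> f g P \<in> H" "P \<in> H"
  shows "word_act f x P \<in> H"
proof (rule add_subgroup_linear[OF assms(1), where f = "\<lambda>x. word_act f x P"])
  show "word_act f (frag_of w) P \<in> H" for w
    using assms(3) by (induction w arbitrary: P) (simp_all add: assms(2))
qed simp

definition ring_ext :: "('a \<Rightarrow> ('b list \<Rightarrow>\<^sub>0 int)) \<Rightarrow> ('a list \<Rightarrow>\<^sub>0 int) \<Rightarrow> ('b list \<Rightarrow>\<^sub>0 int)" where
  "ring_ext f = frag_extend (\<lambda>w. prod_list (map f w))"

lemma ring_ext_simps [simp]: "ring_ext f 0 = 0" "ring_ext f (x - y) = ring_ext f x - ring_ext f y"
  "ring_ext f (x + y) = ring_ext f x + ring_ext f y" "ring_ext f (frag_of w) = prod_list (map f w)"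
  by (simp_all add: ring_ext_def frag_extend_diff frag_extend_add)

lemma ring_ext_cmul: "ring_ext f (frag_cmul c x) = frag_cmul c (ring_ext f x)"
  by (simp add: ring_ext_def frag_extend_cmul)

lemma ring_ext_mult: "ring_ext f (x * y) = ring_ext f x * ring_ext f y"
proof (induction x rule: frag_ind)
  case (one u)
  show ?case
    by (induction y rule: frag_ind) (simp_all add: ring_distribs flip: frag_of_append)
qed (simp_all add: ring_distribs)

abbreviation "act \<equiv> word_act (\<lambda>g. adr (Leaf g))"

lemmas act_diff = word_act_diff[where f = "\<lambda>g. adr (Leaf g)", OF adr_simps(3)]
  and act_mult = word_act_mult[where f = "\<lambda>g. adr (Leaf g)", OF adr_simps(3)]

lemma act_zero [simp]: "act x 0 = 0"
  using act_diff[of x 0 0] by simp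

lemma act_lie_span: "P \<in> lie_span R \<Longrightarrow> act x P \<in> lie_span R"
  by (rule word_act_closed[OF lie_span_subgroup lie_span.adr])

text \<open>This is the adjoint action of the enveloping ring: by \<open>adr_Br\<close>, the
  expansion of a tree acts as the bracket with that tree.\<close>

lemma act_assoc: "act (assoc \<tau>) P - adr \<tau> P \<in> lie_span R"
proof (induction \<tau> arbitrary: P)
  case (Leaf g)
  then show ?case by (simp add: lie_span.zero)
next
  case (Br a b)
  have ab: "act (assoc b) (act (assoc a) P) - adr b (adr a P) \<in> lie_span R"
    using lie_span_add[OF Br(2)[of "act (assoc a) P"] lie_span.adr[OF Br(1)[of P], of b]] by simp
  have ba: "act (assoc a) (act (assoc b) P) - adr a (adr b P) \<in> lie_span R"
    using lie_span_add[OF Br(1)[of "act (assoc b) P"] lie_span.adr[OF Br(2)[of P], of a]] by simp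
  show ?case
    using lie_span_add[OF lie_span.diff[OF ab ba] adr_Br[of b a P]] by (simp add: act_mult)
qed

definition dynkin :: "('g list \<Rightarrow>\<^sub>0 int) \<Rightarrow> ('g lie_tree \<Rightarrow>\<^sub>0 int)" where
  "dynkin = frag_extend (\<lambda>w. case w of [] \<Rightarrow> 0 | g # w \<Rightarrow> fold (\<lambda>g. adr (Leaf g)) w (frag_of (Leaf g)))"

lemma dynkin_simps [simp]: "dynkin 0 = 0" "dynkin (x - y) = dynkin x - dynkin y" "dynkin (frag_of []) = 0"
  "dynkin (frag_of (g # w)) = fold (\<lambda>g. adr (Leaf g)) w (frag_of (Leaf g))"
  by (simp_all add: dynkin_def frag_extend_diff)

text \<open>Bracketing a concatenation continues the left-normed bracketing of the first factor,
  unless this factor is empty; hence the constant coefficient.\<close>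

lemma dynkin_mult: "dynkin (x * y) = act y (dynkin x) + frag_cmul (Poly_Mapping.lookup x []) (dynkin y)"
proof (induction x rule: frag_ind)
  case (one u)
  show ?case
  proof (induction y rule: frag_ind)
    case (one v)
    then show ?case by (cases u) (simp_all flip: frag_of_append)
  qed (simp_all add: ring_distribs)
next
  case (diff x x')
  then show ?case by (simp add: ring_distribs lookup_minus frag_cmul_diff_distrib act_diff)
qed simp

lemma lookup_mult_Nil: "Poly_Mapping.lookup (x * y) [] = Poly_Mapping.lookup x [] * (Poly_Mapping.lookup y [] :: int)"
proof (induction x rule: frag_ind)
  case (one u)
  show ?case
    by (induction y rule: frag_ind) (auto simp: ring_distribs lookup_minus simp flip: frag_of_append)
qed (simp_all add: ring_distribs lookup_minus)

lemma lookup_assoc_Nil [simp]: "Poly_Mapping.lookup (assoc \<tau>) [] = 0"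
  by (induction \<tau>) (simp_all add: lookup_minus lookup_mult_Nil)

text \<open>The theorem of Dynkin, Specht and Wever. Expansions of trees have no constant term, so
  by \<open>dynkin_mult\<close> and \<open>act_assoc\<close> the operator is a derivation on
  brackets, and every leaf contributes the tree once.\<close>

lemma dynkin_assoc: "dynkin (assoc \<tau>) - frag_cmul (int (deg \<tau>)) (frag_of \<tau>) \<in> lie_span R"
proof (induction \<tau>)
  case (Leaf g)
  then show ?case by (simp add: lie_span.zero)
next
  case (Br a b)
  have adr_cmul: "adr c (frag_cmul m (frag_of d)) = frag_cmul m (frag_of (Br d c))" for c d :: "'a lie_tree" and m
    by (simp add: adr_def frag_extend_cmul)
  have ab: "act (assoc b) (dynkin (assoc a)) - frag_cmul (int (deg a)) (frag_of (Br a b)) \<in> lie_span R"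
    using lie_span_add[OF act_assoc[of b "dynkin (assoc a)" R] lie_span.adr[OF Br(1), of b]]
    by (simp add: adr_cmul del: minus_frag_cmul)
  have ba: "act (assoc a) (dynkin (assoc b)) - frag_cmul (int (deg b)) (frag_of (Br b a)) \<in> lie_span R"
    using lie_span_add[OF act_assoc[of a "dynkin (assoc b)" R] lie_span.adr[OF Br(2), of a]]
    by (simp add: adr_cmul del: minus_frag_cmul)
  have "frag_cmul (int (deg b)) (frag_of (Br a b) + frag_of (Br b a)) \<in> lie_span R"
    by (intro lie_span_cmul lie_span.anti)
  from lie_span.diff[OF lie_span.diff[OF ab ba] this] show ?case
    by (simp add: dynkin_mult frag_cmul_distrib frag_cmul_distrib2 algebra_simps)
qed

lemma dynkin_assocs:
  assumes "\<forall>\<tau>\<in>Poly_Mapping.keys P. deg \<tau> = c"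
  shows "dynkin (assocs P) - frag_cmul (int c) P \<in> lie_span R"
proof -
  have "Poly_Mapping.keys P \<subseteq> {\<tau>. deg \<tau> = c}" using assms by blast
  then show ?thesis
  proof (induction P rule: frag_induction)
    case (one \<tau>)
    then show ?case using dynkin_assoc[of \<tau> R] by simp
  next
    case (diff P Q)
    then show ?case using lie_span.diff[OF diff] by (simp add: frag_extend_diff frag_cmul_diff algebra_simps)
  qed (simp add: lie_span.zero)
qed

text \<open>In \<open>u * assoc \<rho> * v\<close> the relator is bracketed with the image of
  \<open>u\<close> or, through the constant term of \<open>u\<close>, contributes a multiple of
  itself.\<close>

lemma dynkin_assoc_ideal: "x \<in> assoc_ideal R \<Longrightarrow> dynkin x \<in> lie_span R"
proof (induction rule: assoc_ideal.induct)
  case (rel \<rho> u v)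
  have "act (assoc \<rho>) (dynkin u) \<in> lie_span R"
  proof -
    have "adl \<rho>' (frag_of \<rho>) \<in> lie_span R" for \<rho>' by (intro lie_span_adl lie_span.rel rel)
    then have "adr \<rho> (frag_of \<rho>') \<in> lie_span R" for \<rho>' by simp
    then have "adr \<rho> (dynkin u) \<in> lie_span R"
      by (intro lie_span_linear[where f = "adr \<rho>" and x = "dynkin u"] adr_simps)
    from lie_span_add[OF act_assoc[of \<rho> "dynkin u"] this] show ?thesis by simp
  qed
  moreover have "dynkin (assoc \<rho>) \<in> lie_span R"
    using lie_span_add[OF dynkin_assoc[of \<rho>] lie_span_cmul[OF lie_span.rel[OF rel], of "int (deg \<rho>)"]] by simp
  ultimately show ?case
    by (simp add: dynkin_mult lookup_mult_Nil act_lie_span lie_span_add lie_span_cmul)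
qed (simp_all add: lie_span.zero lie_span.diff)

subsection \<open>Homogeneous components\<close>

definition hcomp :: "nat \<Rightarrow> ('g lie_tree \<Rightarrow>\<^sub>0 int) \<Rightarrow> ('g lie_tree \<Rightarrow>\<^sub>0 int)" where
  "hcomp c = frag_extend (\<lambda>\<tau>. if deg \<tau> = c then frag_of \<tau> else 0)"

lemma hcomp_simps [simp]: "hcomp c 0 = 0" "hcomp c (P - Q) = hcomp c P - hcomp c Q"
  "hcomp c (P + Q) = hcomp c P + hcomp c Q" "hcomp c (frag_of \<tau>) = (if deg \<tau> = c then frag_of \<tau> else 0)"
  by (simp_all add: hcomp_def frag_extend_diff frag_extend_add)

lemma hcomp_adr: "hcomp c (adr a P) = (if deg a \<le> c then adr a (hcomp (c - deg a) P) else 0)"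
  by (induction P rule: frag_ind) auto

text \<open>The relators are single trees and the Lie laws are homogeneous, so the span is
  graded.\<close>

lemma hcomp_lie_span: "P \<in> lie_span R \<Longrightarrow> hcomp c P \<in> lie_span R"
proof (induction arbitrary: c rule: lie_span.induct)
  case (anti a b)
  then show ?case using lie_span.anti[of a b R] by (simp add: lie_span.zero add.commute)
next
  case (jacobi a b d)
  then show ?case using lie_span.jacobi[of a b d R] by (simp add: lie_span.zero algebra_simps)
next
  case (rel \<rho>)
  then show ?case by (simp add: lie_span.rel lie_span.zero)
qed (simp_all add: hcomp_adr lie_span.zero lie_span.diff lie_span.alt lie_span.adr)

lemma hcomp_homogeneous: "\<forall>\<tau>\<in>Poly_Mapping.keys P. deg \<tau> = c \<Longrightarrow> hcomp c P = P"
  using frag_extend_eq[of P "\<lambda>\<tau>. if deg \<tau> = c then frag_of \<tau> else 0" frag_of]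
  by (simp add: hcomp_def flip: frag_expansion)

lemma deg_keys_hcomp: "\<tau> \<in> Poly_Mapping.keys (hcomp c P) \<Longrightarrow> deg \<tau> = c"
  using keys_frag_extend[of "\<lambda>\<tau>. if deg \<tau> = c then frag_of \<tau> else 0" P]
  by (auto simp: hcomp_def split: if_splits)

subsection \<open>Reduction modulo a prime\<close>

locale lie_mod_prime =
  fixes R :: "'g::countable lie_tree set" and p :: int
  assumes prime_p: "prime p"
begin

text \<open>The kernel of the map from Lie polynomials to the presented Lie ring modulo
  \<open>p\<close>.\<close>

definition N :: "('g lie_tree \<Rightarrow>\<^sub>0 int) set" where
  "N = {P. \<exists>Q. P - frag_cmul p Q \<in> lie_span R}"

lemma N_I: "P \<in> lie_span R \<Longrightarrow> P \<in> N"
  unfolding N_def by (auto intro!: exI[of _ 0])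

lemma N_subgroup: "add_subgroup N"
  unfolding add_subgroup_def
proof (intro conjI ballI)
  show "0 \<in> N" by (rule N_I[OF lie_span.zero])
  fix P Q assume "P \<in> N" "Q \<in> N"
  then obtain P' Q' where "P - frag_cmul p P' \<in> lie_span R" "Q - frag_cmul p Q' \<in> lie_span R"
    by (auto simp: N_def)
  from lie_span.diff[OF this] have "P - Q - frag_cmul p (P' - Q') \<in> lie_span R"
    by (simp add: frag_cmul_diff algebra_simps)
  then show "P - Q \<in> N" by (auto simp: N_def)
qed

lemmas N_diff = add_subgroup_diff[OF N_subgroup]
  and N_add = add_subgroup_add[OF N_subgroup]
  and N_uminus = add_subgroup_uminus[OF N_subgroup]
  and N_cmul = add_subgroup_cmul[OF N_subgroup]
  and N_linear = add_subgroup_linear[OF N_subgroup]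

lemma N_range: "P \<in> range (frag_cmul p) \<Longrightarrow> P \<in> N"
proof -
  assume "P \<in> range (frag_cmul p)"
  then obtain Q where "P = frag_cmul p Q" by blast
  then have "P - frag_cmul p Q \<in> lie_span R" by (simp add: lie_span.zero)
  then show ?thesis by (auto simp: N_def)
qed

lemma N_adr: "P \<in> N \<Longrightarrow> adr a P \<in> N"
proof -
  assume "P \<in> N"
  then obtain Q where "P - frag_cmul p Q \<in> lie_span R" by (auto simp: N_def)
  from lie_span.adr[OF this, of a] have "adr a P - frag_cmul p (adr a Q) \<in> lie_span R"
    by (simp add: adr_def frag_extend_cmul frag_extend_diff)
  then show ?thesis by (auto simp: N_def)
qed

lemma N_adl: "P \<in> N \<Longrightarrow> adl a P \<in> N"
  using N_diff[OF N_I[OF adl_adr[of a P R]] N_adr[of P a]] by simp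

text \<open>
  The basis of the Lie ring modulo \<open>p\<close> formed by the trees that do not reduce to trees with a
  smaller code.
\<close>

definition B :: "'g lie_tree set" where
  "B = {\<tau>. \<nexists>P. Poly_Mapping.keys P \<subseteq> {\<sigma>. to_nat \<sigma> < to_nat \<tau>} \<and> frag_of \<tau> - P \<in> N}"

lemma normal_form_exists: "\<exists>P. Poly_Mapping.keys P \<subseteq> B \<and> frag_of \<tau> - P \<in> N"
proof (induction "to_nat \<tau>" arbitrary: \<tau> rule: less_induct)
  case less
  show ?case
  proof (cases "\<tau> \<in> B")
    case True
    then show ?thesis
      by (intro exI[of _ "frag_of \<tau>"]) (simp add: add_subgroup_zero[OF N_subgroup])
  next
    case False
    then obtain P where P: "Poly_Mapping.keys P \<subseteq> {\<sigma>. to_nat \<sigma> < to_nat \<tau>}" "frag_of \<tau> - P \<in> N"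
      by (auto simp: B_def)
    have "\<exists>Q. Poly_Mapping.keys Q \<subseteq> B \<and> P - Q \<in> N"
      using P(1)
    proof (induction P rule: frag_induction)
      case zero
      then show ?case by (intro exI[of _ 0]) (simp add: add_subgroup_zero[OF N_subgroup])
    next
      case (one \<sigma>)
      then show ?case using less.hyps by simp
    next
      case (diff P1 P2)
      then obtain Q1 Q2 where Q: "Poly_Mapping.keys Q1 \<subseteq> B" "P1 - Q1 \<in> N"
        "Poly_Mapping.keys Q2 \<subseteq> B" "P2 - Q2 \<in> N" by blast
      then have "Poly_Mapping.keys (Q1 - Q2) \<subseteq> B" using keys_diff[of Q1 Q2] by blast
      moreover have "P1 - P2 - (Q1 - Q2) \<in> N" using N_diff[OF Q(2,4)] by (simp add: algebra_simps)
      ultimately show ?case by blast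
    qed
    then obtain Q where "Poly_Mapping.keys Q \<subseteq> B" "P - Q \<in> N" by blast
    then show ?thesis using N_add[OF P(2), of "P - Q"] by auto
  qed
qed

definition nf :: "'g lie_tree \<Rightarrow> ('g lie_tree \<Rightarrow>\<^sub>0 int)" where
  "nf \<tau> = (SOME P. Poly_Mapping.keys P \<subseteq> B \<and> frag_of \<tau> - P \<in> N)"

lemma nf: "Poly_Mapping.keys (nf \<tau>) \<subseteq> B" "frag_of \<tau> - nf \<tau> \<in> N"
  using someI_ex[OF normal_form_exists[of \<tau>]] by (simp_all add: nf_def)

abbreviation "nfs \<equiv> frag_extend nf"

lemma nfs: "Poly_Mapping.keys (nfs P) \<subseteq> B" "P - nfs P \<in> N"
proof -
  show "Poly_Mapping.keys (nfs P) \<subseteq> B" using keys_frag_extend[of nf P] nf(1) by blast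
  show "P - nfs P \<in> N"
    by (rule N_linear[where f = "\<lambda>P. P - nfs P"]) (simp_all add: frag_extend_diff nf)
qed

text \<open>A relation modulo \<open>p\<close> with a nonzero coefficient could be solved for its
  tree of largest code, which would then reduce to trees with smaller codes.\<close>

lemma independent:
  assumes "Poly_Mapping.keys P \<subseteq> B" "P \<in> N"
  shows "P \<in> range (frag_cmul p)"
proof -
  \<comment> \<open>\<open>P1\<close> keeps the terms whose coefficients are prime to
    \<open>p\<close>; the others are harmless.\<close>
  define P1 where "P1 = frag_extend (\<lambda>\<tau>. if p dvd Poly_Mapping.lookup P \<tau> then 0 else frag_of \<tau>) P"
  define P2 where "P2 = frag_extend (\<lambda>\<tau>. if p dvd Poly_Mapping.lookup P \<tau> then frag_of \<tau> else 0) P"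
  have P12: "P = P1 + P2"
  proof -
    have "P1 + P2 = frag_extend frag_of P"
      unfolding P1_def P2_def frag_extend_def by (simp flip: sum.distrib) (rule sum.cong, auto)
    then show ?thesis by (simp flip: frag_expansion)
  qed
  have P2: "P2 \<in> range (frag_cmul p)"
    unfolding P2_def frag_extend_def
  proof (rule add_subgroup_sum[OF add_subgroup_cmul_range])
    fix \<tau>
    show "frag_cmul (Poly_Mapping.lookup P \<tau>) (if p dvd Poly_Mapping.lookup P \<tau> then frag_of \<tau> else 0)
        \<in> range (frag_cmul p)"
      by (cases "p dvd Poly_Mapping.lookup P \<tau>")
        (auto elim!: dvdE simp: add_subgroup_zero[OF add_subgroup_cmul_range] simp flip: frag_cmul_cmul)
  qed
  have "P1 = 0"
  proof (rule ccontr)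
    assume "P1 \<noteq> 0"
    then have fin: "finite (to_nat ` Poly_Mapping.keys P1)" "to_nat ` Poly_Mapping.keys P1 \<noteq> {}" by auto
    then obtain \<tau> where \<tau>: "\<tau> \<in> Poly_Mapping.keys P1" "to_nat \<tau> = Max (to_nat ` Poly_Mapping.keys P1)"
      using Max_in[OF fin] by force
    have keys1: "Poly_Mapping.keys P1 \<subseteq> {\<tau> \<in> B. \<not> p dvd Poly_Mapping.lookup P \<tau>}"
      using keys_frag_extend[of "\<lambda>\<tau>. if p dvd Poly_Mapping.lookup P \<tau> then 0 else frag_of \<tau>" P] assms(1)
      by (fastforce simp: P1_def split: if_splits)
    define c where "c = Poly_Mapping.lookup P1 \<tau>"
    obtain Q where "P2 = frag_cmul p Q" using P2 by blast
    then have "Poly_Mapping.lookup P \<tau> = c + p * Poly_Mapping.lookup Q \<tau>"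
      by (simp add: P12 lookup_add c_def)
    then have "\<not> p dvd c" using keys1 \<tau>(1) by auto
    then have "coprime p c" using prime_p by (simp add: prime_imp_coprime)
    \<comment> \<open>\<open>b\<close> inverts the leading coefficient \<open>c\<close> modulo
      \<open>p\<close>.\<close>
    then obtain a b where ab: "a * p + b * c = 1"
      by (metis bezout_int coprime_iff_gcd_eq_1)
    have "P1 \<in> N" using N_diff[OF assms(2) N_range[OF P2]] by (simp add: P12)
    then have "frag_cmul b P1 + frag_cmul p (frag_cmul a (frag_of \<tau>)) \<in> N"
      by (intro N_add[OF N_cmul N_range] rangeI)
    moreover define S where "S = frag_cmul b (frag_cmul c (frag_of \<tau>) - P1)"
    have "frag_of \<tau> = frag_cmul (a * p + b * c) (frag_of \<tau>)" using ab by simp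
    then have "frag_of \<tau> - S = frag_cmul b P1 + frag_cmul p (frag_cmul a (frag_of \<tau>))"
      by (simp add: S_def frag_cmul_diff frag_cmul_distrib algebra_simps)
    ultimately have "frag_of \<tau> - S \<in> N" by simp
    moreover have "Poly_Mapping.keys S \<subseteq> {\<sigma>. to_nat \<sigma> < to_nat \<tau>}"
    proof
      fix \<sigma> assume "\<sigma> \<in> Poly_Mapping.keys S"
      then have nz: "c * (if \<sigma> = \<tau> then 1 else 0) - Poly_Mapping.lookup P1 \<sigma> \<noteq> 0"
        by (auto simp: S_def in_keys_iff lookup_minus)
      then have "\<sigma> \<noteq> \<tau>" by (auto simp: c_def)
      moreover have "\<sigma> \<in> Poly_Mapping.keys P1" using nz \<open>\<sigma> \<noteq> \<tau>\<close> by (simp add: in_keys_iff)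
      then have "to_nat \<sigma> \<le> to_nat \<tau>" unfolding \<tau>(2) using fin(1) by simp
      ultimately show "\<sigma> \<in> {\<sigma>. to_nat \<sigma> < to_nat \<tau>}" by (simp add: less_le)
    qed
    ultimately have "\<tau> \<notin> B" by (auto simp: B_def)
    then show False using keys1 \<tau>(1) by auto
  qed
  then show ?thesis using P12 P2 by simp
qed

text \<open>The alphabet for straightening is the whole type of trees. The constants are 0 outside
  \<open>B\<close>, where the laws then hold trivially.\<close>

definition \<beta> :: "'g lie_tree \<Rightarrow> 'g lie_tree \<Rightarrow> ('g lie_tree \<Rightarrow>\<^sub>0 int)" where
  "\<beta> a b = (if a \<in> B \<and> b \<in> B then nf (Br a b) else 0)"

lemma ad_\<beta>:
  assumes "a \<in> B" "Poly_Mapping.keys P \<subseteq> B"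
  shows "frag_extend (\<lambda>x. \<beta> x a) P - adr a P \<in> N" "Poly_Mapping.keys (frag_extend (\<lambda>x. \<beta> x a) P) \<subseteq> B"
proof -
  show "frag_extend (\<lambda>x. \<beta> x a) P - adr a P \<in> N"
    using assms(2)
  proof (induction P rule: frag_induction)
    case (one x)
    then show ?case using N_uminus[OF nf(2)[of "Br x a"]] assms(1) by (simp add: \<beta>_def)
  next
    case (diff P Q)
    then show ?case using N_diff[OF diff] by (simp add: frag_extend_diff algebra_simps)
  qed (simp add: add_subgroup_zero[OF N_subgroup])
  have "Poly_Mapping.keys (\<beta> x a) \<subseteq> B" for x using nf(1) by (simp add: \<beta>_def)
  then show "Poly_Mapping.keys (frag_extend (\<lambda>x. \<beta> x a) P) \<subseteq> B"
    using keys_frag_extend[of "\<lambda>x. \<beta> x a" P] by blast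
qed

lemma keys_add_B: "Poly_Mapping.keys P \<subseteq> B \<Longrightarrow> Poly_Mapping.keys Q \<subseteq> B \<Longrightarrow> Poly_Mapping.keys (P + Q) \<subseteq> B"
  using keys_add[of P Q] by blast

lemma keys_diff_B: "Poly_Mapping.keys P \<subseteq> B \<Longrightarrow> Poly_Mapping.keys Q \<subseteq> B \<Longrightarrow> Poly_Mapping.keys (P - Q) \<subseteq> B"
  using keys_diff[of P Q] by blast

text \<open>Each law holds in \<open>N\<close> for the normal forms, and by
  \<open>independent\<close> this determines them up to multiples of \<open>p\<close>.\<close>

sublocale lie_constants to_nat \<beta> p
proof
  show "inj (to_nat :: 'g lie_tree \<Rightarrow> nat)" by simp
  show "\<beta> a a \<in> range (frag_cmul p)" for a
  proof (cases "a \<in> B")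
    case True
    have "nf (Br a a) \<in> N"
      using N_diff[OF N_I[OF lie_span.alt[of a R]] nf(2)[of "Br a a"]] by simp
    then show ?thesis using independent nf(1) True by (simp add: \<beta>_def)
  qed (simp add: \<beta>_def add_subgroup_zero[OF add_subgroup_cmul_range])
  show "\<beta> a b + \<beta> b a \<in> range (frag_cmul p)" for a b
  proof (cases "a \<in> B \<and> b \<in> B")
    case True
    have "nf (Br a b) + nf (Br b a) \<in> N"
      using N_diff[OF N_I[OF lie_span.anti[of a b R]] N_add[OF nf(2)[of "Br a b"] nf(2)[of "Br b a"]]]
      by (simp add: algebra_simps)
    then show ?thesis using independent[OF keys_add_B[OF nf(1) nf(1)]] True by (simp add: \<beta>_def)
  qed (auto simp: \<beta>_def add_subgroup_zero[OF add_subgroup_cmul_range])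
  show "frag_extend (\<lambda>x. \<beta> x c) (\<beta> a b) + frag_extend (\<lambda>x. \<beta> x a) (\<beta> b c) + frag_extend (\<lambda>x. \<beta> x b) (\<beta> c a)
      \<in> range (frag_cmul p)" for a b c
  proof (cases "a \<in> B \<and> b \<in> B \<and> c \<in> B")
    case True
    have step: "frag_extend (\<lambda>x. \<beta> x c) (\<beta> a b) - frag_of (Br (Br a b) c) \<in> N"
      if "a \<in> B" "b \<in> B" "c \<in> B" for a b c
      using N_diff[OF ad_\<beta>(1)[OF that(3) nf(1)[of "Br a b"]] N_adr[OF nf(2)[of "Br a b"], of c]] that
      by (simp add: \<beta>_def)
    let ?J = "frag_of (Br (Br a b) c) + frag_of (Br (Br b c) a) + frag_of (Br (Br c a) b)"
    let ?K = "frag_extend (\<lambda>x. \<beta> x c) (\<beta> a b) + frag_extend (\<lambda>x. \<beta> x a) (\<beta> b c) + frag_extend (\<lambda>x. \<beta> x b) (\<beta> c a)"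
    have "?K - ?J \<in> N"
      using N_add[OF N_add[OF step[of a b c] step[of b c a]] step[of c a b]] True by (simp add: algebra_simps)
    from N_add[OF this N_I[OF lie_span.jacobi[of a b c R]]] have "?K \<in> N" by simp
    moreover have "Poly_Mapping.keys ?K \<subseteq> B"
      using True nf(1) by (intro keys_add_B ad_\<beta>(2)) (auto simp: \<beta>_def)
    ultimately show ?thesis by (rule independent[rotated])
  next
    case False
    have "frag_extend (\<lambda>x. \<beta> x c) (\<beta> a b) = 0" if "a \<notin> B \<or> b \<notin> B \<or> c \<notin> B" for a b c
      using that by (auto simp: \<beta>_def intro: frag_extend_eq_0)
    then show ?thesis using False by (auto simp: add_subgroup_zero[OF add_subgroup_cmul_range])
  qed
qed

abbreviation "subst \<equiv> ring_ext (\<lambda>g. letters (nf (Leaf g)))"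

text \<open>\<open>M\<close> extends the constants bilinearly. \<open>M (nf a) (nf b)\<close> and
  \<open>nf (Br a b)\<close> are both supported in \<open>B\<close> and congruent to the bracket, so
  they agree modulo \<open>p\<close>; the rest is \<open>pbw\<close>.\<close>

lemma L_Br:
  "L (x * (letters (nf a) * letters (nf b) - letters (nf b) * letters (nf a) - letters (nf (Br a b))) * y) \<in> D"
proof -
  define M where "M P Q = frag_extend (\<lambda>a. frag_extend (\<lambda>b. \<beta> a b) Q) P" for P Q
  have M_simps: "M 0 Q = 0" "M P 0 = 0" "M (P - P') Q = M P Q - M P' Q" "M P (Q - Q') = M P Q - M P Q'"
    "M (frag_of a) (frag_of b) = \<beta> a b" for P P' Q Q' a b
    unfolding M_def
    by (simp_all add: frag_extend_diff frag_extend_eq_0)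
      (induction P rule: frag_ind, simp_all add: frag_extend_diff)
  have bilin: "L (x * (letters P * letters Q - letters Q * letters P - letters (M P Q)) * y) \<in> D" for P Q
  proof (rule add_subgroup_linear[OF D_group,
      where f = "\<lambda>P. L (x * (letters P * letters Q - letters Q * letters P - letters (M P Q)) * y)"])
    fix c
    show "L (x * (letters (frag_of c) * letters Q - letters Q * letters (frag_of c) - letters (M (frag_of c) Q)) * y) \<in> D"
      by (rule add_subgroup_linear[OF D_group, where f =
        "\<lambda>Q. L (x * (letters (frag_of c) * letters Q - letters Q * letters (frag_of c) - letters (M (frag_of c) Q)) * y)"])
        (simp_all add: M_simps pbw, simp add: algebra_simps)
  qed (simp add: M_simps algebra_simps)
  have M_br: "M P Q - frag_extend (\<lambda>a. adl a Q) P \<in> N \<and> Poly_Mapping.keys (M P Q) \<subseteq> B"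
    if "Poly_Mapping.keys P \<subseteq> B" "Poly_Mapping.keys Q \<subseteq> B" for P Q
    using that(1)
  proof (induction P rule: frag_induction)
    case (one c)
    show ?case
      using that(2)
    proof (induction Q rule: frag_induction)
      case (one d)
      then show ?case using \<open>c \<in> B\<close> N_uminus[OF nf(2)[of "Br c d"]] nf(1) by (simp add: M_simps \<beta>_def)
    next
      case (diff Q Q')
      have "M (frag_of c) (Q - Q') - frag_extend (\<lambda>a. adl a (Q - Q')) (frag_of c)
        = (M (frag_of c) Q - frag_extend (\<lambda>a. adl a Q) (frag_of c))
          - (M (frag_of c) Q' - frag_extend (\<lambda>a. adl a Q') (frag_of c))"
        by (simp add: M_simps)
      moreover have "M (frag_of c) (Q - Q') = M (frag_of c) Q - M (frag_of c) Q'" by (rule M_simps)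
      ultimately show ?case using diff N_diff keys_diff_B by metis
    qed (simp add: M_simps add_subgroup_zero[OF N_subgroup])
  next
    case (diff P P')
    have "M (P - P') Q - frag_extend (\<lambda>a. adl a Q) (P - P')
        = (M P Q - frag_extend (\<lambda>a. adl a Q) P) - (M P' Q - frag_extend (\<lambda>a. adl a Q) P')"
      by (simp add: M_simps frag_extend_diff)
    moreover have "M (P - P') Q = M P Q - M P' Q" by (rule M_simps)
    ultimately show ?case using diff N_diff keys_diff_B by metis
  qed (simp add: M_simps add_subgroup_zero[OF N_subgroup])
  have br1: "frag_extend (\<lambda>a. adl a Q) P - frag_extend (\<lambda>a. adl a Q') P \<in> N" if "Q - Q' \<in> N" for P Q Q'
  proof (rule N_linear[where f = "\<lambda>P. frag_extend (\<lambda>a. adl a Q) P - frag_extend (\<lambda>a. adl a Q') P"])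
    show "frag_extend (\<lambda>a. adl a Q) (frag_of c) - frag_extend (\<lambda>a. adl a Q') (frag_of c) \<in> N" for c
      using N_adl[OF that, of c] by simp
  qed (simp add: frag_extend_diff)
  have br2: "frag_extend (\<lambda>a. adl a (frag_of b)) P = adr b P" for P
    by (simp add: adr_def)
  have "M (nf a) (nf b) - nf (Br a b)
    = (M (nf a) (nf b) - frag_extend (\<lambda>a. adl a (nf b)) (nf a))
      - (frag_extend (\<lambda>a. adl a (frag_of b)) (nf a) - frag_extend (\<lambda>a. adl a (nf b)) (nf a))
      - adr b (frag_of a - nf a) + (frag_of (Br a b) - nf (Br a b))"
    by (simp add: br2 del: adl_simps(2))
  also have "\<dots> \<in> N"
    by (rule N_add[OF N_diff[OF N_diff[OF conjunct1[OF M_br[OF nf(1)[of a] nf(1)[of b]]]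
        br1[OF nf(2)[of b], of "nf a"]] N_adr[OF nf(2)[of a], of b]] nf(2)[of "Br a b"]])
  finally have "M (nf a) (nf b) - nf (Br a b) \<in> range (frag_cmul p)"
    using M_br[OF nf(1)[of a] nf(1)[of b]] nf(1) by (intro independent keys_diff_B) auto
  from D_intros(1)[OF bilin[of "nf a" "nf b"] L_D[OF this, of x y]] show ?thesis
    by (simp add: algebra_simps)
qed

text \<open>The expansion of a tree becomes its normal form, a combination of single letters. The
  factors \<open>x\<close> and \<open>y\<close> allow the claim to be used inside products in the
  induction.\<close>

lemma L_assoc: "L (x * (subst (assoc \<tau>) - letters (nf \<tau>)) * y) \<in> D"
proof (induction \<tau> arbitrary: x y)
  case (Leaf g)
  then show ?case by (simp add: add_subgroup_zero[OF D_group])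
next
  case (Br a b)
  define A A' C C' where "A = subst (assoc a)" "A' = letters (nf a)" "C = subst (assoc b)" "C' = letters (nf b)"
  note abb = A_A'_C_C'_def
  have "x * (subst (assoc (Br a b)) - letters (nf (Br a b))) * y =
      x * (A - A') * (C * y) + (x * A') * (C - C') * y - x * (C - C') * (A * y) - (x * C') * (A - A') * y
      + x * (A' * C' - C' * A' - letters (nf (Br a b))) * y"
    by (simp add: ring_ext_mult abb(1,3)[symmetric] algebra_simps)
  then have "L (x * (subst (assoc (Br a b)) - letters (nf (Br a b))) * y) =
      L (x * (A - A') * (C * y)) + L ((x * A') * (C - C') * y) - L (x * (C - C') * (A * y)) - L ((x * C') * (A - A') * y)
      + L (x * (A' * C' - C' * A' - letters (nf (Br a b))) * y)"
    by (simp only: L_simps)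
  also have "\<dots> \<in> D"
    unfolding abb by (intro D_intros(1,2) Br L_Br)
  finally show ?case .
qed

text \<open>\<open>L\<close> after \<open>subst\<close> kills the relators modulo \<open>p\<close>
  and returns the normal form of a Lie polynomial. Divisibility by \<open>p\<close> in the
  enveloping ring thus forces divisibility in the Lie ring.\<close>

lemma mod_prime:
  assumes "assocs P - frag_cmul p y \<in> assoc_ideal R"
  shows "P \<in> N"
proof -
  have ideal: "L (subst x) \<in> D" if "x \<in> assoc_ideal R" for x
    using that
  proof (induction rule: assoc_ideal.induct)
    case (rel \<rho> u v)
    have "nf \<rho> \<in> N" using N_diff[OF N_I[OF lie_span.rel[OF rel]] nf(2)[of \<rho>]] by simp
    then have "nf \<rho> \<in> range (frag_cmul p)" using independent nf(1) by blast
    from D_intros(1)[OF L_assoc[of "subst u" \<rho> "subst v"] L_D[OF this, of "subst u" "subst v"]]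
    show ?case by (simp add: ring_ext_mult algebra_simps)
  qed (simp_all add: D_intros)
  have "L (subst (assocs P)) - nfs P \<in> D"
  proof (rule add_subgroup_linear[OF D_group, where f = "\<lambda>P. L (subst (assocs P)) - nfs P"])
    show "L (subst (assocs (frag_of \<tau>))) - nfs (frag_of \<tau>) \<in> D" for \<tau>
      using L_assoc[of 1 \<tau> 1] by (simp add: L_letters)
  qed (simp add: frag_extend_diff)
  moreover have "L (subst (assocs P)) \<in> D"
    using D_intros(1)[OF ideal[OF assms], of "L (subst (frag_cmul p y))"]
    by (simp add: ring_ext_cmul L_cmul)
  ultimately have "nfs P \<in> D"
    using D_intros(2)[of "L (subst (assocs P))" "L (subst (assocs P)) - nfs P"] by simp
  then show ?thesis using N_add[OF nfs(2)[of P] N_range[of "nfs P"]] by simp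
qed

end

text \<open>
  By Dynkin's theorem \<open>P\<close> is in the span if it is divisible by \<open>c\<close> modulo the span. It is so because
  one can divide by the primes dividing \<open>c\<close> one after the other.
\<close>

theorem lie_span_if_assoc_ideal:
  fixes P :: "'g::countable lie_tree \<Rightarrow>\<^sub>0 int"
  assumes torsion_free: "\<And>(m::int) x. m \<noteq> 0 \<Longrightarrow> frag_cmul m x \<in> assoc_ideal R \<Longrightarrow> x \<in> assoc_ideal R"
    and homogeneous: "\<forall>\<tau>\<in>Poly_Mapping.keys P. deg \<tau> = c"
    and P: "assocs P \<in> assoc_ideal R"
  shows "P \<in> lie_span R"
proof -
  let ?K = "\<lambda>Q. (\<forall>\<tau>\<in>Poly_Mapping.keys Q. deg \<tau> = c) \<and> assocs Q \<in> assoc_ideal R"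
  have prime_step: "\<exists>Q. ?K Q \<and> P - frag_cmul p Q \<in> lie_span R" if "prime p" "?K P" for p :: int and P
  proof -
    interpret lie_mod_prime R p by standard fact
    have "assocs P - frag_cmul p 0 \<in> assoc_ideal R" using that by simp
    then have "P \<in> N" by (rule mod_prime)
    then obtain Q where "P - frag_cmul p Q \<in> lie_span R" by (auto simp: N_def)
    from hcomp_lie_span[OF this, of c] have I: "P - frag_cmul p (hcomp c Q) \<in> lie_span R"
      using that(2) hcomp_homogeneous[of P c] by (simp add: hcomp_def frag_extend_cmul frag_extend_diff)
    from assocs_lie_span[OF this] have "assocs P - frag_cmul p (assocs (hcomp c Q)) \<in> assoc_ideal R"
      by (simp add: frag_extend_diff frag_extend_cmul)
    from assoc_ideal.diff[OF conjunct2[OF that(2)] this]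
    have "frag_cmul p (assocs (hcomp c Q)) \<in> assoc_ideal R" by simp
    \<comment> \<open>Cancelling \<open>p\<close> puts the quotient under the hypotheses of
      \<open>P\<close>. Being a component of degree \<open>c\<close> it is homogeneous, so the step
      can be repeated.\<close>
    then have "assocs (hcomp c Q) \<in> assoc_ideal R"
      using torsion_free[of p] prime_p by auto
    then show ?thesis using I deg_keys_hcomp by blast
  qed
  have "\<exists>Q. ?K Q \<and> P - frag_cmul (int m) Q \<in> lie_span R" if "m \<noteq> 0" "?K P" for m :: nat and P
    using that
  proof (induction m arbitrary: P rule: prime_divisors_induct)
    case (unit m)
    then show ?case by (auto intro!: exI[of _ P] simp: lie_span.zero)
  next
    case (factor p m)
    then obtain Q where Q: "?K Q" "P - frag_cmul (int m) Q \<in> lie_span R"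
      using factor.IH[of P] factor.prems by (metis mult_eq_0_iff)
    obtain Q' where Q': "?K Q'" "Q - frag_cmul (int p) Q' \<in> lie_span R"
      using prime_step[of "int p" Q] factor.hyps Q(1) by auto
    from lie_span_add[OF Q(2) lie_span_cmul[OF Q'(2), of "int m"]]
    have "P - frag_cmul (int (p * m)) Q' \<in> lie_span R"
      by (simp add: frag_cmul_diff mult.commute del: minus_frag_cmul)
    then show ?case using Q'(1) by blast
  qed simp
  note divide = this[of c P]
  show ?thesis
  proof (cases "c = 0")
    case True
    have "deg \<tau> > 0" for \<tau> :: "'g lie_tree" by (induction \<tau>) auto
    then have "Poly_Mapping.keys P = {}" using homogeneous True by (metis all_not_in_conv less_irrefl)
    then show ?thesis by (simp add: lie_span.zero)
  next
    case False
    then obtain Q where Q: "?K Q" "P - frag_cmul (int c) Q \<in> lie_span R"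
      using divide homogeneous P by blast
    \<comment> \<open>Modulo the span, Dynkin's operator sends \<open>assocs Q\<close> to
      \<open>c Q\<close>; it also sends it to 0, because \<open>assocs Q\<close> lies in the
      ideal.\<close>
    have "frag_cmul (int c) Q \<in> lie_span R"
      using lie_span.diff[OF dynkin_assoc_ideal dynkin_assocs[of Q c R], of "assocs Q"] Q(1) by simp
    from lie_span_add[OF Q(2) this] show ?thesis by simp
  qed
qed

section \<open>The enveloping ring of the presented Lie ring\<close>

instance fp_gen :: countable
  by countable_datatype

text \<open>
  The letters stand for \<open>t\<close>, \<open>[t, f\<^sub>i]\<close> and \<open>f\<^sub>i\<close>.
\<close>

datatype tsym = LT | LX nat | LY nat

fun isY :: "tsym \<Rightarrow> bool" where
  "isY (LY i) = True" | "isY _ = False"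

fun fp_assoc :: "tsym \<Rightarrow> (fp_gen list \<Rightarrow>\<^sub>0 int)" where
  "fp_assoc LT = frag_of [T]"
| "fp_assoc (LX i) = assoc (Br (Leaf T) (Leaf (F i)))"
| "fp_assoc (LY i) = frag_of [F i]"

text \<open>The derivation \<open>m f\<^sub>i - f\<^sub>i m\<close> on words in \<open>t\<close> and
  the \<open>x\<^sub>j\<close>: it sends \<open>t\<close> to \<open>x\<^sub>i\<close> and kills
  \<open>x\<^sub>j\<close>, which commutes with \<open>f\<^sub>i\<close>. Letters \<open>LY\<close>
  count as constants because they stand to the left of the part that \<open>f\<^sub>i\<close> has to
  pass.\<close>

fun derw :: "nat \<Rightarrow> tsym list \<Rightarrow> (tsym list \<Rightarrow>\<^sub>0 int)" where
  "derw i [] = 0"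
| "derw i (l # w) = (if l = LT then frag_of (LX i # w) else 0) + frag_of [l] * derw i w"

definition der :: "nat \<Rightarrow> (tsym list \<Rightarrow>\<^sub>0 int) \<Rightarrow> (tsym list \<Rightarrow>\<^sub>0 int)" where
  "der i = frag_extend (derw i)"

lemma der_simps [simp]: "der i 0 = 0" "der i (x - y) = der i x - der i y" "der i (x + y) = der i x + der i y"
  "der i (frag_of w) = derw i w"
  by (simp_all add: der_def frag_extend_diff frag_extend_add)

lemma der_mult: "der i (x * y) = der i x * y + x * der i y"
proof (induction x rule: frag_ind)
  case (one u)
  show ?case
  proof (induction y rule: frag_ind)
    case (one v)
    have "derw i (u @ v) = derw i u * frag_of v + frag_of u * derw i v"
    proof (induction u)
      case (Cons l u)
      have "frag_of (LX i # u @ v) = frag_of (LX i # u) * frag_of v"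
        by (simp flip: frag_of_append)
      then show ?case using Cons by (simp add: ring_distribs mult.assoc frag_of_Cons[of l u])
    qed (simp add: frag_of_Nil)
    then show ?case by (simp flip: frag_of_append)
  qed (simp_all add: ring_distribs)
qed (simp_all add: ring_distribs)

text \<open>The two composites agree on letters, since no image of a letter contains
  \<open>LT\<close>, and the mixed terms of the product rule are symmetric.\<close>

lemma der_commute: "der i (der j x) = der j (der i x)"
proof (induction x rule: frag_ind)
  case (one w)
  show ?case
  proof (induction w)
    case (Cons l w)
    have "derw k [LX k'] = 0" for k k' by simp
    then show ?case using Cons
      by (cases l) (simp_all add: frag_of_Cons[of _ w] der_mult del: derw.simps(2), simp_all)
  qed simp
qed simp_all

text \<open>
  The action of the free ring on words in these letters for which the empty word generates the
  enveloping ring: \<open>f\<^sub>i\<close> is moved to the right past \<open>t\<close>, giving \<open>[t, f\<^sub>i]\<close>. The map \<open>lam []\<close> below is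
  its inverse up to the ideals on the two sides.
\<close>

fun gen_act :: "fp_gen \<Rightarrow> (tsym list \<Rightarrow>\<^sub>0 int) \<Rightarrow> (tsym list \<Rightarrow>\<^sub>0 int)" where
  "gen_act T m = m * frag_of [LT]"
| "gen_act (F i) m = der i m + m * frag_of [LY i]"

lemma gen_act_diff: "gen_act g (x - y) = gen_act g x - gen_act g y"
  by (cases g) (simp_all add: ring_distribs)

abbreviation "ract \<equiv> word_act gen_act"

lemmas ract_mult = word_act_mult[where f = gen_act, OF gen_act_diff]

lemma ract_Leaf: "ract (assoc (Leaf g)) m = gen_act g m"
  by simp

lemma ract_Br: "ract (assoc (Br a b)) m = ract (assoc b) (ract (assoc a) m) - ract (assoc a) (ract (assoc b) m)"
  by (simp add: ract_mult)

text \<open>The letters \<open>LY\<close> are sorted to the front. The argument \<open>u\<close>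
  collects the other letters already passed, for inductions along a word.\<close>

definition lam :: "tsym list \<Rightarrow> (tsym list \<Rightarrow>\<^sub>0 int) \<Rightarrow> (fp_gen list \<Rightarrow>\<^sub>0 int)" where
  "lam u = frag_extend (\<lambda>w. prod_list (map fp_assoc (filter isY w)) * prod_list (map fp_assoc u) *
     prod_list (map fp_assoc (filter (\<lambda>l. \<not> isY l) w)))"

lemma lam_simps [simp]: "lam u 0 = 0" "lam u (x - y) = lam u x - lam u y" "lam u (x + y) = lam u x + lam u y"
  "lam u (frag_of w) = prod_list (map fp_assoc (filter isY w)) * prod_list (map fp_assoc u) *
     prod_list (map fp_assoc (filter (\<lambda>l. \<not> isY l) w))"
  by (simp_all add: lam_def frag_extend_diff frag_extend_add)

lemma lam_Y: "isY l \<Longrightarrow> lam u (frag_of [l] * x) = fp_assoc l * lam u x"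
  by (induction x rule: frag_ind) (simp_all add: ring_distribs mult.assoc flip: frag_of_append)

lemma lam_not_Y: "\<not> isY l \<Longrightarrow> lam u (frag_of [l] * x) = lam (u @ [l]) x"
  by (induction x rule: frag_ind) (simp_all add: ring_distribs mult.assoc flip: frag_of_append)

lemma lam_derw: "lam u (derw i w) = prod_list (map fp_assoc (filter isY w)) * prod_list (map fp_assoc u) *
    ring_ext fp_assoc (derw i (filter (\<lambda>l. \<not> isY l) w))"
proof (induction w arbitrary: u)
  case (Cons l w)
  show ?case
  proof (cases "isY l")
    case True
    then show ?thesis using Cons by (cases l) (simp_all add: lam_Y mult.assoc)
  next
    case False
    then show ?thesis using Cons
      by (simp add: lam_not_Y ring_ext_mult ring_distribs mult.assoc)
  qed
qed simp

section \<open>The enveloping ring as a module of traces\<close>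

locale partially_commutative =
  fixes \<theta> :: "(nat \<times> nat) set"
  assumes sym: "(a, b) \<in> \<theta> \<Longrightarrow> (b, a) \<in> \<theta>" and irrefl: "(a, a) \<notin> \<theta>"
begin

text \<open>\<open>LY\<close> commutes with the other kinds although \<open>f\<^sub>i\<close> and
  \<open>t\<close> do not commute in the enveloping ring. Additively this ring is a tensor product
  of a part in the \<open>f\<^sub>i\<close> and a part in \<open>t\<close> and the
  \<open>x\<^sub>i\<close>; their interaction is left to \<open>der\<close>.\<close>

fun commuting :: "tsym \<Rightarrow> tsym \<Rightarrow> bool" where
  "commuting (LX i) (LX j) \<longleftrightarrow> (i, j) \<in> \<theta>"
| "commuting (LY i) (LY j) \<longleftrightarrow> (i, j) \<in> \<theta>"
| "commuting LT LT \<longleftrightarrow> False"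
| "commuting LT (LX i) \<longleftrightarrow> False"
| "commuting (LX i) LT \<longleftrightarrow> False"
| "commuting LT (LY i) \<longleftrightarrow> True"
| "commuting (LY i) LT \<longleftrightarrow> True"
| "commuting (LX i) (LY j) \<longleftrightarrow> True"
| "commuting (LY i) (LX j) \<longleftrightarrow> True"

lemma commuting_sym: "commuting a b \<Longrightarrow> commuting b a"
  by (cases a; cases b) (auto intro: sym)

lemma commuting_irrefl: "\<not> commuting a a"
  by (cases a) (auto simp: irrefl)

inductive_set comm_ideal :: "(tsym list \<Rightarrow>\<^sub>0 int) set" where
  zero: "0 \<in> comm_ideal"
| diff: "x \<in> comm_ideal \<Longrightarrow> y \<in> comm_ideal \<Longrightarrow> x - y \<in> comm_ideal"
| rel: "commuting a b \<Longrightarrow> x * (frag_of [a, b] - frag_of [b, a]) * y \<in> comm_ideal"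

lemma comm_ideal_subgroup: "add_subgroup comm_ideal"
  by (simp add: add_subgroup_def comm_ideal.zero comm_ideal.diff)

lemmas comm_ideal_add = add_subgroup_add[OF comm_ideal_subgroup]

lemma comm_ideal_rel: "commuting a b \<Longrightarrow> frag_of [a, b] - frag_of [b, a] \<in> comm_ideal"
  using comm_ideal.rel[of a b 1 1] by simp

lemma comm_ideal_mult: "x \<in> comm_ideal \<Longrightarrow> u * x * v \<in> comm_ideal"
proof (induction rule: comm_ideal.induct)
  case (rel a b u' v')
  have "u * (u' * (frag_of [a, b] - frag_of [b, a]) * v') * v = (u * u') * (frag_of [a, b] - frag_of [b, a]) * (v' * v)"
    by (simp add: mult.assoc)
  then show ?case using comm_ideal.rel[OF rel] by metis
qed (simp_all add: comm_ideal.zero comm_ideal.diff ring_distribs)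

lemma comm_ideal_mult_right: "x \<in> comm_ideal \<Longrightarrow> x * v \<in> comm_ideal"
  and comm_ideal_mult_left: "x \<in> comm_ideal \<Longrightarrow> u * x \<in> comm_ideal"
  using comm_ideal_mult[of x 1 v] comm_ideal_mult[of x u 1] by simp_all

lemma comm_ideal_der: "x \<in> comm_ideal \<Longrightarrow> der i x \<in> comm_ideal"
proof (induction rule: comm_ideal.induct)
  case (rel a b x y)
  have "derw i [a, b] - derw i [b, a] \<in> comm_ideal"
    using rel comm_ideal_rel[of "LX i"] comm_ideal_rel[of _ "LX i"]
    by (cases a; cases b) (simp_all add: comm_ideal.zero flip: frag_of_append)
  then have "x * (derw i [a, b] - derw i [b, a]) * y \<in> comm_ideal" by (rule comm_ideal_mult)
  then have "der i x * (frag_of [a, b] - frag_of [b, a]) * y + x * (derw i [a, b] - derw i [b, a]) * y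
      + x * (frag_of [a, b] - frag_of [b, a]) * der i y \<in> comm_ideal"
    by (intro comm_ideal_add comm_ideal.rel rel)
  then show ?case by (simp add: der_mult algebra_simps del: derw.simps)
qed (simp_all add: comm_ideal.zero comm_ideal.diff)

lemma comm_ideal_op: "x \<in> comm_ideal \<Longrightarrow> gen_act g x \<in> comm_ideal"
  by (cases g) (simp_all add: comm_ideal_der comm_ideal_mult_right comm_ideal_add)

lemma comm_ideal_ract: "m \<in> comm_ideal \<Longrightarrow> ract x m \<in> comm_ideal"
  by (rule word_act_closed[OF comm_ideal_subgroup comm_ideal_op])

text \<open>Both orders of each commuting pair and all indices are included, so that no range has to
  be carried along; \<open>fp_trees_J\<close> matches this with the given relators.\<close>

definition fp_trees :: "fp_gen lie_tree set" where
  "fp_trees = {Br (Leaf (F a)) (Leaf (F b)) | a b. (a, b) \<in> \<theta>} \<union>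
     {Br (Br (Leaf T) (Leaf (F i))) (Leaf (F j)) | i j. True} \<union>
     {Br (Br (Leaf T) (Leaf (F a))) (Br (Leaf T) (Leaf (F b))) | a b. (a, b) \<in> \<theta>}"

abbreviation "AI \<equiv> assoc_ideal fp_trees"

text \<open>By the product rule the \<open>der\<close> terms leave
  \<open>m * frag_of [LX i]\<close>; the remaining terms differ by moving \<open>LT\<close> past
  \<open>LY i\<close>.\<close>

lemma ract_x: "ract (assoc (Br (Leaf T) (Leaf (F i)))) m - m * frag_of [LX i] \<in> comm_ideal"
proof -
  have "ract (assoc (Br (Leaf T) (Leaf (F i)))) m - m * frag_of [LX i]
      = m * (frag_of [LT, LY i] - frag_of [LY i, LT]) * 1"
    unfolding ract_Br ract_Leaf
    by (simp add: der_mult ring_distribs mult.assoc flip: frag_of_append)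
  also have "\<dots> \<in> comm_ideal" by (rule comm_ideal.rel) simp
  finally show ?thesis .
qed

lemma ract_fp_trees:
  assumes "\<rho> \<in> fp_trees"
  shows "ract (assoc \<rho>) m \<in> comm_ideal"
proof -
  let ?x = "\<lambda>i. Br (Leaf T) (Leaf (F i))"
  consider (f) a b where "\<rho> = Br (Leaf (F a)) (Leaf (F b))" "(a, b) \<in> \<theta>"
    | (xf) i j where "\<rho> = Br (?x i) (Leaf (F j))"
    | (xx) a b where "\<rho> = Br (?x a) (?x b)" "(a, b) \<in> \<theta>"
    using assms by (auto simp: fp_trees_def)
  then show ?thesis
  proof cases
    case f
    have "ract (assoc \<rho>) m = m * (frag_of [LY a, LY b] - frag_of [LY b, LY a]) * 1"
      unfolding f(1) ract_Br ract_Leaf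
      by (simp add: der_mult der_commute[of b a] ring_distribs mult.assoc flip: frag_of_append)
    also have "\<dots> \<in> comm_ideal" by (rule comm_ideal.rel) (simp add: f)
    finally show ?thesis .
  next
    case xf
    have "gen_act (F j) (m * frag_of [LX i]) - gen_act (F j) m * frag_of [LX i]
        = m * (frag_of [LX i, LY j] - frag_of [LY j, LX i]) * 1"
      by (simp add: der_mult ring_distribs mult.assoc flip: frag_of_append)
    also have "\<dots> \<in> comm_ideal" by (rule comm_ideal.rel) simp
    finally have "gen_act (F j) (m * frag_of [LX i]) - gen_act (F j) m * frag_of [LX i] \<in> comm_ideal" .
    from comm_ideal_add[OF comm_ideal.diff[OF comm_ideal_op[OF ract_x[of i m], of "F j"] ract_x[of i "gen_act (F j) m"]] this]
    show ?thesis unfolding xf ract_Br[of "?x i"] ract_Leaf gen_act_diff by (simp del: assoc.simps gen_act.simps)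
  next
    case xx
    have *: "ract (assoc (?x b)) (ract (assoc (?x a)) m) - m * frag_of [LX a, LX b] \<in> comm_ideal" for a b
    proof -
      have "(ract (assoc (?x b)) (ract (assoc (?x a)) m) - ract (assoc (?x a)) m * frag_of [LX b])
          + (ract (assoc (?x a)) m - m * frag_of [LX a]) * frag_of [LX b] \<in> comm_ideal"
        by (intro comm_ideal_add comm_ideal_mult_right ract_x)
      then show ?thesis by (simp add: ring_distribs mult.assoc flip: frag_of_append del: assoc.simps)
    qed
    have "m * (frag_of [LX a, LX b] - frag_of [LX b, LX a]) * 1 \<in> comm_ideal"
      by (rule comm_ideal.rel) (simp add: xx)
    from comm_ideal_add[OF comm_ideal.diff[OF *[of b a] *[of a b]] this]
    show ?thesis unfolding xx ract_Br[of "?x a"] by (simp add: algebra_simps del: assoc.simps)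
  qed
qed

lemma ract_AI: "x \<in> AI \<Longrightarrow> ract x m \<in> comm_ideal"
proof (induction rule: assoc_ideal.induct)
  case (rel \<rho> u v)
  then show ?case by (simp add: ract_mult comm_ideal_ract ract_fp_trees)
qed (simp_all add: comm_ideal.zero comm_ideal.diff)

lemmas AI_mult_left = assoc_ideal_mult[where R = fp_trees and v = 1, simplified]
  and AI_mult_right = assoc_ideal_mult[where R = fp_trees and u = 1, simplified]
  and AI_add = add_subgroup_add[OF assoc_ideal_subgroup, of _ fp_trees]
  and AI_linear = add_subgroup_linear[OF assoc_ideal_subgroup, of _ fp_trees]

lemma AI_rel: "\<rho> \<in> fp_trees \<Longrightarrow> assoc \<rho> \<in> AI"
  using assoc_ideal.rel[of \<rho> fp_trees 1 1] by simp

text \<open>An exchange of two letters \<open>LY\<close> or of two letters \<open>LX\<close>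
  produces a relator; a mixed exchange disappears in the sorting.\<close>

lemma lam_comm_ideal: "x \<in> comm_ideal \<Longrightarrow> lam [] x \<in> AI"
proof (induction rule: comm_ideal.induct)
  case (rel a b x y)
  have word: "lam [] (frag_of u * (frag_of [a, b] - frag_of [b, a]) * frag_of v) \<in> AI" for u v
  proof -
    let ?Y = "\<lambda>w. prod_list (map fp_assoc (filter isY w))"
    let ?N = "\<lambda>w. prod_list (map fp_assoc (filter (\<lambda>l. \<not> isY l) w))"
    have eq: "lam [] (frag_of u * (frag_of [a, b] - frag_of [b, a]) * frag_of v)
        = ?Y u * ?Y [a, b] * ?Y v * (?N u * ?N [a, b] * ?N v) - ?Y u * ?Y [b, a] * ?Y v * (?N u * ?N [b, a] * ?N v)"
      by (simp add: ring_distribs mult.assoc flip: frag_of_append)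
    consider (YY) i j where "a = LY i" "b = LY j" "(i, j) \<in> \<theta>" | (XX) i j where "a = LX i" "b = LX j" "(i, j) \<in> \<theta>"
      | (mix) "isY a \<noteq> isY b"
      using rel by (cases a; cases b) auto
    then show ?thesis
    proof cases
      case YY
      have "?Y u * assoc (Br (Leaf (F i)) (Leaf (F j))) * (?Y v * (?N u * ?N v)) \<in> AI"
        by (rule assoc_ideal.rel) (use YY in \<open>auto simp: fp_trees_def\<close>)
      then show ?thesis unfolding eq by (simp add: YY ring_distribs mult.assoc)
    next
      case XX
      have "?Y u * ?Y v * ?N u * assoc (Br (Br (Leaf T) (Leaf (F i))) (Br (Leaf T) (Leaf (F j)))) * ?N v \<in> AI"
        by (rule assoc_ideal.rel) (use XX in \<open>auto simp: fp_trees_def\<close>)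
      then show ?thesis unfolding eq by (simp add: XX ring_distribs mult.assoc)
    next
      case mix
      then show ?thesis unfolding eq by (auto simp: assoc_ideal.zero)
    qed
  qed
  show ?case
  proof (rule AI_linear[where f = "\<lambda>x. lam [] (x * (frag_of [a, b] - frag_of [b, a]) * y)"])
    fix u :: "tsym list"
    show "lam [] (frag_of u * (frag_of [a, b] - frag_of [b, a]) * y) \<in> AI"
      by (rule AI_linear[where f = "\<lambda>y. lam [] (frag_of u * (frag_of [a, b] - frag_of [b, a]) * y)", OF _ word])
        (simp only: right_diff_distrib lam_simps)
  qed (simp only: left_diff_distrib lam_simps)
qed (simp_all add: assoc_ideal.zero assoc_ideal.diff)

text \<open>Moving \<open>f\<^sub>i\<close> to the left past \<open>t\<close> creates
  \<open>x\<^sub>i\<close>, by the meaning of \<open>LX i\<close>; past \<open>x\<^sub>j\<close> it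
  creates a relator.\<close>

lemma commute_past:
  "\<forall>l\<in>set b. \<not> isY l \<Longrightarrow> prod_list (map fp_assoc b) * frag_of [F i] - frag_of [F i] * prod_list (map fp_assoc b)
     - ring_ext fp_assoc (derw i b) \<in> AI"
proof (induction b)
  case (Cons l b)
  define B where "B = prod_list (map fp_assoc b)"
  define E where "E = ring_ext fp_assoc (derw i b)"
  have IH: "fp_assoc l * (B * frag_of [F i] - frag_of [F i] * B - E) \<in> AI"
    using Cons by (intro AI_mult_left) (simp add: B_def E_def)
  show ?case
  proof (cases l)
    case LT
    then show ?thesis using IH by (simp add: ring_ext_mult B_def[symmetric] E_def[symmetric] algebra_simps)
  next
    case (LX j)
    have "assoc (Br (Br (Leaf T) (Leaf (F j))) (Leaf (F i))) * B \<in> AI"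
      by (intro AI_mult_right AI_rel) (auto simp: fp_trees_def)
    then have "(fp_assoc l * frag_of [F i] - frag_of [F i] * fp_assoc l) * B \<in> AI" by (simp add: LX)
    from AI_add[OF IH this] show ?thesis
      using LX by (simp add: ring_ext_mult B_def[symmetric] E_def[symmetric] algebra_simps del: fp_assoc.simps)
  next
    case (LY j)
    then show ?thesis using Cons.prems by simp
  qed
qed (simp add: assoc_ideal.zero)

lemma lam_op: "lam [] (gen_act g m) - lam [] m * frag_of [g] \<in> AI"
proof (rule AI_linear[where f = "\<lambda>m. lam [] (gen_act g m) - lam [] m * frag_of [g]"])
  fix w :: "tsym list"
  show "lam [] (gen_act g (frag_of w)) - lam [] (frag_of w) * frag_of [g] \<in> AI"
  proof (cases g)
    case (F i)
    let ?Y = "prod_list (map fp_assoc (filter isY w))"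
    let ?b = "filter (\<lambda>l. \<not> isY l) w"
    have "?Y * (prod_list (map fp_assoc ?b) * frag_of [F i] - frag_of [F i] * prod_list (map fp_assoc ?b)
     - ring_ext fp_assoc (derw i ?b)) \<in> AI"
      by (intro AI_mult_left commute_past) auto
    from add_subgroup_uminus[OF assoc_ideal_subgroup this] show ?thesis
      by (simp add: F lam_derw algebra_simps flip: frag_of_append)
  next
    case T
    then show ?thesis by (simp add: mult.assoc assoc_ideal.zero flip: frag_of_append)
  qed
qed (simp add: gen_act_diff ring_distribs)

lemma lam_ract: "x - lam [] (ract x 1) \<in> AI"
proof (rule AI_linear[where f = "\<lambda>x. x - lam [] (ract x 1)"])
  fix w :: "fp_gen list"
  show "frag_of w - lam [] (ract (frag_of w) 1) \<in> AI"
  proof (induction w rule: rev_induct)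
    case Nil
    have "ract (frag_of []) 1 = frag_of []" unfolding word_act_simps(3) by (simp add: frag_of_Nil)
    moreover have "lam [] (frag_of []) = frag_of []" unfolding lam_simps(4) by (simp add: frag_of_Nil)
    ultimately show ?case by (simp only: diff_self assoc_ideal.zero)
  next
    case (snoc g w)
    from assoc_ideal.diff[OF AI_mult_right[OF snoc, of "frag_of [g]"] lam_op[of g "ract (frag_of w) 1"]]
    show ?case by (simp add: ring_distribs flip: frag_of_append)
  qed
qed simp

text \<open>\<open>ract_AI\<close> gives one direction; for the other, \<open>lam_ract\<close>
  recovers \<open>x\<close> from \<open>ract x 1\<close>. This identifies the enveloping ring with
  the trace module.\<close>

lemma AI_iff: "x \<in> AI \<longleftrightarrow> ract x 1 \<in> comm_ideal"
  using ract_AI[of x 1] AI_add[OF lam_ract[of x] lam_comm_ideal[of "ract x 1"]] by auto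

text \<open>
  A trace is determined by its projections to pairs of letters that do not commute; the pairs
  \<open>(a, a)\<close> record the multiplicities.
\<close>

definition trace :: "tsym list \<Rightarrow> tsym \<times> tsym \<Rightarrow> tsym list" where
  "trace w = (\<lambda>(a, b). if commuting a b then [] else filter (\<lambda>l. l = a \<or> l = b) w)"

lemma trace_eq_iff: "trace u = trace v \<longleftrightarrow>
    (\<forall>a b. \<not> commuting a b \<longrightarrow> filter (\<lambda>l. l = a \<or> l = b) u = filter (\<lambda>l. l = a \<or> l = b) v)"
  by (auto simp: trace_def fun_eq_iff)

lemma trace_swap: "commuting a b \<Longrightarrow> trace (u @ a # b # v) = trace (u @ b # a # v)"
  by (auto simp: trace_eq_iff dest: commuting_sym)

lemma trace_count: "trace u = trace v \<Longrightarrow> filter (\<lambda>l. l = a) u = filter (\<lambda>l. l = a) v"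
  using commuting_irrefl[of a] unfolding trace_eq_iff by (metis (mono_tags, lifting) filter_cong)

lemma trace_mset: "trace u = trace v \<Longrightarrow> mset u = mset v"
  by (rule multiset_eqI) (metis (full_types) count_mset filter_eq_replicate_mset length_replicate mset_filter
     size_mset size_replicate_mset trace_count)

lemma comm_ideal_front:
  assumes "\<forall>b\<in>set p. commuting a b"
  shows "frag_of (p @ a # q) - frag_of (a # p @ q) \<in> comm_ideal" "trace (p @ a # q) = trace (a # p @ q)"
proof -
  have "frag_of (p @ a # q) - frag_of (a # p @ q) \<in> comm_ideal \<and> trace (p @ a # q) = trace (a # p @ q)"
    using assms
  proof (induction p)
    case (Cons b p)
    then have 1: "frag_of [b] * (frag_of (p @ a # q) - frag_of (a # p @ q)) \<in> comm_ideal"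
      by (intro comm_ideal_mult_left) simp
    have "1 * (frag_of [b, a] - frag_of [a, b]) * frag_of (p @ q) \<in> comm_ideal"
      by (rule comm_ideal.rel) (use Cons.prems commuting_sym in auto)
    from comm_ideal_add[OF 1 this] have "frag_of ((b # p) @ a # q) - frag_of (a # (b # p) @ q) \<in> comm_ideal"
      by (simp add: ring_distribs flip: frag_of_append)
    moreover have "trace (b # p @ a # q) = trace (b # a # p @ q)"
      using Cons by (auto simp: trace_eq_iff)
    moreover have "trace (b # a # p @ q) = trace (a # b # p @ q)"
      using trace_swap[of b a "[]"] Cons.prems commuting_sym by simp
    ultimately show ?case by simp
  qed (simp add: comm_ideal.zero)
  then show "frag_of (p @ a # q) - frag_of (a # p @ q) \<in> comm_ideal" "trace (p @ a # q) = trace (a # p @ q)" by auto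
qed

text \<open>The first letter of \<open>u\<close> can be brought to the front of \<open>v\<close> and
  cancelled there.\<close>

lemma trace_eq_imp_comm_ideal: "trace u = trace v \<Longrightarrow> frag_of u - frag_of v \<in> comm_ideal"
proof (induction u arbitrary: v)
  case Nil
  then have "v = []" using trace_mset[of "[]" v] by simp
  then show ?case by (simp add: comm_ideal.zero)
next
  case (Cons a u)
  have "a \<in> set v" using trace_mset[OF Cons.prems] by (metis list.set_intros(1) set_mset_mset)
  then obtain p q where v: "v = p @ a # q" "a \<notin> set p" by (meson split_list_first)
  \<comment> \<open>A letter \<open>b\<close> before the first \<open>a\<close> in \<open>v\<close>
    that does not commute with \<open>a\<close> would come first in the projection of
    \<open>v\<close> to these two letters, whereas the projection of \<open>a # u\<close> starts
    with \<open>a\<close>.\<close>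
  have front: "\<forall>b\<in>set p. commuting a b"
  proof (rule ballI, rule ccontr)
    fix b assume b: "b \<in> set p" "\<not> commuting a b"
    then have eq: "filter (\<lambda>l. l = a \<or> l = b) (a # u) = filter (\<lambda>l. l = a \<or> l = b) (p @ a # q)"
      using Cons.prems v(1) unfolding trace_eq_iff by blast
    have "filter (\<lambda>l. l = a \<or> l = b) p \<noteq> []" using b(1) by (auto simp: filter_empty_conv)
    then obtain c r where cr: "filter (\<lambda>l. l = a \<or> l = b) p = c # r" by (cases "filter (\<lambda>l. l = a \<or> l = b) p") auto
    then have "c \<in> set (filter (\<lambda>l. l = a \<or> l = b) p)" by simp
    then have "c \<in> set p" by simp
    moreover have "c = a" using eq cr by simp
    ultimately show False using v(2) by simp
  qed
  have "trace (a # u) = trace (a # p @ q)" using Cons.prems v(1) comm_ideal_front(2)[OF front] by simp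
  then have "trace u = trace (p @ q)" by (auto simp: trace_eq_iff split: if_splits)
  then have "frag_of [a] * (frag_of u - frag_of (p @ q)) \<in> comm_ideal"
    by (intro comm_ideal_mult_left Cons.IH)
  from comm_ideal.diff[OF this comm_ideal_front(1)[OF front, of q]] show ?case
    by (simp add: v(1) ring_distribs flip: frag_of_append)
qed

definition trf :: "(tsym list \<Rightarrow>\<^sub>0 int) \<Rightarrow> ((tsym \<times> tsym \<Rightarrow> tsym list) \<Rightarrow>\<^sub>0 int)" where
  "trf = frag_extend (\<lambda>w. frag_of (trace w))"

lemma trf_simps [simp]: "trf 0 = 0" "trf (x - y) = trf x - trf y" "trf (x + y) = trf x + trf y"
  "trf (frag_of w) = frag_of (trace w)"
  by (simp_all add: trf_def frag_extend_diff frag_extend_add)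

lemma comm_ideal_iff: "x \<in> comm_ideal \<longleftrightarrow> trf x = 0"
proof
  show "x \<in> comm_ideal \<Longrightarrow> trf x = 0"
  proof (induction rule: comm_ideal.induct)
    case (rel a b x y)
    show ?case
    proof (induction x rule: frag_ind)
      case (one u)
      show ?case
      proof (induction y rule: frag_ind)
        case (one v)
        then show ?case using trace_swap[OF rel, of u v] by (simp add: ring_distribs flip: frag_of_append)
      qed (simp_all add: ring_distribs)
    qed (simp_all add: ring_distribs)
  qed simp_all
  assume x: "trf x = 0"
  \<comment> \<open>\<open>s\<close> picks a word for every trace and so inverts \<open>trf\<close>
    modulo the ideal.\<close>
  define s where "s = frag_extend (\<lambda>\<tau>. frag_of (SOME w. trace w = \<tau>))"
  have "x - s (trf x) \<in> comm_ideal"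
  proof (rule add_subgroup_linear[OF comm_ideal_subgroup, where f = "\<lambda>x. x - s (trf x)"])
    show "frag_of w - s (trf (frag_of w)) \<in> comm_ideal" for w
      using someI[of "\<lambda>v. trace v = trace w" w] by (simp add: s_def trace_eq_imp_comm_ideal)
  qed (simp add: s_def frag_extend_diff)
  then show "x \<in> comm_ideal" by (simp add: x s_def)
qed

text \<open>Membership is detected by the coefficients of traces, which are integers.\<close>

lemma AI_torsion_free: "m \<noteq> 0 \<Longrightarrow> frag_cmul m x \<in> AI \<Longrightarrow> x \<in> AI"
  by (simp add: AI_iff comm_ideal_iff word_act_def trf_def frag_extend_cmul)

end

section \<open>The lower central series\<close>

context group
begin

lemma cancel_left: "x \<in> carrier G \<Longrightarrow> y \<in> carrier G \<Longrightarrow> x \<otimes> (inv x \<otimes> y) = y"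
  "x \<in> carrier G \<Longrightarrow> y \<in> carrier G \<Longrightarrow> inv x \<otimes> (x \<otimes> y) = y"
  by (simp_all flip: m_assoc)

lemmas group_simps = commutator_def m_assoc inv_mult_group cancel_left

lemma commutator_closed [simp]: "x \<in> carrier G \<Longrightarrow> y \<in> carrier G \<Longrightarrow> commutator G x y \<in> carrier G"
  by (simp add: commutator_def)

lemma commutator_self: "x \<in> carrier G \<Longrightarrow> commutator G x x = \<one>"
  by (simp add: group_simps)

lemma commutator_one: "x \<in> carrier G \<Longrightarrow> commutator G x \<one> = \<one>" "x \<in> carrier G \<Longrightarrow> commutator G \<one> x = \<one>"
  by (simp_all add: group_simps)

lemma inv_commutator:
  "x \<in> carrier G \<Longrightarrow> y \<in> carrier G \<Longrightarrow> inv (commutator G x y) = commutator G y x"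
  by (simp add: group_simps)

lemma mult_commutator:
  "x \<in> carrier G \<Longrightarrow> y \<in> carrier G \<Longrightarrow> y \<otimes> x \<otimes> commutator G x y = x \<otimes> y"
  by (simp add: group_simps)

lemma commutator_eq_one_iff:
  "x \<in> carrier G \<Longrightarrow> y \<in> carrier G \<Longrightarrow> commutator G x y = \<one> \<longleftrightarrow> x \<otimes> y = y \<otimes> x"
  using mult_commutator[of x y] by (metis commutator_closed l_cancel_one m_closed r_one)

lemma commutator_mult_left:
  assumes "x \<in> carrier G" "y \<in> carrier G" "z \<in> carrier G"
  shows "commutator G (x \<otimes> y) z = inv y \<otimes> commutator G x z \<otimes> y \<otimes> commutator G y z"
  using assms by (simp add: group_simps)

lemma commutator_mult_right:
  assumes "x \<in> carrier G" "y \<in> carrier G" "z \<in> carrier G"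
  shows "commutator G x (y \<otimes> z) = commutator G x z \<otimes> (inv z \<otimes> commutator G x y \<otimes> z)"
  using assms by (simp add: group_simps)

lemma conj_eq_mult_commutator:
  "x \<in> carrier G \<Longrightarrow> y \<in> carrier G \<Longrightarrow> inv y \<otimes> x \<otimes> y = x \<otimes> commutator G x y"
  by (simp add: group_simps)

lemma hall_witt:
  assumes "x \<in> carrier G" "y \<in> carrier G" "z \<in> carrier G"
  shows "(inv y \<otimes> commutator G (commutator G x (inv y)) z \<otimes> y) \<otimes>
     (inv z \<otimes> commutator G (commutator G y (inv z)) x \<otimes> z) \<otimes>
     (inv x \<otimes> commutator G (commutator G z (inv x)) y \<otimes> x) = \<one>"
  using assms by (simp add: group_simps)

abbreviation \<gamma> :: "nat \<Rightarrow> 'a set" where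
  "\<gamma> \<equiv> lower_central G"

lemma carrier_normal: "carrier G \<lhd> G"
  by (simp add: normal_inv_iff subgroup_self)

lemma lower_central_Suc:
  "c \<ge> 1 \<Longrightarrow> \<gamma> (Suc c) = generate G {commutator G x y | x y. x \<in> \<gamma> c \<and> y \<in> carrier G}"
  by (cases c) simp_all

lemma conj_commutator:
  "x \<in> carrier G \<Longrightarrow> y \<in> carrier G \<Longrightarrow> g \<in> carrier G \<Longrightarrow>
    g \<otimes> commutator G x y \<otimes> inv g = commutator G (g \<otimes> x \<otimes> inv g) (g \<otimes> y \<otimes> inv g)"
  by (simp add: group_simps)

lemma lower_central_normal: "\<gamma> c \<lhd> G"
proof (induction c)
  case 0
  show ?case by (simp add: carrier_normal)
next
  case (Suc c)
  show ?case
  proof (cases "c = 0")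
    case True
    then show ?thesis by (simp add: carrier_normal)
  next
    case False
    interpret N: normal "\<gamma> c" G by (rule Suc)
    show ?thesis
      unfolding lower_central_Suc[of c, unfolded One_nat_def Suc_le_eq, OF False[unfolded neq0_conv]]
    proof (rule normal_generateI)
      show "{commutator G x y |x y. x \<in> \<gamma> c \<and> y \<in> carrier G} \<subseteq> carrier G"
        using N.subset by auto
      fix h g assume "h \<in> {commutator G x y |x y. x \<in> \<gamma> c \<and> y \<in> carrier G}" and g: "g \<in> carrier G"
      then obtain x y where h: "h = commutator G x y" "x \<in> \<gamma> c" "y \<in> carrier G" by blast
      then have "g \<otimes> h \<otimes> inv g = commutator G (g \<otimes> x \<otimes> inv g) (g \<otimes> y \<otimes> inv g)"
        using g N.subset by (simp add: conj_commutator subsetD)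
      moreover have "g \<otimes> x \<otimes> inv g \<in> \<gamma> c" using g h(2) by (rule N.inv_op_closed2)
      ultimately show "g \<otimes> h \<otimes> inv g \<in> {commutator G x y |x y. x \<in> \<gamma> c \<and> y \<in> carrier G}"
        using g h(3) by blast
    qed
  qed
qed

lemma lower_central_subgroup: "subgroup (\<gamma> c) G"
  by (rule normal_imp_subgroup[OF lower_central_normal])

lemma lower_central_carrier: "x \<in> \<gamma> c \<Longrightarrow> x \<in> carrier G"
  by (rule subgroup.mem_carrier[OF lower_central_subgroup])

lemmas lower_central_mult = subgroup.m_closed[OF lower_central_subgroup]
  and lower_central_inv = subgroup.m_inv_closed[OF lower_central_subgroup]
  and lower_central_one = subgroup.one_closed[OF lower_central_subgroup]
  and lower_central_conj = normal.inv_op_closed1[OF lower_central_normal]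

lemma commutator_lower_central_Suc:
  "c \<ge> 1 \<Longrightarrow> x \<in> \<gamma> c \<Longrightarrow> y \<in> carrier G \<Longrightarrow> commutator G x y \<in> \<gamma> (Suc c)"
  unfolding lower_central_Suc by (rule generate.incl) blast

lemma lower_central_Suc_subset: "\<gamma> (Suc c) \<subseteq> \<gamma> c"
proof (cases "c = 0")
  case False
  then have c: "c \<ge> 1" by simp
  show ?thesis
    unfolding lower_central_Suc[OF c]
  proof (rule generate_subgroup_incl[OF _ lower_central_subgroup])
    show "{commutator G x y |x y. x \<in> \<gamma> c \<and> y \<in> carrier G} \<subseteq> \<gamma> c"
    proof clarify
      fix x y assume xy: "x \<in> \<gamma> c" "y \<in> carrier G"
      have "commutator G x y = inv x \<otimes> (inv y \<otimes> x \<otimes> y)"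
        using xy lower_central_carrier by (simp add: group_simps)
      then show "commutator G x y \<in> \<gamma> c"
        using lower_central_mult[OF lower_central_inv[OF xy(1)] lower_central_conj[OF xy(2,1)]] by simp
    qed
  qed
qed simp

text \<open>The elements that commute with \<open>y\<close> modulo \<open>N\<close> form a
  subgroup.\<close>

lemma commutator_generate_left:
  assumes "N \<lhd> G" "S \<subseteq> carrier G" "y \<in> carrier G" "\<And>s. s \<in> S \<Longrightarrow> commutator G s y \<in> N" "x \<in> generate G S"
  shows "commutator G x y \<in> N"
  using assms(5)
proof (induction x rule: generate.induct)
  interpret N: normal N G by fact
  case one
  then show ?case using assms(3) by (simp add: commutator_one)
next
  case (incl h)
  then show ?case by (rule assms(4))
next
  interpret N: normal N G by fact
  case (inv h)
  then have h: "h \<in> carrier G" using assms(2) by blast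
  have "commutator G (inv h) y = inv (inv h) \<otimes> inv (commutator G h y) \<otimes> inv h"
    using h assms(3) by (simp add: group_simps)
  then show ?case using N.inv_op_closed1[OF inv_closed[OF h] N.m_inv_closed[OF assms(4)[OF inv]]] by simp
next
  interpret N: normal N G by fact
  case (eng a b)
  then have "a \<in> carrier G" "b \<in> carrier G" using generate_in_carrier[OF assms(2)] by blast+
  then show ?case using eng N.inv_op_closed1 assms(3) by (simp add: commutator_mult_left)
qed

text \<open>The three subgroups lemma, by induction on \<open>j\<close>: two of the Hall--Witt
  factors lie in the normal subgroup, hence so does the third.\<close>

theorem commutator_lower_central:
  assumes "i \<ge> 1" "j \<ge> 1" "x \<in> \<gamma> i" "y \<in> \<gamma> j"
  shows "commutator G x y \<in> \<gamma> (i + j)"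
  using assms(2,1,3,4)
proof (induction j arbitrary: i x y rule: nat_induct_at_least)
  case base
  then show ?case using commutator_lower_central_Suc[of i x y] by simp
next
  case (Suc j)
  let ?N = "\<gamma> (i + Suc j)"
  interpret N: normal ?N G by (rule lower_central_normal)
  have x: "x \<in> carrier G" using Suc.prems lower_central_carrier by blast
  have gen: "commutator G (commutator G u v) x \<in> ?N" if uv: "u \<in> \<gamma> j" "v \<in> carrier G" for u v
  proof -
    have u: "u \<in> carrier G" using uv lower_central_carrier by blast
    \<comment> \<open>Hall--Witt is applied to \<open>x\<close>, \<open>u\<close> and the inverse of
      \<open>v\<close>; this choice makes the middle factor \<open>b\<close> a conjugate of
      \<open>[[u, v], x]\<close>.\<close>
    define a where "a = inv u \<otimes> commutator G (commutator G x (inv u)) (inv v) \<otimes> u"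
    define b where "b = inv (inv v) \<otimes> commutator G (commutator G u (inv (inv v))) x \<otimes> inv v"
    define c where "c = inv x \<otimes> commutator G (commutator G (inv v) (inv x)) u \<otimes> x"
    have "commutator G x (inv u) \<in> \<gamma> (i + j)"
      using Suc.IH[of i x "inv u"] Suc.prems uv lower_central_inv by blast
    then have "commutator G (commutator G x (inv u)) (inv v) \<in> ?N"
      using commutator_lower_central_Suc[of "i + j"] Suc.prems(1) uv(2) by simp
    then have a: "a \<in> ?N" unfolding a_def by (rule N.inv_op_closed1[OF u])
    have "commutator G (inv x) (inv v) \<in> \<gamma> (Suc i)"
      using commutator_lower_central_Suc[of i "inv x"] Suc.prems lower_central_inv uv(2) by simp
    then have "commutator G (inv v) (inv x) \<in> \<gamma> (Suc i)"
      using inv_commutator[of "inv x" "inv v"] lower_central_inv x uv(2) by fastforce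
    then have "commutator G (commutator G (inv v) (inv x)) u \<in> ?N"
      using Suc.IH[of "Suc i" "commutator G (inv v) (inv x)" u] uv(1) by simp
    then have c: "c \<in> ?N" unfolding c_def by (rule N.inv_op_closed1[OF x])
    have carr: "a \<in> carrier G" "b \<in> carrier G" "c \<in> carrier G"
      unfolding a_def b_def c_def using x u uv(2) by simp_all
    have "a \<otimes> b \<otimes> c = \<one>"
      using hall_witt[of x u "inv v"] x u uv(2) by (simp add: a_def b_def c_def)
    then have "b = inv a \<otimes> inv c"
      using carr by (metis inv_closed inv_solve_left inv_solve_right l_one m_closed)
    then have "b \<in> ?N" using a c by (simp add: lower_central_mult lower_central_inv)
    then have "inv v \<otimes> b \<otimes> v \<in> ?N" by (rule N.inv_op_closed1[OF uv(2)])
    moreover have "inv v \<otimes> b \<otimes> v = commutator G (commutator G u v) x"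
      unfolding b_def using x u uv(2) by (simp add: m_assoc cancel_left)
    ultimately show ?thesis by simp
  qed
  have "commutator G y x \<in> ?N"
  proof (rule commutator_generate_left[OF lower_central_normal _ x])
    show "{commutator G u v |u v. u \<in> \<gamma> j \<and> v \<in> carrier G} \<subseteq> carrier G"
      using lower_central_carrier by auto
    show "y \<in> generate G {commutator G u v |u v. u \<in> \<gamma> j \<and> v \<in> carrier G}"
      using Suc.prems(3) lower_central_Suc[OF Suc.hyps] by simp
  qed (use gen in blast)
  then show ?case
    using inv_commutator[of y x] N.m_inv_closed x lower_central_carrier[OF Suc.prems(3)] by fastforce
qed

subsection \<open>Cosets of the lower central series\<close>

abbreviation cl :: "nat \<Rightarrow> 'a \<Rightarrow> 'a set" where
  "cl c x \<equiv> \<gamma> (Suc c) #> x"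

abbreviation Q :: "nat \<Rightarrow> 'a set monoid" where
  "Q \<equiv> lower_central_quotient G"

lemma rcos_eq_iff:
  assumes "subgroup H G" "x \<in> carrier G" "y \<in> carrier G"
  shows "H #> x = H #> y \<longleftrightarrow> x \<otimes> inv y \<in> H"
proof
  assume "H #> x = H #> y"
  then have "x \<in> H #> y" using rcos_self[OF assms(2,1)] by simp
  then obtain h where "h \<in> H" "x = h \<otimes> y" by (auto simp: r_coset_def)
  then show "x \<otimes> inv y \<in> H"
    using assms subgroup.mem_carrier[OF assms(1)] by (simp add: m_assoc)
next
  assume *: "x \<otimes> inv y \<in> H"
  have "x = (x \<otimes> inv y) \<otimes> y" using assms by (simp add: m_assoc)
  then have "x \<in> H #> y" using * unfolding r_coset_def by blast
  then show "H #> x = H #> y" using repr_independence[OF _ assms(3,1)] by simp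
qed

lemmas cl_eq_iff = rcos_eq_iff[OF lower_central_subgroup]

lemma cl_one_iff: "x \<in> carrier G \<Longrightarrow> cl c x = \<gamma> (Suc c) \<longleftrightarrow> x \<in> \<gamma> (Suc c)"
  using cl_eq_iff[of x \<one> "Suc c"] coset_join2[OF one_closed lower_central_subgroup lower_central_one] by simp

lemma r_coset_carrier_update: "r_coset (G\<lparr>carrier := S\<rparr>) H x = H #> x"
  by (simp add: r_coset_def)

lemma lcq_carrier: "carrier (Q c) = cl c ` \<gamma> c"
  by (auto simp: lower_central_quotient_def FactGroup_def RCOSETS_def r_coset_carrier_update)

lemma lcq_one: "\<one>\<^bsub>Q c\<^esub> = \<gamma> (Suc c)"
  by (simp add: lower_central_quotient_def)

lemma lcq_mult: "x \<in> carrier G \<Longrightarrow> y \<in> carrier G \<Longrightarrow> cl c x \<otimes>\<^bsub>Q c\<^esub> cl c y = cl c (x \<otimes> y)"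
  using normal.rcos_sum[OF lower_central_normal, of x y "Suc c"]
  by (simp add: lower_central_quotient_def set_mult_def)

lemma lcq_group: "group (Q c)"
  unfolding lower_central_quotient_def
  by (intro normal.factorgroup_is_group normal_restrict_supergroup lower_central_subgroup
      lower_central_normal lower_central_Suc_subset)

lemma lcq_pow:
  assumes "x \<in> \<gamma> c"
  shows "cl c x [^]\<^bsub>Q c\<^esub> (k::nat) = cl c (x [^] k)"
proof (induction k)
  case 0
  have "\<gamma> (Suc c) \<subseteq> carrier G" using lower_central_carrier by blast
  then show ?case by (simp add: lcq_one coset_mult_one)
next
  case (Suc k)
  then show ?case using assms lower_central_carrier by (simp add: lcq_mult)
qed

lemma cl_commute:
  assumes "c \<ge> 1" "x \<in> \<gamma> c" "y \<in> \<gamma> c"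
  shows "cl c (x \<otimes> y) = cl c (y \<otimes> x)"
proof -
  have xy: "x \<in> carrier G" "y \<in> carrier G" using assms lower_central_carrier by blast+
  have "commutator G (inv x) (inv y) \<in> \<gamma> (Suc c)"
    using commutator_lower_central_Suc[OF assms(1) lower_central_inv[OF assms(2)]] xy by simp
  moreover have "x \<otimes> y \<otimes> inv (y \<otimes> x) = commutator G (inv x) (inv y)"
    using xy by (simp add: group_simps)
  ultimately show ?thesis using cl_eq_iff[of "x \<otimes> y" "y \<otimes> x"] xy by simp
qed

lemma lcq_comm_group:
  assumes "c \<ge> 1"
  shows "comm_group (Q c)"
proof (rule group.group_comm_groupI[OF lcq_group])
  fix X Y assume "X \<in> carrier (Q c)" "Y \<in> carrier (Q c)"
  then obtain x y where "X = cl c x" "x \<in> \<gamma> c" "Y = cl c y" "y \<in> \<gamma> c" by (auto simp: lcq_carrier)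
  then show "X \<otimes>\<^bsub>Q c\<^esub> Y = Y \<otimes>\<^bsub>Q c\<^esub> X"
    using cl_commute[OF assms] lower_central_carrier by (simp add: lcq_mult)
qed

lemma cl_conj:
  assumes "c \<ge> 1" "x \<in> \<gamma> c" "y \<in> carrier G"
  shows "cl c (inv y \<otimes> x \<otimes> y) = cl c x"
proof -
  have x: "x \<in> carrier G" using assms lower_central_carrier by blast
  have "x \<otimes> commutator G x y \<otimes> inv x \<in> \<gamma> (Suc c)"
    using normal.inv_op_closed2[OF lower_central_normal x commutator_lower_central_Suc[OF assms]] .
  then show ?thesis
    using cl_eq_iff[of "inv y \<otimes> x \<otimes> y" x "Suc c"] x assms(3) conj_eq_mult_commutator[OF x assms(3)] by simp
qed

lemma cl_commutator_mult_left:
  assumes "i \<ge> 1" "j \<ge> 1" "x \<in> \<gamma> i" "x' \<in> \<gamma> i" "y \<in> \<gamma> j"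
  shows "cl (i + j) (commutator G (x \<otimes> x') y) = cl (i + j) (commutator G x y) \<otimes>\<^bsub>Q (i + j)\<^esub> cl (i + j) (commutator G x' y)"
proof -
  have c: "x \<in> carrier G" "x' \<in> carrier G" "y \<in> carrier G" using assms lower_central_carrier by blast+
  have "cl (i + j) (inv x' \<otimes> commutator G x y \<otimes> x') = cl (i + j) (commutator G x y)"
    using assms c by (intro cl_conj commutator_lower_central) auto
  then show ?thesis
    using c lcq_mult[of "inv x' \<otimes> commutator G x y \<otimes> x'" "commutator G x' y" "i + j"]
    by (simp add: commutator_mult_left)
qed

lemma cl_commutator_mult_right:
  assumes "i \<ge> 1" "j \<ge> 1" "x \<in> \<gamma> i" "y \<in> \<gamma> j" "y' \<in> \<gamma> j"
  shows "cl (i + j) (commutator G x (y \<otimes> y')) = cl (i + j) (commutator G x y) \<otimes>\<^bsub>Q (i + j)\<^esub> cl (i + j) (commutator G x y')"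
proof -
  have c: "x \<in> carrier G" "y \<in> carrier G" "y' \<in> carrier G" using assms lower_central_carrier by blast+
  interpret Qc: comm_group "Q (i + j)" using assms by (intro lcq_comm_group) simp
  have "cl (i + j) (inv y' \<otimes> commutator G x y \<otimes> y') = cl (i + j) (commutator G x y)"
    using assms c by (intro cl_conj commutator_lower_central) auto
  moreover have "cl (i + j) (commutator G x y) \<in> carrier (Q (i + j))"
    "cl (i + j) (commutator G x y') \<in> carrier (Q (i + j))"
    using assms commutator_lower_central by (auto simp: lcq_carrier)
  ultimately show ?thesis
    using c lcq_mult[of "commutator G x y'" "inv y' \<otimes> commutator G x y \<otimes> y'" "i + j"]
    by (simp add: commutator_mult_right Qc.m_comm)
qed

text \<open>This is why the union in \<open>gr_bracket\<close> is over equal cosets: a change of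
  \<open>x\<close> or \<open>y\<close> within its coset contributes a commutator of degree
  \<open>i + j + 1\<close>.\<close>

lemma cl_commutator_cong:
  assumes "i \<ge> 1" "j \<ge> 1" "x \<in> \<gamma> i" "y \<in> \<gamma> j" "x' \<in> cl i x" "y' \<in> cl j y"
  shows "cl (i + j) (commutator G x' y') = cl (i + j) (commutator G x y)"
proof -
  interpret Qc: comm_group "Q (i + j)" using assms by (intro lcq_comm_group) simp
  obtain h k where h: "h \<in> \<gamma> (Suc i)" "x' = h \<otimes> x" and k: "k \<in> \<gamma> (Suc j)" "y' = k \<otimes> y"
    using assms(5,6) by (auto simp: r_coset_def)
  have hk: "h \<in> \<gamma> i" "k \<in> \<gamma> j" using h k lower_central_Suc_subset by blast+
  have y': "y' \<in> \<gamma> j" using k hk assms lower_central_mult by blast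
  have c: "x \<in> carrier G" "y \<in> carrier G" "y' \<in> carrier G" "h \<in> carrier G" "k \<in> carrier G"
    using assms hk y' lower_central_carrier by blast+
  have in_Q: "cl (i + j) (commutator G x y) \<in> carrier (Q (i + j))"
    using assms commutator_lower_central by (auto simp: lcq_carrier)
  have "commutator G h y' \<in> \<gamma> (Suc (i + j))"
    using commutator_lower_central[of "Suc i" j h y'] h y' assms by simp
  then have 1: "cl (i + j) (commutator G h y') = \<one>\<^bsub>Q (i + j)\<^esub>"
    using cl_one_iff c by (simp add: lcq_one)
  have "commutator G x k \<in> \<gamma> (Suc (i + j))"
    using commutator_lower_central[of i "Suc j" x k] k assms by simp
  then have 2: "cl (i + j) (commutator G x k) = \<one>\<^bsub>Q (i + j)\<^esub>"
    using cl_one_iff c by (simp add: lcq_one)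
  have "cl (i + j) (commutator G x' y') = cl (i + j) (commutator G x y')"
    using cl_commutator_mult_left[OF assms(1,2) hk(1) assms(3) y'] 1 in_Q
      commutator_lower_central[OF assms(1-3) y'] by (simp add: h(2) lcq_carrier)
  also have "\<dots> = cl (i + j) (commutator G x y)"
    using cl_commutator_mult_right[OF assms(1-3) hk(2) assms(4)] 2 in_Q by (simp add: k(2))
  finally show ?thesis .
qed

lemma gr_bracket_cl:
  assumes "i \<ge> 1" "j \<ge> 1" "x \<in> \<gamma> i" "y \<in> \<gamma> j"
  shows "gr_bracket G i j (cl i x) (cl j y) = cl (i + j) (commutator G x y)"
proof -
  have "x \<in> cl i x" "y \<in> cl j y"
    using assms lower_central_carrier lower_central_subgroup by (auto intro: rcos_self)
  then show ?thesis
    using cl_commutator_cong[OF assms] unfolding gr_bracket_def by blast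
qed

lemma gr_bracket_closed:
  assumes "i \<ge> 1" "j \<ge> 1" "X \<in> carrier (Q i)" "Y \<in> carrier (Q j)"
  shows "gr_bracket G i j X Y \<in> carrier (Q (i + j))"
  using assms commutator_lower_central by (auto simp: lcq_carrier gr_bracket_cl)

lemma gr_bracket_mult_left:
  assumes "i \<ge> 1" "j \<ge> 1" "X \<in> carrier (Q i)" "X' \<in> carrier (Q i)" "Y \<in> carrier (Q j)"
  shows "gr_bracket G i j (X \<otimes>\<^bsub>Q i\<^esub> X') Y = gr_bracket G i j X Y \<otimes>\<^bsub>Q (i + j)\<^esub> gr_bracket G i j X' Y"
  using assms cl_commutator_mult_left lower_central_carrier lower_central_mult
  by (auto simp: lcq_carrier gr_bracket_cl lcq_mult)

lemma gr_bracket_mult_right: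
  assumes "i \<ge> 1" "j \<ge> 1" "X \<in> carrier (Q i)" "Y \<in> carrier (Q j)" "Y' \<in> carrier (Q j)"
  shows "gr_bracket G i j X (Y \<otimes>\<^bsub>Q j\<^esub> Y') = gr_bracket G i j X Y \<otimes>\<^bsub>Q (i + j)\<^esub> gr_bracket G i j X Y'"
  using assms cl_commutator_mult_right lower_central_carrier lower_central_mult
  by (auto simp: lcq_carrier gr_bracket_cl lcq_mult)

lemma gr_bracket_one:
  assumes "i \<ge> 1" "j \<ge> 1"
  shows "X \<in> carrier (Q i) \<Longrightarrow> gr_bracket G i j X \<one>\<^bsub>Q j\<^esub> = \<one>\<^bsub>Q (i + j)\<^esub>"
    "Y \<in> carrier (Q j) \<Longrightarrow> gr_bracket G i j \<one>\<^bsub>Q i\<^esub> Y = \<one>\<^bsub>Q (i + j)\<^esub>"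
proof -
  have one: "\<one>\<^bsub>Q c\<^esub> = cl c \<one>" for c
    by (simp add: lcq_one coset_join2 lower_central_subgroup lower_central_one)
  show "X \<in> carrier (Q i) \<Longrightarrow> gr_bracket G i j X \<one>\<^bsub>Q j\<^esub> = \<one>\<^bsub>Q (i + j)\<^esub>"
    "Y \<in> carrier (Q j) \<Longrightarrow> gr_bracket G i j \<one>\<^bsub>Q i\<^esub> Y = \<one>\<^bsub>Q (i + j)\<^esub>"
    using assms lower_central_carrier lower_central_one
    by (auto simp: lcq_carrier one gr_bracket_cl commutator_one)
qed

text \<open>Hall--Witt modulo the next term of the series, where conjugations disappear and
  inverting an entry inverts the commutator.\<close>

lemma cl_jacobi:
  assumes "i \<ge> 1" "j \<ge> 1" "k \<ge> 1" "x \<in> \<gamma> i" "y \<in> \<gamma> j" "z \<in> \<gamma> k"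
  shows "commutator G (commutator G x y) z \<otimes> commutator G (commutator G y z) x \<otimes> commutator G (commutator G z x) y
    \<in> \<gamma> (Suc (i + j + k))"
proof -
  let ?n = "i + j + k"
  interpret Qn: comm_group "Q ?n" using assms by (intro lcq_comm_group) simp
  define f where "f x y z = cl ?n (commutator G (commutator G x y) z)" for x y z
  define g where "g x y z = cl ?n (inv y \<otimes> commutator G (commutator G x (inv y)) z \<otimes> y)" for x y z
  have fg: "f x y z \<in> carrier (Q ?n) \<and> g x y z = inv\<^bsub>Q ?n\<^esub> f x y z"
    if "a \<ge> 1" "b \<ge> 1" "c \<ge> 1" "x \<in> \<gamma> a" "y \<in> \<gamma> b" "z \<in> \<gamma> c" "a + b + c = ?n" for a b c x y z
  proof -
    have c: "x \<in> carrier G" "y \<in> carrier G" "z \<in> carrier G" using that lower_central_carrier by blast+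
    note xy = commutator_lower_central[OF that(1,2,4,5)]
    note xy' = commutator_lower_central[OF that(1,2,4) lower_central_inv[OF that(5)]]
    interpret Qab: comm_group "Q (a + b)" using that by (intro lcq_comm_group) simp
    have ab: "a + b \<ge> 1" using that by simp
    have "cl (a + b) (commutator G x (y \<otimes> inv y)) = \<one>\<^bsub>Q (a + b)\<^esub>"
      using c by (simp add: commutator_one lcq_one coset_join2 lower_central_subgroup lower_central_one)
    then have "cl (a + b) (commutator G x y \<otimes> commutator G x (inv y)) = \<one>\<^bsub>Q (a + b)\<^esub>"
      using cl_commutator_mult_right[OF that(1,2,4,5) lower_central_inv[OF that(5)]] c by (simp add: lcq_mult)
    then have "gr_bracket G (a + b) c (cl (a + b) (commutator G x y \<otimes> commutator G x (inv y))) (cl c z) = \<one>\<^bsub>Q (a + b + c)\<^esub>"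
      using gr_bracket_one(2)[OF ab that(3)] that(6) by (simp add: lcq_carrier)
    then have "cl ?n (commutator G (commutator G x y \<otimes> commutator G x (inv y)) z) = \<one>\<^bsub>Q ?n\<^esub>"
      using gr_bracket_cl[OF ab that(3) lower_central_mult[OF xy xy'] that(6)] that(7) by simp
    then have "f x y z \<otimes>\<^bsub>Q ?n\<^esub> f x (inv y) z = \<one>\<^bsub>Q ?n\<^esub>"
      using cl_commutator_mult_left[OF ab that(3) xy xy' that(6)] that(7) by (simp add: f_def)
    moreover have "f x y z \<in> carrier (Q ?n)" "f x (inv y) z \<in> carrier (Q ?n)"
      using commutator_lower_central[OF ab that(3) xy that(6)] commutator_lower_central[OF ab that(3) xy' that(6)] that(7)
      by (auto simp: f_def lcq_carrier)
    moreover have "g x y z = f x (inv y) z"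
      unfolding f_def g_def using commutator_lower_central[OF ab that(3) xy' that(6)] that(7) c assms(1)
      by (intro cl_conj) auto
    ultimately show ?thesis by (metis Qn.inv_equality Qn.m_comm)
  qed
  have c: "x \<in> carrier G" "y \<in> carrier G" "z \<in> carrier G" using assms lower_central_carrier by blast+
  have "g x y z \<otimes>\<^bsub>Q ?n\<^esub> g y z x \<otimes>\<^bsub>Q ?n\<^esub> g z x y = \<one>\<^bsub>Q ?n\<^esub>"
    using c hall_witt[of x y z] unfolding g_def
    by (simp add: lcq_mult lcq_one coset_join2 lower_central_subgroup lower_central_one)
  moreover have A: "f x y z \<in> carrier (Q ?n)" "g x y z = inv\<^bsub>Q ?n\<^esub> f x y z"
    using fg[OF assms refl] by simp_all
  moreover have B: "f y z x \<in> carrier (Q ?n)" "g y z x = inv\<^bsub>Q ?n\<^esub> f y z x"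
    using fg[OF assms(2,3,1,5,6,4)] by (simp_all add: ac_simps)
  moreover have C: "f z x y \<in> carrier (Q ?n)" "g z x y = inv\<^bsub>Q ?n\<^esub> f z x y"
    using fg[OF assms(3,1,2,6,4,5)] by (simp_all add: ac_simps)
  ultimately have "inv\<^bsub>Q ?n\<^esub> (f x y z \<otimes>\<^bsub>Q ?n\<^esub> f y z x \<otimes>\<^bsub>Q ?n\<^esub> f z x y) = \<one>\<^bsub>Q ?n\<^esub>"
    using Qn.inv_mult[OF A(1) B(1)] Qn.inv_mult[OF Qn.m_closed[OF A(1) B(1)] C(1)] by metis
  then have "f x y z \<otimes>\<^bsub>Q ?n\<^esub> f y z x \<otimes>\<^bsub>Q ?n\<^esub> f z x y = \<one>\<^bsub>Q ?n\<^esub>"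
    using Qn.inv_eq_1_iff Qn.m_closed[OF Qn.m_closed[OF A(1) B(1)] C(1)] by metis
  then have "cl ?n (commutator G (commutator G x y) z \<otimes> commutator G (commutator G y z) x \<otimes> commutator G (commutator G z x) y)
      = \<gamma> (Suc ?n)"
    using c by (simp add: f_def lcq_mult lcq_one)
  then show ?thesis using c cl_one_iff by simp
qed

end

section \<open>The graded Lie ring of a group\<close>

lemma finprod_hom:
  assumes "comm_group A" "comm_group B" "f \<in> hom A B" "g \<in> I \<rightarrow> carrier A"
  shows "f (finprod A g I) = finprod B (\<lambda>i. f (g i)) I"
proof -
  interpret A: comm_group A by fact
  interpret B: comm_group B by fact
  interpret group_hom A B f by unfold_locales (rule assms(3))
  show ?thesis
    using assms(4)
  proof (induction I rule: infinite_finite_induct)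
    case (insert i I)
    then show ?case by (simp add: Pi_iff A.finprod_insert B.finprod_insert)
  qed simp_all
qed

context group
begin

lemma gr_simps: "carrier (gr G) = carrier (sum_group {1..} Q)" "monoid.mult (gr G) = monoid.mult (sum_group {1..} Q)"
  "one (gr G) = one (sum_group {1..} Q)"
  by (simp_all add: gr_def Let_def)

lemma gr_mult_apply: "c \<ge> 1 \<Longrightarrow> (u \<otimes>\<^bsub>gr G\<^esub> v) c = u c \<otimes>\<^bsub>Q c\<^esub> v c"
  by (simp add: gr_simps)

lemma gr_one_apply: "c \<ge> 1 \<Longrightarrow> \<one>\<^bsub>gr G\<^esub> c = \<gamma> (Suc c)"
  by (simp add: gr_simps lcq_one)

lemma gr_carrier_iff: "u \<in> carrier (gr G) \<longleftrightarrow>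
    u \<in> extensional {1..} \<and> (\<forall>c\<ge>1. u c \<in> carrier (Q c)) \<and> finite {c. 1 \<le> c \<and> u c \<noteq> \<one>\<^bsub>Q c\<^esub>}"
  by (auto simp: gr_simps carrier_sum_group lcq_group PiE_iff)

lemma gr_apply_closed: "u \<in> carrier (gr G) \<Longrightarrow> c \<ge> 1 \<Longrightarrow> u c \<in> carrier (Q c)"
  by (simp add: gr_carrier_iff)

lemma gr_apply_cl: "u \<in> carrier (gr G) \<Longrightarrow> c \<ge> 1 \<Longrightarrow> \<exists>x\<in>\<gamma> c. u c = cl c x"
  using gr_apply_closed[of u c] by (auto simp: lcq_carrier)

lemma gr_eqI:
  "u \<in> carrier (gr G) \<Longrightarrow> v \<in> carrier (gr G) \<Longrightarrow> (\<And>c. c \<ge> 1 \<Longrightarrow> u c = v c) \<Longrightarrow> u = v"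
  by (rule extensionalityI[of u "{1..}"]) (auto simp: gr_carrier_iff)

lemma gr_comm_group: "comm_group (gr G)"
proof -
  interpret S: group "sum_group {1..} Q" by (simp add: lcq_group)
  have "group (gr G)"
    using S.l_one S.m_assoc S.m_closed S.one_closed S.l_inv_ex
    by (intro groupI) (auto simp: gr_simps simp del: mult_sum_group one_sum_group)
  then show ?thesis
  proof (rule group.group_comm_groupI)
    fix u v assume uv: "u \<in> carrier (gr G)" "v \<in> carrier (gr G)"
    then have "u c \<otimes>\<^bsub>Q c\<^esub> v c = v c \<otimes>\<^bsub>Q c\<^esub> u c" if "c \<ge> 1" for c
      using comm_groupE(4)[OF lcq_comm_group[OF that]] gr_apply_closed that by blast
    then show "u \<otimes>\<^bsub>gr G\<^esub> v = v \<otimes>\<^bsub>gr G\<^esub> u" by (simp add: gr_simps cong: restrict_cong)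
  qed
qed

lemma gr_bracket_apply:
  "k \<ge> 1 \<Longrightarrow> bracket (gr G) u v k = finprod (Q k) (\<lambda>i. gr_bracket G i (k - i) (u i) (v (k - i))) {1..<k}"
  by (simp add: gr_def Let_def)

lemma gr_bracket_term_closed:
  assumes "u \<in> carrier (gr G)" "v \<in> carrier (gr G)"
  shows "(\<lambda>i. gr_bracket G i (k - i) (u i) (v (k - i))) \<in> {1..<k} \<rightarrow> carrier (Q k)"
proof
  fix i assume "i \<in> {1..<k}"
  then have "i \<ge> 1" "k - i \<ge> 1" "i + (k - i) = k" by auto
  then show "gr_bracket G i (k - i) (u i) (v (k - i)) \<in> carrier (Q k)"
    using gr_bracket_closed[of i "k - i" "u i" "v (k - i)"] assms by (simp add: gr_apply_closed)
qed

lemma lie_bracket_closed: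
  assumes "u \<in> carrier (gr G)" "v \<in> carrier (gr G)"
  shows "bracket (gr G) u v \<in> carrier (gr G)"
proof -
  let ?b = "bracket (gr G) u v"
  have closed: "?b k \<in> carrier (Q k)" if "k \<ge> 1" for k
  proof -
    interpret Qk: comm_group "Q k" using that by (rule lcq_comm_group)
    show ?thesis using gr_bracket_term_closed[OF assms] that by (simp add: gr_bracket_apply)
  qed
  obtain A B where A: "\<And>c. c \<ge> 1 \<Longrightarrow> u c \<noteq> \<one>\<^bsub>Q c\<^esub> \<Longrightarrow> c < A" and B: "\<And>c. c \<ge> 1 \<Longrightarrow> v c \<noteq> \<one>\<^bsub>Q c\<^esub> \<Longrightarrow> c < B"
    using assms finite_nat_bounded[of "{c. 1 \<le> c \<and> u c \<noteq> \<one>\<^bsub>Q c\<^esub>}"] finite_nat_bounded[of "{c. 1 \<le> c \<and> v c \<noteq> \<one>\<^bsub>Q c\<^esub>}"]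
    unfolding gr_carrier_iff by blast
  \<comment> \<open>In degree \<open>A + B\<close> or more, every summand has a trivial component on
    one side.\<close>
  have "?b k = \<one>\<^bsub>Q k\<^esub>" if "k \<ge> A + B" "k \<ge> 1" for k
  proof -
    interpret Qk: comm_group "Q k" using that by (intro lcq_comm_group)
    have "gr_bracket G i (k - i) (u i) (v (k - i)) = \<one>\<^bsub>Q k\<^esub>" if i: "i \<in> {1..<k}" for i
    proof (cases "i < A")
      case True
      then have "v (k - i) = \<one>\<^bsub>Q (k - i)\<^esub>" using B[of "k - i"] i \<open>k \<ge> A + B\<close> by force
      then show ?thesis using gr_bracket_one(1)[of i "k - i" "u i"] i assms
        by (simp add: gr_apply_closed Suc_leI)
    next
      case False
      then have "u i = \<one>\<^bsub>Q i\<^esub>" using A[of i] i by force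
      then show ?thesis using gr_bracket_one(2)[of i "k - i" "v (k - i)"] i assms
        by (simp add: gr_apply_closed Suc_leI)
    qed
    then have "finprod (Q k) (\<lambda>i. gr_bracket G i (k - i) (u i) (v (k - i))) {1..<k} = \<one>\<^bsub>Q k\<^esub>"
      by (rule Qk.finprod_one_eqI)
    then show ?thesis using that by (simp add: gr_bracket_apply)
  qed
  then have "{c. 1 \<le> c \<and> ?b c \<noteq> \<one>\<^bsub>Q c\<^esub>} \<subseteq> {..<A + B}" by force
  moreover have "?b \<in> extensional {1..}" by (simp add: gr_def Let_def)
  ultimately show ?thesis using closed by (simp add: gr_carrier_iff finite_subset[OF _ finite_lessThan])
qed

lemma lie_bracket_mult_left:
  assumes "u \<in> carrier (gr G)" "u' \<in> carrier (gr G)" "v \<in> carrier (gr G)"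
  shows "bracket (gr G) (u \<otimes>\<^bsub>gr G\<^esub> u') v = bracket (gr G) u v \<otimes>\<^bsub>gr G\<^esub> bracket (gr G) u' v"
proof (rule gr_eqI)
  interpret L: comm_group "gr G" by (rule gr_comm_group)
  show "bracket (gr G) (u \<otimes>\<^bsub>gr G\<^esub> u') v \<in> carrier (gr G)"
    "bracket (gr G) u v \<otimes>\<^bsub>gr G\<^esub> bracket (gr G) u' v \<in> carrier (gr G)"
    using assms by (simp_all add: lie_bracket_closed)
  fix k :: nat assume k: "k \<ge> 1"
  interpret Qk: comm_group "Q k" using k by (rule lcq_comm_group)
  have "finprod (Q k) (\<lambda>i. gr_bracket G i (k - i) ((u \<otimes>\<^bsub>gr G\<^esub> u') i) (v (k - i))) {1..<k}
     = finprod (Q k) (\<lambda>i. gr_bracket G i (k - i) (u i) (v (k - i)) \<otimes>\<^bsub>Q k\<^esub> gr_bracket G i (k - i) (u' i) (v (k - i))) {1..<k}"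
  proof (rule Qk.finprod_cong')
    show "(\<lambda>i. gr_bracket G i (k - i) (u i) (v (k - i)) \<otimes>\<^bsub>Q k\<^esub> gr_bracket G i (k - i) (u' i) (v (k - i))) \<in> {1..<k} \<rightarrow> carrier (Q k)"
      using gr_bracket_term_closed[OF assms(1,3), of k] gr_bracket_term_closed[OF assms(2,3), of k] by (auto simp: Pi_iff)
    fix i assume "i \<in> {1..<k}"
    then have "i \<ge> 1" "k - i \<ge> 1" "i + (k - i) = k" by auto
    then show "gr_bracket G i (k - i) ((u \<otimes>\<^bsub>gr G\<^esub> u') i) (v (k - i)) =
        gr_bracket G i (k - i) (u i) (v (k - i)) \<otimes>\<^bsub>Q k\<^esub> gr_bracket G i (k - i) (u' i) (v (k - i))"
      using gr_bracket_mult_left[of i "k - i" "u i" "u' i" "v (k - i)"] assms by (simp add: gr_mult_apply gr_apply_closed)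
  qed simp
  then show "bracket (gr G) (u \<otimes>\<^bsub>gr G\<^esub> u') v k = (bracket (gr G) u v \<otimes>\<^bsub>gr G\<^esub> bracket (gr G) u' v) k"
    using gr_bracket_term_closed[OF assms(1,3), of k] gr_bracket_term_closed[OF assms(2,3), of k] k
    by (simp add: gr_mult_apply gr_bracket_apply)
qed

lemma lie_bracket_mult_right:
  assumes "u \<in> carrier (gr G)" "v \<in> carrier (gr G)" "v' \<in> carrier (gr G)"
  shows "bracket (gr G) u (v \<otimes>\<^bsub>gr G\<^esub> v') = bracket (gr G) u v \<otimes>\<^bsub>gr G\<^esub> bracket (gr G) u v'"
proof (rule gr_eqI)
  interpret L: comm_group "gr G" by (rule gr_comm_group)
  show "bracket (gr G) u (v \<otimes>\<^bsub>gr G\<^esub> v') \<in> carrier (gr G)"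
    "bracket (gr G) u v \<otimes>\<^bsub>gr G\<^esub> bracket (gr G) u v' \<in> carrier (gr G)"
    using assms by (simp_all add: lie_bracket_closed)
  fix k :: nat assume k: "k \<ge> 1"
  interpret Qk: comm_group "Q k" using k by (rule lcq_comm_group)
  have "finprod (Q k) (\<lambda>i. gr_bracket G i (k - i) (u i) ((v \<otimes>\<^bsub>gr G\<^esub> v') (k - i))) {1..<k}
     = finprod (Q k) (\<lambda>i. gr_bracket G i (k - i) (u i) (v (k - i)) \<otimes>\<^bsub>Q k\<^esub> gr_bracket G i (k - i) (u i) (v' (k - i))) {1..<k}"
  proof (rule Qk.finprod_cong')
    show "(\<lambda>i. gr_bracket G i (k - i) (u i) (v (k - i)) \<otimes>\<^bsub>Q k\<^esub> gr_bracket G i (k - i) (u i) (v' (k - i))) \<in> {1..<k} \<rightarrow> carrier (Q k)"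
      using gr_bracket_term_closed[OF assms(1,2), of k] gr_bracket_term_closed[OF assms(1,3), of k] by (auto simp: Pi_iff)
    fix i assume "i \<in> {1..<k}"
    then have "i \<ge> 1" "k - i \<ge> 1" "i + (k - i) = k" by auto
    then show "gr_bracket G i (k - i) (u i) ((v \<otimes>\<^bsub>gr G\<^esub> v') (k - i)) =
        gr_bracket G i (k - i) (u i) (v (k - i)) \<otimes>\<^bsub>Q k\<^esub> gr_bracket G i (k - i) (u i) (v' (k - i))"
      using gr_bracket_mult_right[of i "k - i" "u i" "v (k - i)" "v' (k - i)"] assms by (simp add: gr_mult_apply gr_apply_closed)
  qed simp
  then show "bracket (gr G) u (v \<otimes>\<^bsub>gr G\<^esub> v') k = (bracket (gr G) u v \<otimes>\<^bsub>gr G\<^esub> bracket (gr G) u v') k"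
    using gr_bracket_term_closed[OF assms(1,2), of k] gr_bracket_term_closed[OF assms(1,3), of k] k
    by (simp add: gr_mult_apply gr_bracket_apply)
qed

lemma gr_class_apply: "k \<ge> 1 \<Longrightarrow> gr_class G c x k = (if k = c then cl c x else \<one>\<^bsub>Q k\<^esub>)"
  by (simp add: gr_class_def)

lemma gr_class_closed:
  assumes "x \<in> \<gamma> c"
  shows "gr_class G c x \<in> carrier (gr G)"
proof -
  have "gr_class G c x k \<in> carrier (Q k)" if "k \<ge> 1" for k
    using that assms group.is_monoid[OF lcq_group[of k]] by (auto simp: gr_class_apply lcq_carrier[of c] monoid.one_closed)
  moreover have "{k. 1 \<le> k \<and> gr_class G c x k \<noteq> \<one>\<^bsub>Q k\<^esub>} \<subseteq> {c}"
    by (auto simp: gr_class_apply)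
  ultimately show ?thesis using finite_subset by (auto simp: gr_carrier_iff gr_class_def)
qed

lemma gr_class_mult:
  assumes "x \<in> \<gamma> c" "y \<in> \<gamma> c"
  shows "gr_class G c (x \<otimes> y) = gr_class G c x \<otimes>\<^bsub>gr G\<^esub> gr_class G c y"
proof (rule gr_eqI)
  interpret L: comm_group "gr G" by (rule gr_comm_group)
  show "gr_class G c (x \<otimes> y) \<in> carrier (gr G)" "gr_class G c x \<otimes>\<^bsub>gr G\<^esub> gr_class G c y \<in> carrier (gr G)"
    using assms by (simp_all add: gr_class_closed lower_central_mult)
  fix k :: nat assume "k \<ge> 1"
  then show "gr_class G c (x \<otimes> y) k = (gr_class G c x \<otimes>\<^bsub>gr G\<^esub> gr_class G c y) k"
    using assms lower_central_carrier group.is_monoid[OF lcq_group[of k]]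
    by (simp add: gr_mult_apply gr_class_apply lcq_mult monoid.l_one monoid.one_closed)
qed

lemma gr_class_eq_one_iff:
  assumes "c \<ge> 1" "x \<in> \<gamma> c"
  shows "gr_class G c x = \<one>\<^bsub>gr G\<^esub> \<longleftrightarrow> x \<in> \<gamma> (Suc c)"
proof -
  interpret L: comm_group "gr G" by (rule gr_comm_group)
  have "gr_class G c x = \<one>\<^bsub>gr G\<^esub> \<longleftrightarrow> cl c x = \<gamma> (Suc c)"
  proof
    assume "gr_class G c x = \<one>\<^bsub>gr G\<^esub>"
    then show "cl c x = \<gamma> (Suc c)" using gr_class_apply[of c c x] gr_one_apply[of c] assms(1) by simp
  next
    assume "cl c x = \<gamma> (Suc c)"
    then show "gr_class G c x = \<one>\<^bsub>gr G\<^esub>"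
      using assms by (intro gr_eqI) (auto simp: gr_class_closed gr_class_apply gr_one_apply lcq_one)
  qed
  then show ?thesis using cl_one_iff assms lower_central_carrier by simp
qed

lemma gr_class_inv:
  assumes "c \<ge> 1" "x \<in> \<gamma> c"
  shows "gr_class G c (inv x) = inv\<^bsub>gr G\<^esub> gr_class G c x"
proof -
  interpret L: comm_group "gr G" by (rule gr_comm_group)
  have "gr_class G c (inv x) \<otimes>\<^bsub>gr G\<^esub> gr_class G c x = gr_class G c \<one>"
    using assms lower_central_carrier lower_central_inv by (simp flip: gr_class_mult)
  then show ?thesis
    using assms gr_class_eq_one_iff[OF assms(1) lower_central_one] lower_central_one lower_central_inv gr_class_closed
    by (metis L.inv_equality)
qed

lemma lie_bracket_gr_class:
  assumes "c \<ge> 1" "d \<ge> 1" "x \<in> \<gamma> c" "y \<in> \<gamma> d"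
  shows "bracket (gr G) (gr_class G c x) (gr_class G d y) = gr_class G (c + d) (commutator G x y)"
proof (rule gr_eqI)
  note cls = gr_class_closed[OF assms(3)] gr_class_closed[OF assms(4)]
  show "bracket (gr G) (gr_class G c x) (gr_class G d y) \<in> carrier (gr G)"
    "gr_class G (c + d) (commutator G x y) \<in> carrier (gr G)"
    using assms cls by (simp_all add: lie_bracket_closed gr_class_closed commutator_lower_central)
  fix k :: nat assume k: "k \<ge> 1"
  interpret Qk: comm_group "Q k" using k by (rule lcq_comm_group)
  let ?b = "\<lambda>i. gr_bracket G i (k - i) (gr_class G c x i) (gr_class G d y (k - i))"
  \<comment> \<open>Only the summand in bidegree \<open>(c, d)\<close> can survive.\<close>
  have zero: "?b i = \<one>\<^bsub>Q k\<^esub>" if "i \<in> {1..<k}" "\<not> (i = c \<and> k = c + d)" for i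
  proof (cases "i = c")
    case True
    then have "k - i \<noteq> d" "k - i \<ge> 1" using that by auto
    then have "gr_class G d y (k - i) = \<one>\<^bsub>Q (k - i)\<^esub>" by (simp add: gr_class_apply)
    then show ?thesis using that(1) gr_bracket_one(1)[of i "k - i"] gr_apply_closed[OF cls(1), of i]
      by (simp add: Suc_leI)
  next
    case False
    then have "gr_class G c x i = \<one>\<^bsub>Q i\<^esub>" using that by (auto simp: gr_class_apply)
    then show ?thesis using that(1) gr_bracket_one(2)[of i "k - i"] gr_apply_closed[OF cls(2), of "k - i"]
      by (simp add: Suc_leI)
  qed
  show "bracket (gr G) (gr_class G c x) (gr_class G d y) k = gr_class G (c + d) (commutator G x y) k"
  proof (cases "k = c + d")
    case True
    have "finprod (Q k) ?b {1..<k} = finprod (Q k) (\<lambda>i. if c = i then ?b i else \<one>\<^bsub>Q k\<^esub>) {1..<k}"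
      using gr_bracket_term_closed[OF cls, of k] zero by (intro Qk.finprod_cong') auto
    also have "\<dots> = ?b c"
      using True assms(1,2) gr_bracket_term_closed[OF cls, of k] by (intro Qk.finprod_singleton) auto
    also have "\<dots> = cl k (commutator G x y)"
      using True assms by (simp add: gr_class_apply gr_bracket_cl)
    finally show ?thesis using k True by (simp add: gr_bracket_apply gr_class_apply)
  next
    case False
    then have "finprod (Q k) ?b {1..<k} = \<one>\<^bsub>Q k\<^esub>"
      by (intro Qk.finprod_one_eqI zero) auto
    then show ?thesis using k False by (simp add: gr_bracket_apply gr_class_apply)
  qed
qed

text \<open>An element of the direct sum is the product of its finitely many homogeneous components,
  which are split off one at a time.\<close>

lemma gr_subgroup_memI:
  assumes J: "subgroup J (gr G)" and u: "u \<in> carrier (gr G)"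
    and comp: "\<And>c. c \<ge> 1 \<Longrightarrow> \<exists>x\<in>\<gamma> c. u c = cl c x \<and> gr_class G c x \<in> J"
  shows "u \<in> J"
proof -
  interpret L: comm_group "gr G" by (rule gr_comm_group)
  have "finite {c. 1 \<le> c \<and> u c \<noteq> \<one>\<^bsub>Q c\<^esub>}" using u by (simp add: gr_carrier_iff)
  then show ?thesis
    using u comp
  proof (induction "{c. 1 \<le> c \<and> u c \<noteq> \<one>\<^bsub>Q c\<^esub>}" arbitrary: u rule: finite_induct)
    case empty
    then have "u = \<one>\<^bsub>gr G\<^esub>" by (intro gr_eqI) (auto simp: gr_one_apply lcq_one)
    then show ?case using subgroup.one_closed[OF J] by simp
  next
    case (insert d D)
    then have d: "d \<ge> 1" by blast
    then obtain x where x: "x \<in> \<gamma> d" "u d = cl d x" "gr_class G d x \<in> J" using insert.prems by blast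
    interpret Qd: comm_group "Q d" using d by (rule lcq_comm_group)
    \<comment> \<open>\<open>w\<close> is \<open>u\<close> with its component of degree
      \<open>d\<close> removed.\<close>
    define w where "w = gr_class G d (inv x) \<otimes>\<^bsub>gr G\<^esub> u"
    have inv_closed: "gr_class G d (inv x) \<in> carrier (gr G)" using x by (simp add: gr_class_closed lower_central_inv)
    then have w: "w \<in> carrier (gr G)" using insert.prems by (simp add: w_def)
    have wc: "w c = (if c = d then \<one>\<^bsub>Q c\<^esub> else u c)" if "c \<ge> 1" for c
    proof -
      interpret Qc: comm_group "Q c" using that by (rule lcq_comm_group)
      show ?thesis
        using that x lower_central_carrier gr_apply_closed[OF insert.prems(1)]
        by (simp add: w_def gr_mult_apply gr_class_apply lcq_mult lcq_one coset_join2 lower_central_subgroup lower_central_one)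
          (simp flip: lcq_one)
    qed
    have D: "D = {c. 1 \<le> c \<and> w c \<noteq> \<one>\<^bsub>Q c\<^esub>}"
    proof (rule Set.set_eqI)
      fix c
      have "c \<in> D \<longleftrightarrow> c \<noteq> d \<and> 1 \<le> c \<and> u c \<noteq> \<one>\<^bsub>Q c\<^esub>" using insert.hyps(2,4) by blast
      moreover have "1 \<le> c \<and> w c \<noteq> \<one>\<^bsub>Q c\<^esub> \<longleftrightarrow> c \<noteq> d \<and> 1 \<le> c \<and> u c \<noteq> \<one>\<^bsub>Q c\<^esub>"
        using wc[of c] by (metis (full_types))
      ultimately show "c \<in> D \<longleftrightarrow> c \<in> {c. 1 \<le> c \<and> w c \<noteq> \<one>\<^bsub>Q c\<^esub>}" by simp
    qed
    have "\<exists>y\<in>\<gamma> c. w c = cl c y \<and> gr_class G c y \<in> J" if "c \<ge> 1" for c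
    proof (cases "c = d")
      case True
      have "gr_class G d \<one> = \<one>\<^bsub>gr G\<^esub>" using gr_class_eq_one_iff[OF d lower_central_one] lower_central_one by simp
      then show ?thesis
        using wc[OF d] True subgroup.one_closed[OF J] lower_central_one
        by (intro bexI[of _ \<one>]) (simp_all add: lcq_one coset_join2 lower_central_subgroup)
    next
      case False
      then show ?thesis using wc[OF that] insert.prems(2)[OF that] by simp
    qed
    then have "w \<in> J" using insert.hyps(3)[OF D w] by blast
    moreover have "u = gr_class G d x \<otimes>\<^bsub>gr G\<^esub> w"
      using inv_closed insert.prems(1) gr_class_closed[OF x(1)] x(1) d
      by (simp add: w_def gr_class_inv flip: L.m_assoc)
    ultimately show ?case using subgroup.m_closed[OF J x(3)] by simp
  qed
qed

lemma gr_one_class: "c \<ge> 1 \<Longrightarrow> gr_class G c \<one> = \<one>\<^bsub>gr G\<^esub>"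
  using gr_class_eq_one_iff[of c \<one>] lower_central_one by simp

primrec tree_val :: "('g \<Rightarrow> 'a) \<Rightarrow> 'g lie_tree \<Rightarrow> 'a" where
  "tree_val f (Leaf g) = f g"
| "tree_val f (Br a b) = commutator G (tree_val f a) (tree_val f b)"

lemma deg_pos: "deg \<tau> \<ge> 1"
  by (induction \<tau>) auto

lemma tree_val_lower_central:
  assumes "\<And>g. f g \<in> carrier G"
  shows "tree_val f \<tau> \<in> \<gamma> (deg \<tau>)"
  using assms by (induction \<tau>) (auto intro: commutator_lower_central deg_pos)

lemma lie_bracket_one:
  assumes "u \<in> carrier (gr G)"
  shows "bracket (gr G) u \<one>\<^bsub>gr G\<^esub> = \<one>\<^bsub>gr G\<^esub>" "bracket (gr G) \<one>\<^bsub>gr G\<^esub> u = \<one>\<^bsub>gr G\<^esub>"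
proof -
  interpret L: comm_group "gr G" by (rule gr_comm_group)
  have "bracket (gr G) u \<one>\<^bsub>gr G\<^esub> k = \<one>\<^bsub>gr G\<^esub> k \<and> bracket (gr G) \<one>\<^bsub>gr G\<^esub> u k = \<one>\<^bsub>gr G\<^esub> k" if k: "k \<ge> 1" for k
  proof -
    interpret Qk: comm_group "Q k" using k by (rule lcq_comm_group)
    have "gr_bracket G i (k - i) (u i) (\<one>\<^bsub>gr G\<^esub> (k - i)) = \<one>\<^bsub>Q k\<^esub>"
      "gr_bracket G i (k - i) (\<one>\<^bsub>gr G\<^esub> i) (u (k - i)) = \<one>\<^bsub>Q k\<^esub>" if "i \<in> {1..<k}" for i
    proof -
      have i: "i \<ge> 1" "k - i \<ge> 1" "i + (k - i) = k" using that by auto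
      show "gr_bracket G i (k - i) (u i) (\<one>\<^bsub>gr G\<^esub> (k - i)) = \<one>\<^bsub>Q k\<^esub>"
        using gr_bracket_one(1)[OF i(1,2) gr_apply_closed[OF assms i(1)]] i by (simp add: gr_one_apply lcq_one)
      show "gr_bracket G i (k - i) (\<one>\<^bsub>gr G\<^esub> i) (u (k - i)) = \<one>\<^bsub>Q k\<^esub>"
        using gr_bracket_one(2)[OF i(1,2) gr_apply_closed[OF assms i(2)]] i by (simp add: gr_one_apply lcq_one)
    qed
    then have "finprod (Q k) (\<lambda>i. gr_bracket G i (k - i) (u i) (\<one>\<^bsub>gr G\<^esub> (k - i))) {1..<k} = \<one>\<^bsub>Q k\<^esub>"
      "finprod (Q k) (\<lambda>i. gr_bracket G i (k - i) (\<one>\<^bsub>gr G\<^esub> i) (u (k - i))) {1..<k} = \<one>\<^bsub>Q k\<^esub>"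
      by (auto intro!: Qk.finprod_one_eqI)
    then show ?thesis using k by (simp add: gr_bracket_apply gr_one_apply lcq_one)
  qed
  then show "bracket (gr G) u \<one>\<^bsub>gr G\<^esub> = \<one>\<^bsub>gr G\<^esub>" "bracket (gr G) \<one>\<^bsub>gr G\<^esub> u = \<one>\<^bsub>gr G\<^esub>"
    using assms by (auto intro!: gr_eqI lie_bracket_closed)
qed

text \<open>
  The Lie ring laws hold in \<open>gr G\<close> on homogeneous elements, so the map from formal Lie polynomials
  to \<open>gr G\<close> sends all their formal consequences into any ideal containing the relators.
\<close>

lemma lie_eval_exists:
  assumes f: "\<And>g. f g \<in> carrier G"
  obtains E where "\<And>P. E P \<in> carrier (gr G)" "E 0 = \<one>\<^bsub>gr G\<^esub>"
    "\<And>P Q. E (P + Q) = E P \<otimes>\<^bsub>gr G\<^esub> E Q" "\<And>P. E (- P) = inv\<^bsub>gr G\<^esub> E P"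
    "\<And>\<tau>. E (frag_of \<tau>) = gr_class G (deg \<tau>) (tree_val f \<tau>)"
proof -
  interpret L: comm_group "gr G" by (rule gr_comm_group)
  have "(\<lambda>\<tau>. gr_class G (deg \<tau>) (tree_val f \<tau>)) ` UNIV \<subseteq> carrier (gr G)"
    using tree_val_lower_central[of f, OF f] gr_class_closed by blast
  then obtain E where E: "E \<in> hom (free_Abelian_group UNIV) (gr G)"
    "\<And>\<tau>. E (frag_of \<tau>) = gr_class G (deg \<tau>) (tree_val f \<tau>)"
    using L.free_Abelian_group_universal[of "\<lambda>\<tau>. gr_class G (deg \<tau>) (tree_val f \<tau>)" UNIV] by auto
  have closed: "E P \<in> carrier (gr G)" and add: "E (P + P') = E P \<otimes>\<^bsub>gr G\<^esub> E P'" for P P'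
    using hom_in_carrier[OF E(1), of P] hom_mult[OF E(1), of P P'] by (simp_all add: free_Abelian_group_def)
  have zero: "E 0 = \<one>\<^bsub>gr G\<^esub>"
    using add[of 0 0] closed[of 0] L.l_cancel_one by simp
  have "E (- P) = inv\<^bsub>gr G\<^esub> E P" for P
    using add[of "- P" P] closed zero by (simp add: L.inv_equality)
  then show ?thesis using that[of E] closed zero add E(2) by blast
qed

end

locale lie_evaluation = group +
  fixes f :: "'g \<Rightarrow> 'a" and E :: "('g lie_tree \<Rightarrow>\<^sub>0 int) \<Rightarrow> (nat \<Rightarrow> 'a set)"
  assumes f: "f g \<in> carrier G"
    and E_closed: "E P \<in> carrier (gr G)" and E_zero: "E 0 = \<one>\<^bsub>gr G\<^esub>"
    and E_add: "E (P + P') = E P \<otimes>\<^bsub>gr G\<^esub> E P'" and E_uminus: "E (- P) = inv\<^bsub>gr G\<^esub> E P"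
    and E_of: "E (frag_of \<tau>) = gr_class G (deg \<tau>) (tree_val f \<tau>)"
begin

lemmas val = tree_val_lower_central[of f, OF f]

lemma E_diff: "E (P - P') = E P \<otimes>\<^bsub>gr G\<^esub> inv\<^bsub>gr G\<^esub> E P'"
  using E_add[of P "- P'"] E_uminus by simp

lemma E_lbr: "E (lbr P P') = bracket (gr G) (E P) (E P')"
proof (induction P rule: frag_ind)
  interpret L: comm_group "gr G" by (rule gr_comm_group)
  case zero
  show ?case using lie_bracket_one(2)[OF E_closed] by (simp add: E_zero)
next
  interpret L: comm_group "gr G" by (rule gr_comm_group)
  case (one a)
  show ?case
  proof (induction P' rule: frag_ind)
    case zero
    show ?case using lie_bracket_one(1)[OF E_closed] by (simp add: E_zero)
  next
    case (one b)
    show ?case using lie_bracket_gr_class[OF deg_pos deg_pos val val, of a b] by (simp add: E_of)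
  next
    case (diff P' P'')
    have "E P' = E (P' - P'') \<otimes>\<^bsub>gr G\<^esub> E P''" using E_add[of "P' - P''" P''] by simp
    then have "bracket (gr G) (E (frag_of a)) (E (P' - P'')) \<otimes>\<^bsub>gr G\<^esub> E (lbr (frag_of a) P'') = E (lbr (frag_of a) P')"
      using lie_bracket_mult_right[OF E_closed[of "frag_of a"] E_closed[of "P' - P''"] E_closed[of P'']] diff by simp
    then have "bracket (gr G) (E (frag_of a)) (E (P' - P'')) = E (lbr (frag_of a) P') \<otimes>\<^bsub>gr G\<^esub> inv\<^bsub>gr G\<^esub> E (lbr (frag_of a) P'')"
      using E_closed lie_bracket_closed by (simp add: L.inv_solve_right del: lbr_simps)
    then show ?case by (simp only: lbr_diff_right E_diff[of "lbr (frag_of a) P'"])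
  qed
next
  interpret L: comm_group "gr G" by (rule gr_comm_group)
  case (diff P P'')
  have "E P = E (P - P'') \<otimes>\<^bsub>gr G\<^esub> E P''" using E_add[of "P - P''" P''] by simp
  then have "bracket (gr G) (E (P - P'')) (E P') \<otimes>\<^bsub>gr G\<^esub> E (lbr P'' P') = E (lbr P P')"
    using lie_bracket_mult_left[OF E_closed[of "P - P''"] E_closed[of P''] E_closed[of P']] diff by simp
  then have "bracket (gr G) (E (P - P'')) (E P') = E (lbr P P') \<otimes>\<^bsub>gr G\<^esub> inv\<^bsub>gr G\<^esub> E (lbr P'' P')"
    using E_closed lie_bracket_closed by (simp add: L.inv_solve_right del: lbr_simps)
  then show ?case by (simp only: lbr_simps(2) E_diff[of "lbr P P'"])
qed

lemma lie_span_eval: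
  assumes J: "lie_ideal J (gr G)" and R: "\<And>\<rho>. \<rho> \<in> R \<Longrightarrow> gr_class G (deg \<rho>) (tree_val f \<rho>) \<in> J"
    and P: "P \<in> lie_span R"
  shows "E P \<in> J"
proof -
  interpret L: comm_group "gr G" by (rule gr_comm_group)
  have JS: "subgroup J (gr G)" and Jb: "\<And>x y. x \<in> J \<Longrightarrow> y \<in> carrier (gr G) \<Longrightarrow> bracket (gr G) x y \<in> J"
    using J by (auto simp: lie_ideal_def)
  interpret J: subgroup J "gr G" by (rule JS)
  show ?thesis
    using P
  proof (induction rule: lie_span.induct)
    case zero
    then show ?case by (simp add: E_zero)
  next
    case (diff P Q)
    then show ?case by (simp add: E_diff)
  next
    case (alt a)
    have "E (frag_of (Br a a)) = \<one>\<^bsub>gr G\<^esub>"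
      using val[of a] lower_central_carrier deg_pos[of a] by (simp add: E_of commutator_self gr_one_class)
    then show ?case by simp
  next
    case (anti a b)
    have c: "tree_val f a \<in> carrier G" "tree_val f b \<in> carrier G" using val lower_central_carrier by blast+
    have "E (frag_of (Br a b) + frag_of (Br b a)) = gr_class G (deg a + deg b)
        (commutator G (tree_val f a) (tree_val f b) \<otimes> inv (commutator G (tree_val f a) (tree_val f b)))"
      using commutator_lower_central[OF deg_pos deg_pos val[of a] val[of b]]
        commutator_lower_central[OF deg_pos deg_pos val[of b] val[of a]] c
      by (simp add: E_add E_of gr_class_mult inv_commutator add.commute)
    also have "\<dots> = \<one>\<^bsub>gr G\<^esub>" using c deg_pos[of a] by (simp add: gr_one_class)
    finally show ?case by simp
  next
    case (jacobi a b c)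
    let ?x = "tree_val f a" and ?y = "tree_val f b" and ?z = "tree_val f c"
    note vals = val[of "Br (Br a b) c"] val[of "Br (Br b c) a"] val[of "Br (Br c a) b"]
    have deg: "deg (Br (Br b c) a) = deg (Br (Br a b) c)" "deg (Br (Br c a) b) = deg (Br (Br a b) c)" by simp_all
    have "E (frag_of (Br (Br a b) c) + frag_of (Br (Br b c) a) + frag_of (Br (Br c a) b))
      = gr_class G (deg (Br (Br a b) c)) (tree_val f (Br (Br a b) c) \<otimes> tree_val f (Br (Br b c) a) \<otimes> tree_val f (Br (Br c a) b))"
      unfolding E_add E_of deg using vals unfolding deg by (simp add: gr_class_mult lower_central_mult del: deg.simps tree_val.simps)
    also have "\<dots> = \<one>\<^bsub>gr G\<^esub>"
      using cl_jacobi[OF deg_pos deg_pos deg_pos val[of a] val[of b] val[of c]] vals deg_pos[of a]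
      by (subst gr_class_eq_one_iff[OF deg_pos]) (auto simp: deg_pos add_ac intro!: lower_central_mult simp del: One_nat_def)
    finally show ?case by simp
  next
    case (rel \<rho>)
    then show ?case using R E_of by simp
  next
    case (adr P a)
    then show ?case using Jb[OF adr.IH E_closed[of "frag_of a"]] by (simp add: lbr_frag_of flip: E_lbr)
  qed
qed

end

section \<open>Induced homomorphisms\<close>

lemma lie_ideal_gen_lie_ideal:
  assumes "group L" "S \<subseteq> carrier L" "\<And>x y. x \<in> carrier L \<Longrightarrow> y \<in> carrier L \<Longrightarrow> bracket L x y \<in> carrier L"
  shows "lie_ideal (gen_lie_ideal L S) L" "S \<subseteq> gen_lie_ideal L S"
proof -
  have "lie_ideal (carrier L) L"
    using assms by (simp add: lie_ideal_def group.subgroup_self)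
  then have ne: "{I. lie_ideal I L \<and> S \<subseteq> I} \<noteq> {}" using assms(2) by blast
  have "subgroup (\<Inter> {I. lie_ideal I L \<and> S \<subseteq> I}) L"
    by (rule group.subgroups_Inter[OF assms(1) _ ne]) (simp add: lie_ideal_def)
  then show "lie_ideal (gen_lie_ideal L S) L"
    unfolding gen_lie_ideal_def by (auto simp: lie_ideal_def)
  show "S \<subseteq> gen_lie_ideal L S" by (auto simp: gen_lie_ideal_def)
qed

lemma UN_UN_constant:
  "(\<And>x y. x \<in> A \<Longrightarrow> y \<in> B \<Longrightarrow> f x y = c) \<Longrightarrow> a \<in> A \<Longrightarrow> b \<in> B \<Longrightarrow> (\<Union>x\<in>A. \<Union>y\<in>B. f x y) = c"
  by blast

lemma lie_hom_factor:
  assumes L: "comm_group L" and K: "group K" and \<pi>: "\<pi> \<in> lie_hom L K" and surj: "\<pi> ` carrier L = carrier K"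
    and J: "subgroup J L" and ker: "\<And>u. u \<in> carrier L \<Longrightarrow> \<pi> u = \<one>\<^bsub>K\<^esub> \<longleftrightarrow> u \<in> J"
    and closed: "\<And>x y. x \<in> carrier L \<Longrightarrow> y \<in> carrier L \<Longrightarrow> bracket L x y \<in> carrier L"
  shows "\<exists>\<psi> \<in> lie_iso (lie_quotient L J) K. \<forall>u \<in> carrier L. \<psi> (J #>\<^bsub>L\<^esub> u) = \<pi> u"
proof -
  interpret L: comm_group L by (rule L)
  interpret K: group K by (rule K)
  interpret \<pi>: group_hom L K \<pi>
    using \<pi> by unfold_locales (simp add: lie_hom_def)
  interpret J: normal J L by (rule L.subgroup_imp_normal[OF J])
  have coset: "J #>\<^bsub>L\<^esub> u = J #>\<^bsub>L\<^esub> v \<longleftrightarrow> \<pi> u = \<pi> v" if "u \<in> carrier L" "v \<in> carrier L" for u v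
    using that ker[of "u \<otimes>\<^bsub>L\<^esub> inv\<^bsub>L\<^esub> v"] L.rcos_eq_iff[OF J that] K.inv_solve_right'[of "\<one>\<^bsub>K\<^esub>" "\<pi> u" "\<pi> v"]
    by (auto simp: K.inv_equality)
  obtain \<psi> where hom: "\<psi> \<in> hom (L Mod J) K" and \<psi>: "\<And>u. u \<in> carrier L \<Longrightarrow> \<psi> (J #>\<^bsub>L\<^esub> u) = \<pi> u"
    using FactGroup_universal[OF \<pi>.homh J.normal_axioms] coset by metis
  have bracket: "bracket (lie_quotient L J) (J #>\<^bsub>L\<^esub> u) (J #>\<^bsub>L\<^esub> v) = J #>\<^bsub>L\<^esub> bracket L u v"
    if uv: "u \<in> carrier L" "v \<in> carrier L" for u v
  proof -
    have "J #>\<^bsub>L\<^esub> bracket L x y = J #>\<^bsub>L\<^esub> bracket L u v" if "x \<in> J #>\<^bsub>L\<^esub> u" "y \<in> J #>\<^bsub>L\<^esub> v" for x y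
    proof -
      have c: "x \<in> carrier L" "y \<in> carrier L"
        using that uv J.elemrcos_carrier[OF L.is_group] by blast+
      have "\<pi> x = \<pi> u" "\<pi> y = \<pi> v"
        using coset[of u x] coset[of v y] L.repr_independence[OF that(1) uv(1) J] L.repr_independence[OF that(2) uv(2) J] uv c
        by simp_all
      then have "\<pi> (bracket L x y) = \<pi> (bracket L u v)"
        using \<pi> c uv by (simp add: lie_hom_def)
      then show ?thesis using coset closed c uv by simp
    qed
    moreover have "u \<in> J #>\<^bsub>L\<^esub> u" "v \<in> J #>\<^bsub>L\<^esub> v" using uv J L.rcos_self by auto
    ultimately have "(\<Union>x\<in>J #>\<^bsub>L\<^esub> u. \<Union>y\<in>J #>\<^bsub>L\<^esub> v. J #>\<^bsub>L\<^esub> bracket L x y) = J #>\<^bsub>L\<^esub> bracket L u v"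
      by (intro UN_UN_constant)
    then show ?thesis by (simp add: lie_quotient_def)
  qed
  have carrier: "carrier (lie_quotient L J) = (\<lambda>u. J #>\<^bsub>L\<^esub> u) ` carrier L"
    by (simp add: lie_quotient_def carrier_FactGroup)
  have "\<psi> \<in> hom (lie_quotient L J) K"
    using hom by (simp add: hom_def lie_quotient_def)
  moreover have "\<psi> (bracket (lie_quotient L J) X Y) = bracket K (\<psi> X) (\<psi> Y)"
    if "X \<in> carrier (lie_quotient L J)" "Y \<in> carrier (lie_quotient L J)" for X Y
    using that \<pi> closed by (auto simp: carrier bracket \<psi> lie_hom_def)
  moreover have "bij_betw \<psi> (carrier (lie_quotient L J)) (carrier K)"
  proof (rule bij_betw_imageI)
    show "inj_on \<psi> (carrier (lie_quotient L J))"
      unfolding carrier by (rule inj_onI, elim imageE) (simp add: \<psi> coset)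
    show "\<psi> ` carrier (lie_quotient L J) = carrier K"
      unfolding carrier image_image surj[symmetric] by (rule image_cong) (simp_all add: \<psi>)
  qed
  ultimately have "\<psi> \<in> lie_iso (lie_quotient L J) K" by (simp add: lie_iso_def lie_hom_def)
  then show ?thesis using \<psi> by blast
qed

context group_hom
begin

lemma hom_commutator: "x \<in> carrier G \<Longrightarrow> y \<in> carrier G \<Longrightarrow> h (commutator G x y) = commutator H (h x) (h y)"
  by (simp add: commutator_def)

lemma hom_lower_central: "x \<in> lower_central G c \<Longrightarrow> h x \<in> lower_central H c"
proof (induction c arbitrary: x)
  case 0
  then show ?case by simp
next
  case (Suc c)
  show ?case
  proof (cases "c = 0")
    case True
    then show ?thesis using Suc.prems by simp
  next
    case False
    then have c: "c \<ge> 1" by simp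
    let ?S = "{commutator G x y |x y. x \<in> lower_central G c \<and> y \<in> carrier G}"
    have S: "?S \<subseteq> carrier G" using G.lower_central_carrier by auto
    have "x \<in> generate G ?S" using Suc.prems G.lower_central_Suc[OF c] by simp
    then show ?thesis
    proof (induction x rule: generate.induct)
      case one
      then show ?case using H.lower_central_one by simp
    next
      case (incl x)
      then obtain u v where "x = commutator G u v" "u \<in> lower_central G c" "v \<in> carrier G" by blast
      then show ?case
        using Suc.IH H.commutator_lower_central_Suc[OF c] G.lower_central_carrier by (simp add: hom_commutator)
    next
      case (inv x)
      then obtain u v where uv: "x = commutator G u v" "u \<in> lower_central G c" "v \<in> carrier G" by blast
      then have "h x \<in> lower_central H (Suc c)"
        using Suc.IH H.commutator_lower_central_Suc[OF c] G.lower_central_carrier by (simp add: hom_commutator)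
      then show ?case using uv G.lower_central_carrier H.lower_central_inv by simp
    next
      case (eng a b)
      then show ?case using G.generate_in_carrier[OF S] H.lower_central_mult by simp
    qed
  qed
qed

lemma hom_lower_central_surj:
  assumes surj: "h ` carrier G = carrier H"
  shows "lower_central H c \<subseteq> h ` lower_central G c"
proof (induction c)
  case 0
  then show ?case using surj by simp
next
  case (Suc c)
  show ?case
  proof (cases "c = 0")
    case True
    then show ?thesis using surj by simp
  next
    case False
    then have c: "c \<ge> 1" by simp
    have "{commutator H x y |x y. x \<in> lower_central H c \<and> y \<in> carrier H} \<subseteq> h ` lower_central G (Suc c)"
    proof clarify
      fix x y assume "x \<in> lower_central H c" "y \<in> carrier H"
      then obtain u v where "x = h u" "u \<in> lower_central G c" "y = h v" "v \<in> carrier G"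
        using Suc surj by blast
      then show "commutator H x y \<in> h ` lower_central G (Suc c)"
        using G.commutator_lower_central_Suc[OF c] G.lower_central_carrier
        by (auto simp flip: hom_commutator)
    qed
    then show ?thesis
      unfolding H.lower_central_Suc[OF c]
      by (rule H.generate_subgroup_incl) (rule subgroup_img_is_subgroup[OF G.lower_central_subgroup])
  qed
qed

definition lcq_map :: "nat \<Rightarrow> 'a set \<Rightarrow> 'c set" where
  "lcq_map c X = (\<Union>x\<in>X. lower_central H (Suc c) #>\<^bsub>H\<^esub> h x)"

text \<open>A homomorphism respects the lower central series, so the union in \<open>lcq_map\<close>
  is over equal cosets.\<close>

lemma lcq_map_cl:
  assumes "x \<in> carrier G"
  shows "lcq_map c (lower_central G (Suc c) #> x) = lower_central H (Suc c) #>\<^bsub>H\<^esub> h x"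
proof -
  have "lower_central H (Suc c) #>\<^bsub>H\<^esub> h y = lower_central H (Suc c) #>\<^bsub>H\<^esub> h x"
    if y: "y \<in> lower_central G (Suc c) #> x" for y
  proof -
    obtain k where k: "k \<in> lower_central G (Suc c)" "y = k \<otimes> x" using y by (auto simp: r_coset_def)
    then have "k \<in> carrier G" using G.lower_central_carrier by blast
    then have "h y \<otimes>\<^bsub>H\<^esub> inv\<^bsub>H\<^esub> h x = h k" using k(2) assms by (simp add: H.m_assoc)
    then show ?thesis
      using H.cl_eq_iff[of "h y" "h x" "Suc c"] hom_lower_central[OF k(1)] k(2) \<open>k \<in> carrier G\<close> assms by simp
  qed
  moreover have "x \<in> lower_central G (Suc c) #> x"
    using assms G.rcos_self G.lower_central_subgroup by blast
  ultimately show ?thesis unfolding lcq_map_def by blast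
qed

lemma lcq_map_hom: "lcq_map c \<in> hom (lower_central_quotient G c) (lower_central_quotient H c)"
proof (rule homI)
  fix X assume "X \<in> carrier (lower_central_quotient G c)"
  then show "lcq_map c X \<in> carrier (lower_central_quotient H c)"
    using hom_lower_central G.lower_central_carrier by (auto simp: G.lcq_carrier H.lcq_carrier lcq_map_cl)
next
  fix X Y assume "X \<in> carrier (lower_central_quotient G c)" "Y \<in> carrier (lower_central_quotient G c)"
  then show "lcq_map c (X \<otimes>\<^bsub>lower_central_quotient G c\<^esub> Y) = lcq_map c X \<otimes>\<^bsub>lower_central_quotient H c\<^esub> lcq_map c Y"
    using G.lower_central_carrier by (auto simp: G.lcq_carrier lcq_map_cl G.lcq_mult H.lcq_mult)
qed

lemma gr_map_apply: "c \<ge> 1 \<Longrightarrow> gr_map G H h u c = lcq_map c (u c)"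
  by (simp add: gr_map_def lcq_map_def)

lemma gr_map_closed:
  assumes "u \<in> carrier (gr G)"
  shows "gr_map G H h u \<in> carrier (gr H)"
  unfolding H.gr_carrier_iff
proof (intro conjI allI impI)
  show "gr_map G H h u \<in> extensional {1..}" by (simp add: gr_map_def)
  show "gr_map G H h u c \<in> carrier (lower_central_quotient H c)" if "1 \<le> c" for c
    using that G.gr_apply_closed[OF assms that] hom_in_carrier[OF lcq_map_hom] by (simp add: gr_map_apply)
  have "gr_map G H h u c = \<one>\<^bsub>lower_central_quotient H c\<^esub>" if "1 \<le> c" "u c = \<one>\<^bsub>lower_central_quotient G c\<^esub>" for c
    using that Group.hom_one[OF lcq_map_hom G.lcq_group H.lcq_group] by (simp add: gr_map_apply)
  then have "{c. 1 \<le> c \<and> gr_map G H h u c \<noteq> \<one>\<^bsub>lower_central_quotient H c\<^esub>}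
      \<subseteq> {c. 1 \<le> c \<and> u c \<noteq> \<one>\<^bsub>lower_central_quotient G c\<^esub>}" by blast
  then show "finite {c. 1 \<le> c \<and> gr_map G H h u c \<noteq> \<one>\<^bsub>lower_central_quotient H c\<^esub>}"
    using assms finite_subset by (auto simp: G.gr_carrier_iff)
qed

lemma gr_map_gr_class:
  assumes "c \<ge> 1" "x \<in> lower_central G c"
  shows "gr_map G H h (gr_class G c x) = gr_class H c (h x)"
proof (rule H.gr_eqI)
  show "gr_map G H h (gr_class G c x) \<in> carrier (gr H)" "gr_class H c (h x) \<in> carrier (gr H)"
    using assms G.gr_class_closed H.gr_class_closed gr_map_closed hom_lower_central by blast+
  show "gr_map G H h (gr_class G c x) k = gr_class H c (h x) k" if "k \<ge> 1" for k
    using that assms G.lower_central_carrier Group.hom_one[OF lcq_map_hom G.lcq_group H.lcq_group]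
    by (simp add: gr_map_apply G.gr_class_apply H.gr_class_apply lcq_map_cl)
qed

lemma gr_map_lie_hom: "gr_map G H h \<in> lie_hom (gr G) (gr H)"
  unfolding lie_hom_def
proof (intro CollectI conjI ballI)
  interpret LG: comm_group "gr G" by (rule G.gr_comm_group)
  interpret LH: comm_group "gr H" by (rule H.gr_comm_group)
  show "gr_map G H h \<in> hom (gr G) (gr H)"
  proof (rule homI)
    fix u v assume uv: "u \<in> carrier (gr G)" "v \<in> carrier (gr G)"
    show "gr_map G H h (u \<otimes>\<^bsub>gr G\<^esub> v) = gr_map G H h u \<otimes>\<^bsub>gr H\<^esub> gr_map G H h v"
    proof (rule H.gr_eqI)
      fix c :: nat assume "c \<ge> 1"
      then show "gr_map G H h (u \<otimes>\<^bsub>gr G\<^esub> v) c = (gr_map G H h u \<otimes>\<^bsub>gr H\<^esub> gr_map G H h v) c"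
        using Group.hom_mult[OF lcq_map_hom] G.gr_apply_closed uv
        by (simp add: gr_map_apply G.gr_mult_apply H.gr_mult_apply)
    qed (use uv in \<open>simp_all add: gr_map_closed\<close>)
  qed (rule gr_map_closed)
  fix u v assume uv: "u \<in> carrier (gr G)" "v \<in> carrier (gr G)"
  show "gr_map G H h (bracket (gr G) u v) = bracket (gr H) (gr_map G H h u) (gr_map G H h v)"
  proof (rule H.gr_eqI)
    fix k :: nat assume k: "k \<ge> 1"
    have "lcq_map k (finprod (lower_central_quotient G k) (\<lambda>i. gr_bracket G i (k - i) (u i) (v (k - i))) {1..<k})
      = finprod (lower_central_quotient H k) (\<lambda>i. lcq_map k (gr_bracket G i (k - i) (u i) (v (k - i)))) {1..<k}"
      by (rule finprod_hom[OF G.lcq_comm_group[OF k] H.lcq_comm_group[OF k] lcq_map_hom G.gr_bracket_term_closed[OF uv]])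
    also have "\<dots> = finprod (lower_central_quotient H k)
        (\<lambda>i. gr_bracket H i (k - i) (gr_map G H h u i) (gr_map G H h v (k - i))) {1..<k}"
    proof (rule comm_monoid.finprod_cong'[OF comm_group.axioms(1)[OF H.lcq_comm_group[OF k]] refl])
      show "(\<lambda>i. gr_bracket H i (k - i) (gr_map G H h u i) (gr_map G H h v (k - i))) \<in> {1..<k} \<rightarrow> carrier (lower_central_quotient H k)"
        by (rule H.gr_bracket_term_closed) (simp_all add: uv gr_map_closed)
      fix i assume "i \<in> {1..<k}"
      then have i: "i \<ge> 1" "k - i \<ge> 1" "i + (k - i) = k" by auto
      obtain x y where xy: "x \<in> lower_central G i" "u i = lower_central G (Suc i) #> x"
          "y \<in> lower_central G (k - i)" "v (k - i) = lower_central G (Suc (k - i)) #> y"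
        using G.gr_apply_cl uv i by meson
      then show "lcq_map k (gr_bracket G i (k - i) (u i) (v (k - i))) =
          gr_bracket H i (k - i) (gr_map G H h u i) (gr_map G H h v (k - i))"
        using G.gr_bracket_cl[OF i(1,2) xy(1,3)] H.gr_bracket_cl[OF i(1,2) hom_lower_central[OF xy(1)] hom_lower_central[OF xy(3)]]
          i G.lower_central_carrier[OF xy(1)] G.lower_central_carrier[OF xy(3)]
        by (simp add: gr_map_apply lcq_map_cl hom_commutator)
    qed
    finally show "gr_map G H h (bracket (gr G) u v) k = bracket (gr H) (gr_map G H h u) (gr_map G H h v) k"
      using k by (simp add: gr_map_apply G.gr_bracket_apply H.gr_bracket_apply)
  qed (use uv in \<open>simp_all add: gr_map_closed G.lie_bracket_closed H.lie_bracket_closed\<close>)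
qed

lemma gr_map_surj:
  assumes surj: "h ` carrier G = carrier H"
  shows "gr_map G H h ` carrier (gr G) = carrier (gr H)"
proof
  interpret LG: comm_group "gr G" by (rule G.gr_comm_group)
  interpret LH: comm_group "gr H" by (rule H.gr_comm_group)
  interpret \<pi>: group_hom "gr G" "gr H" "gr_map G H h"
    using gr_map_lie_hom by unfold_locales (simp add: lie_hom_def)
  show "gr_map G H h ` carrier (gr G) \<subseteq> carrier (gr H)" using gr_map_closed by blast
  have "u \<in> gr_map G H h ` carrier (gr G)" if u: "u \<in> carrier (gr H)" for u
  proof (rule H.gr_subgroup_memI[OF \<pi>.subgroup_img_is_subgroup[OF LG.subgroup_self] u])
    fix c :: nat assume c: "c \<ge> 1"
    obtain y where y: "y \<in> lower_central H c" "u c = lower_central H (Suc c) #>\<^bsub>H\<^esub> y"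
      using H.gr_apply_cl[OF u c] by blast
    then obtain x where x: "x \<in> lower_central G c" "y = h x"
      using hom_lower_central_surj[OF surj, of c] by blast
    then have "gr_class H c y \<in> gr_map G H h ` carrier (gr G)"
      using gr_map_gr_class[OF c x(1)] G.gr_class_closed[OF x(1)] by (metis imageI)
    then show "\<exists>y\<in>lower_central H c. u c = lower_central H (Suc c) #>\<^bsub>H\<^esub> y \<and> gr_class H c y \<in> gr_map G H h ` carrier (gr G)"
      using y by blast
  qed
  then show "carrier (gr H) \<subseteq> gr_map G H h ` carrier (gr G)" by blast
qed

end

section \<open>Unipotent automorphisms of a filtered group\<close>

text \<open>The model is the functionals vanishing from degree \<open>k\<close> on.
  \<open>S 0 = {0}\<close> makes an operator that lowers the index nilpotent on every
  \<open>S k\<close>.\<close>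

locale filtered =
  fixes S :: "nat \<Rightarrow> 'v::ab_group_add set"
  assumes S_zero: "S 0 = {0}" and S_Suc: "S k \<subseteq> S (Suc k)"
    and S_diff: "x \<in> S k \<Longrightarrow> y \<in> S k \<Longrightarrow> x - y \<in> S k"
begin

lemma S_mono: "i \<le> j \<Longrightarrow> S i \<subseteq> S j"
  by (rule lift_Suc_mono_le[of S, OF S_Suc])

lemma S_monoD: "x \<in> S i \<Longrightarrow> i \<le> j \<Longrightarrow> x \<in> S j"
  using S_mono by blast

lemma S_0: "0 \<in> S k"
  using S_mono[of 0 k] S_zero by blast

lemma S_uminus: "x \<in> S k \<Longrightarrow> - x \<in> S k"
  using S_diff[OF S_0] by fastforce

lemma S_add: "x \<in> S k \<Longrightarrow> y \<in> S k \<Longrightarrow> x + y \<in> S k"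
  using S_diff[of x k "- y"] S_uminus by simp

definition V :: "'v set" where
  "V = (\<Union>k. S k)"

lemma S_V: "x \<in> S k \<Longrightarrow> x \<in> V"
  by (auto simp: V_def)

lemma V_S:
  assumes "x \<in> V" "y \<in> V"
  obtains k where "x \<in> S k" "y \<in> S k"
proof -
  obtain i j where "x \<in> S i" "y \<in> S j" using assms by (auto simp: V_def)
  then show ?thesis using that[of "max i j"] S_mono[of i "max i j"] S_mono[of j "max i j"] by auto
qed

lemma V_add: "x \<in> V \<Longrightarrow> y \<in> V \<Longrightarrow> x + y \<in> V"
  and V_diff: "x \<in> V \<Longrightarrow> y \<in> V \<Longrightarrow> x - y \<in> V"
  by (metis V_S S_add S_V, metis V_S S_diff S_V)

definition additive_V :: "('v \<Rightarrow> 'v) \<Rightarrow> bool" where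
  "additive_V A \<longleftrightarrow> (\<forall>x\<in>V. \<forall>y\<in>V. A (x + y) = A x + A y)"

text \<open>The truncated difference is intended: for \<open>k\<close> at most \<open>c\<close>,
  \<open>unip c g\<close> makes \<open>g\<close> the identity on \<open>S k\<close>, since
  \<open>S 0 = {0}\<close>.\<close>

definition unip :: "nat \<Rightarrow> ('v \<Rightarrow> 'v) \<Rightarrow> bool" where
  "unip c g \<longleftrightarrow> (\<forall>k. \<forall>x\<in>S k. g x - x \<in> S (k - c))"

lemma additive_V_diff:
  assumes "additive_V A" "x \<in> V" "y \<in> V"
  shows "A (x - y) = A x - A y"
proof -
  have "A (x - y + y) = A (x - y) + A y"
    using assms V_diff unfolding additive_V_def by blast
  then show ?thesis by (simp add: eq_diff_eq)
qed

lemma additive_V_zero: "additive_V A \<Longrightarrow> A 0 = 0"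
  using additive_V_diff[of A 0 0] S_V[OF S_0] by simp

lemma unipD: "unip c g \<Longrightarrow> x \<in> S k \<Longrightarrow> g x - x \<in> S (k - c)"
  by (simp add: unip_def)

lemma unip_S:
  assumes "unip c g" "x \<in> S k"
  shows "g x \<in> S k"
  using S_add[OF subsetD[OF S_mono unipD[OF assms]] assms(2)] by simp

lemma unip_V: "unip c g \<Longrightarrow> x \<in> V \<Longrightarrow> g x \<in> V"
  by (metis V_S S_V unip_S)

lemma unip_comp:
  assumes "unip c g" "unip c h"
  shows "unip c (g \<circ> h)"
  unfolding unip_def
proof (intro allI ballI)
  fix k x assume x: "x \<in> S k"
  have "g (h x) - h x + (h x - x) \<in> S (k - c)"
    by (intro S_add unipD[OF assms(1)] unipD[OF assms(2)] unip_S[OF assms(2)] x)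
  then show "(g \<circ> h) x - x \<in> S (k - c)" by simp
qed

text \<open>If \<open>g z = 0\<close>, then \<open>z\<close> is minus \<open>g z - z\<close>, which
  lies one step lower; so \<open>z\<close> descends to \<open>S 0\<close>.\<close>

lemma unip_inj:
  assumes "additive_V g" "unip 1 g" "x \<in> V" "y \<in> V" "g x = g y"
  shows "x = y"
proof -
  have "z = 0" if "z \<in> S k" "g z = 0" for z k
    using that
  proof (induction k)
    case (Suc k)
    then show ?case using unipD[OF assms(2) Suc.prems(1)] S_uminus by fastforce
  qed (simp add: S_zero)
  moreover have "g (x - y) = 0" using additive_V_diff[OF assms(1,3,4)] assms(5) by simp
  ultimately have "x - y = 0" using V_diff[OF assms(3,4)] unfolding V_def by blast
  then show ?thesis by simp
qed

text \<open>\<open>x\<close> solves the equation up to the error \<open>g x - x\<close>, which lies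
  one step lower and is corrected recursively.\<close>

lemma unip_surj:
  assumes "additive_V g" "unip 1 g"
  shows "x \<in> S k \<Longrightarrow> \<exists>y\<in>S k. g y = x"
proof (induction k arbitrary: x)
  case 0
  then show ?case using additive_V_zero[OF assms(1)] by (simp add: S_zero)
next
  case (Suc k)
  then have "g x - x \<in> S k" using unipD[OF assms(2)] by fastforce
  then obtain y where y: "y \<in> S k" "g y = g x - x" using Suc.IH by blast
  then have "y \<in> S (Suc k)" using S_Suc by blast
  then show ?case
    using y Suc.prems S_diff additive_V_diff[OF assms(1)] S_V by (intro bexI[of _ "x - y"]) auto
qed

text \<open>Elements are total functions; \<open>permutes\<close> fixes them off \<open>V\<close>,
  so that equality is decided on \<open>V\<close> and \<open>id\<close> is the identity.\<close>

definition UG :: "('v \<Rightarrow> 'v) monoid" where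
  "UG = \<lparr>carrier = {g. g permutes V \<and> additive_V g \<and> unip 1 g}, monoid.mult = (\<circ>), one = id\<rparr>"

lemma UG_simps: "carrier UG = {g. g permutes V \<and> additive_V g \<and> unip 1 g}" "x \<otimes>\<^bsub>UG\<^esub> y = x \<circ> y" "\<one>\<^bsub>UG\<^esub> = id"
  by (simp_all add: UG_def)

lemma inv_UG:
  assumes g: "g permutes V" "additive_V g" "unip 1 g"
  shows "inv_into UNIV g permutes V" "additive_V (inv_into UNIV g)" "unip 1 (inv_into UNIV g)"
proof -
  let ?h = "inv_into UNIV g"
  have gh: "g (?h x) = x" for x using permutes_inverses[OF g(1)] by simp
  show h: "?h permutes V" by (rule permutes_inv[OF g(1)])
  show "additive_V ?h"
    unfolding additive_V_def
  proof (intro ballI)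
    fix x y assume "x \<in> V" "y \<in> V"
    then have V: "?h x \<in> V" "?h y \<in> V" using permutes_in_image[OF h] by blast+
    then have "g (?h x + ?h y) = x + y" using g(2) gh unfolding additive_V_def by simp
    then show "?h (x + y) = ?h x + ?h y" using permutes_inverses[OF g(1)] by metis
  qed
  show "unip 1 ?h"
    unfolding unip_def
  proof (intro allI ballI)
    fix k x assume x: "x \<in> S k"
    obtain y where y: "y \<in> S k" "g y = x" using unip_surj[OF g(2,3) x] by blast
    then have "?h x = y" using permutes_inverses[OF g(1)] by auto
    then show "?h x - x \<in> S (k - 1)" using S_uminus[OF unipD[OF g(3) y(1)]] y(2) by simp
  qed
qed

lemma UG_group: "group UG"
proof (rule groupI)
  show "\<one>\<^bsub>UG\<^esub> \<in> carrier UG"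
    by (simp add: UG_simps permutes_id additive_V_def unip_def S_0)
  show "x \<otimes>\<^bsub>UG\<^esub> y \<in> carrier UG" if "x \<in> carrier UG" "y \<in> carrier UG" for x y
    using that permutes_compose[of y V x] unip_comp[of 1 x y] unip_V[of 1 y]
    by (simp add: UG_simps additive_V_def)
  show "\<exists>y\<in>carrier UG. y \<otimes>\<^bsub>UG\<^esub> x = \<one>\<^bsub>UG\<^esub>" if "x \<in> carrier UG" for x
    using that inv_UG[of x] permutes_inv_o[of x V] by (intro bexI[of _ "inv_into UNIV x"]) (simp_all add: UG_simps)
qed (simp_all add: UG_simps o_assoc)

sublocale UG: group UG
  by (rule UG_group)

lemma UG_eqI:
  assumes "g \<in> carrier UG" "h \<in> carrier UG" "\<And>x. x \<in> V \<Longrightarrow> g x = h x"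
  shows "g = h"
  using assms by (auto simp: UG_simps fun_eq_iff permutes_def) metis

definition lift :: "('v \<Rightarrow> 'v) \<Rightarrow> ('v \<Rightarrow> 'v)" where
  "lift g = (\<lambda>x. if x \<in> V then g x else x)"

lemma lift_UG:
  assumes "additive_V g" "unip 1 g"
  shows "lift g \<in> carrier UG"
proof -
  have "bij_betw g V V"
  proof (rule bij_betw_imageI)
    show "inj_on g V" using unip_inj[OF assms] by (blast intro: inj_onI)
    show "g ` V = V"
      using unip_V[OF assms(2)] unip_surj[OF assms] S_V by (auto simp: V_def) blast+
  qed
  then have "lift g permutes V" unfolding lift_def by (intro bij_imp_permutes) (auto cong: bij_betw_cong)
  moreover have "additive_V (lift g)" "unip 1 (lift g)"
    using assms V_add S_V by (simp_all add: additive_V_def unip_def lift_def)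
  ultimately show ?thesis by (simp add: UG_simps)
qed

lemma UG_unip: "g \<in> carrier UG \<Longrightarrow> unip 1 g"
  and UG_additive: "g \<in> carrier UG \<Longrightarrow> additive_V g"
  by (simp_all add: UG_simps)

lemma UG_inv_apply: "g \<in> carrier UG \<Longrightarrow> (inv\<^bsub>UG\<^esub> g) (g x) = x"
  using UG.l_inv[of g] by (simp add: UG_simps fun_eq_iff)

lemma UG_apply_inv: "g \<in> carrier UG \<Longrightarrow> g ((inv\<^bsub>UG\<^esub> g) x) = x"
  using UG.r_inv[of g] by (simp add: UG_simps fun_eq_iff)

text \<open>\<open>lead c g A\<close>: the operator \<open>A\<close> of degree \<open>c\<close> is the leading term of \<open>g - id\<close>.\<close>

definition lead :: "nat \<Rightarrow> ('v \<Rightarrow> 'v) \<Rightarrow> ('v \<Rightarrow> 'v) \<Rightarrow> bool" where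
  "lead c g A \<longleftrightarrow> additive_V A \<and> (\<forall>k. \<forall>x\<in>S k. A x \<in> S (k - c) \<and> g x - x - A x \<in> S (k - Suc c))"

lemma leadD:
  assumes "lead c g A" "x \<in> S k"
  shows "A x \<in> S (k - c)" "g x - x - A x \<in> S (k - Suc c)"
  using assms by (auto simp: lead_def)

lemma lead_additive: "lead c g A \<Longrightarrow> additive_V A"
  by (simp add: lead_def)

lemma lead_cong:
  assumes "lead c g A" "\<And>x. x \<in> V \<Longrightarrow> A x = B x"
  shows "lead c g B"
proof -
  have "B x = A x" if "x \<in> S k" for x k using assms(2)[OF S_V[OF that]] by simp
  then show ?thesis
    using assms V_add by (simp add: lead_def additive_V_def)
qed

lemma lead_unip:
  assumes "lead c g A"
  shows "unip c g"
  unfolding unip_def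
proof (intro allI ballI)
  fix k x assume x: "x \<in> S k"
  have "g x - x - A x \<in> S (k - c)"
    by (rule subsetD[OF S_mono leadD(2)[OF assms x]]) simp
  from S_add[OF this leadD(1)[OF assms x]] show "g x - x \<in> S (k - c)" by simp
qed

text \<open>Taken at \<open>k = Suc c\<close> this kills the leading term; that is how elements of
  the next term of the lower central series are recognized.\<close>

lemma lead_unip_Suc:
  assumes "lead c g A" "unip (Suc c) g" "x \<in> S k"
  shows "A x \<in> S (k - Suc c)"
  using S_diff[OF unipD[OF assms(2,3)] leadD(2)[OF assms(1,3)]] by simp

lemma lead_mult:
  assumes "c \<ge> 1" "lead c g A" "lead c h B"
  shows "lead c (g \<otimes>\<^bsub>UG\<^esub> h) (\<lambda>x. A x + B x)"
  unfolding lead_def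
proof (intro conjI allI ballI)
  show "additive_V (\<lambda>x. A x + B x)"
    using lead_additive[OF assms(2)] lead_additive[OF assms(3)] by (simp add: additive_V_def algebra_simps)
  fix k x assume x: "x \<in> S k"
  show "A x + B x \<in> S (k - c)" by (intro S_add leadD[OF assms(2)] leadD[OF assms(3)] x)
  \<comment> \<open>The error \<open>A (h x - x)\<close> drops by \<open>2 c\<close>, which is at
    least \<open>c + 1\<close> because \<open>c\<close> is positive.\<close>
  have hx: "h x \<in> S k" by (rule unip_S[OF lead_unip[OF assms(3)] x])
  have "A (h x - x) \<in> S (k - c - c)"
    by (rule leadD(1)[OF assms(2) unipD[OF lead_unip[OF assms(3)] x]])
  then have "A (h x - x) \<in> S (k - Suc c)" by (rule S_monoD) (use assms(1) in auto)
  moreover have "A (h x - x) = A (h x) - A x"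
    using additive_V_diff[OF lead_additive[OF assms(2)]] hx x S_V by blast
  ultimately have "(g (h x) - h x - A (h x)) + (h x - x - B x) + (A (h x) - A x) \<in> S (k - Suc c)"
    using leadD(2)[OF assms(2) hx] leadD(2)[OF assms(3) x] by (intro S_add) simp_all
  then show "(g \<otimes>\<^bsub>UG\<^esub> h) x - x - (A x + B x) \<in> S (k - Suc c)"
    by (simp add: UG_simps algebra_simps)
qed

lemma lead_inv:
  assumes "c \<ge> 1" "lead c g A" "g \<in> carrier UG"
  shows "lead c (inv\<^bsub>UG\<^esub> g) (\<lambda>x. - A x)"
  unfolding lead_def
proof (intro conjI allI ballI)
  show "additive_V (\<lambda>x. - A x)"
    using lead_additive[OF assms(2)] by (simp add: additive_V_def)
  fix k x assume x: "x \<in> S k"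
  show "- A x \<in> S (k - c)" by (intro S_uminus leadD[OF assms(2)] x)
  let ?y = "(inv\<^bsub>UG\<^esub> g) x"
  have y: "?y \<in> S k" by (rule unip_S[OF UG_unip[OF UG.inv_closed[OF assms(3)]] x])
  have gy: "g ?y = x" by (rule UG_apply_inv[OF assms(3)])
  have "x - ?y \<in> S (k - c)" using unipD[OF lead_unip[OF assms(2)] y] gy by simp
  then have "A (x - ?y) \<in> S (k - c - c)" by (rule leadD(1)[OF assms(2)])
  then have "A (x - ?y) \<in> S (k - Suc c)" by (rule S_monoD) (use assms(1) in auto)
  moreover have "A (x - ?y) = A x - A ?y"
    using additive_V_diff[OF lead_additive[OF assms(2)]] y x S_V by blast
  moreover have "x - ?y - A ?y \<in> S (k - Suc c)" using leadD(2)[OF assms(2) y] gy by simp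
  ultimately have "A x - A ?y - (x - ?y - A ?y) \<in> S (k - Suc c)" by (metis S_diff)
  then show "?y - x - - A x \<in> S (k - Suc c)" by (simp add: algebra_simps)
qed

text \<open>As operators, \<open>g h - h g = (g - 1)(h - 1) - (h - 1)(g - 1)\<close>, with leading
  part \<open>A B - B A\<close>, and \<open>[g, h] - 1\<close> is the inverse of \<open>h g\<close>
  applied to this difference, which does not affect the leading part.\<close>

lemma lead_commutator:
  assumes g: "g \<in> carrier UG" "lead i g A" and h: "h \<in> carrier UG" "lead j h B"
  shows "lead (i + j) (commutator UG g h) (\<lambda>x. A (B x) - B (A x))"
  unfolding lead_def
proof (intro conjI allI ballI)
  note A = lead_additive[OF g(2)] and B = lead_additive[OF h(2)]
  have AV: "A x \<in> V" "B x \<in> V" if "x \<in> V" for x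
    using that leadD(1)[OF g(2)] leadD(1)[OF h(2)] S_V by (metis V_S)+
  show "additive_V (\<lambda>x. A (B x) - B (A x))"
    using A B AV by (simp add: additive_V_def)
  fix k x assume x: "x \<in> S k"
  have AB: "A (B x) \<in> S (k - (i + j))"
    using leadD(1)[OF g(2) leadD(1)[OF h(2) x]] by (simp add: add.commute)
  have BA: "B (A x) \<in> S (k - (i + j))"
    using leadD(1)[OF h(2) leadD(1)[OF g(2) x]] by simp
  show "A (B x) - B (A x) \<in> S (k - (i + j))" by (rule S_diff[OF AB BA])
  let ?n = "h \<otimes>\<^bsub>UG\<^esub> g"
  define a where "a = g x - x"
  define b where "b = h x - x"
  define z where "z = (g b - b) - (h a - a)"
  have n: "?n \<in> carrier UG" using g h by simp
  have ab: "a \<in> S (k - i)" "b \<in> S (k - j)"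
    unfolding a_def b_def using unipD[OF lead_unip[OF g(2)] x] unipD[OF lead_unip[OF h(2)] x] by auto
  have step: "G b - b - A' (B' x) \<in> S (k - Suc (i' + j'))"
    if "lead i' G A'" "lead j' H B'" "b = H x - x" for i' j' G H A' B' b
  proof -
    have b: "b \<in> S (k - j')" using unipD[OF lead_unip[OF that(2)] x] that(3) by simp
    have "G b - b - A' b \<in> S (k - j' - Suc i')" by (rule leadD(2)[OF that(1) b])
    moreover have "b - B' x \<in> S (k - Suc j')" using leadD(2)[OF that(2) x] that(3) by simp
    then have "A' (b - B' x) \<in> S (k - Suc j' - i')" by (rule leadD(1)[OF that(1)])
    moreover have "A' (b - B' x) = A' b - A' (B' x)"
      using additive_V_diff[OF lead_additive[OF that(1)]] b leadD(1)[OF that(2) x] S_V by blast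
    ultimately have "(G b - b - A' b) + (A' b - A' (B' x)) \<in> S (k - Suc (i' + j'))"
      by (intro S_add) (simp_all add: add.commute)
    then show ?thesis by simp
  qed
  have "(g b - b - A (B x)) - (h a - a - B (A x)) \<in> S (k - Suc (i + j))"
    using S_diff[OF step[OF g(2) h(2) b_def], of "h a - a - B (A x)"] step[OF h(2) g(2) a_def]
    by (simp add: add.commute)
  then have zAB: "z - (A (B x) - B (A x)) \<in> S (k - Suc (i + j))"
    by (simp add: z_def algebra_simps)
  have "z - (A (B x) - B (A x)) + (A (B x) - B (A x)) \<in> S (k - (i + j))"
    by (rule S_add[OF S_monoD[OF zAB] S_diff[OF AB BA]]) simp
  then have z: "z \<in> S (k - (i + j))" by simp
  have xV: "x \<in> V" "a \<in> V" "b \<in> V" using x ab S_V by blast+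
  have "g (h x) = g x + g b" "h (g x) = h x + h a"
    using UG_additive[OF g(1)] UG_additive[OF h(1)] xV by (simp_all add: additive_V_def a_def b_def V_add flip: add_diff_eq) (metis add.commute diff_add_cancel)+
  then have ghz: "g (h x) = h (g x) + z"
    by (simp add: z_def a_def b_def)
  have "(commutator UG g h) x = (inv\<^bsub>UG\<^esub> ?n) (g (h x))"
    using g h by (simp add: commutator_def UG.inv_mult_group) (simp add: UG_simps)
  also have "\<dots> = (inv\<^bsub>UG\<^esub> ?n) (?n x) + (inv\<^bsub>UG\<^esub> ?n) z"
  proof -
    have "?n x \<in> V" using unip_V[OF UG_unip[OF n]] xV by blast
    then show ?thesis
      using UG_additive[OF UG.inv_closed[OF n]] S_V[OF z] by (simp add: additive_V_def ghz UG_simps)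
  qed
  also have "(inv\<^bsub>UG\<^esub> ?n) (?n x) = x" by (rule UG_inv_apply[OF n])
  finally have c: "(commutator UG g h) x - x = (inv\<^bsub>UG\<^esub> ?n) z" by simp
  have "(inv\<^bsub>UG\<^esub> ?n) z - z \<in> S (k - (i + j) - 1)"
    by (rule unipD[OF UG_unip[OF UG.inv_closed[OF n]] z])
  then have "((inv\<^bsub>UG\<^esub> ?n) z - z) + (z - (A (B x) - B (A x))) \<in> S (k - Suc (i + j))"
    using zAB by (intro S_add) simp_all
  then show "(commutator UG g h) x - x - (A (B x) - B (A x)) \<in> S (k - Suc (i + j))"
    by (simp add: c algebra_simps)
qed

text \<open>The leading term is multiplied by \<open>m\<close>. With values in the integers this
  loses nothing, which later excludes torsion.\<close>

lemma lead_pow: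
  assumes "c \<ge> 1" "lead c g A"
  shows "lead c (g [^]\<^bsub>UG\<^esub> (m::nat)) (\<lambda>x. \<Sum>i<m. A x)"
proof (induction m)
  case 0
  show ?case by (simp add: lead_def additive_V_def UG_simps S_0)
next
  case (Suc m)
  then show ?case using lead_mult[OF assms(1) Suc assms(2)] by (simp add: add.commute)
qed

end

section \<open>A unipotent representation of the Formanek--Procesi group\<close>

text \<open>\<open>LX i\<close> stands for a commutator of two generators, hence weight 2.\<close>

fun wt :: "tsym \<Rightarrow> nat" where
  "wt (LX i) = 2" | "wt _ = 1"

lemma wt_pos: "wt l \<ge> 1"
  by (cases l) auto

definition wtl :: "tsym list \<Rightarrow> nat" where
  "wtl w = sum_list (map wt w)"

lemma wtl_simps [simp]: "wtl [] = 0" "wtl (l # w) = wt l + wtl w" "wtl (u @ v) = wtl u + wtl v"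
  by (simp_all add: wtl_def)

definition High :: "nat \<Rightarrow> (tsym list \<Rightarrow>\<^sub>0 int) set" where
  "High k = {x. \<forall>w\<in>Poly_Mapping.keys x. k \<le> wtl w}"

lemma High_subgroup: "add_subgroup (High k)"
  using keys_diff by (fastforce simp: add_subgroup_def High_def)

lemmas High_add = add_subgroup_add[OF High_subgroup]
  and High_diff = add_subgroup_diff[OF High_subgroup]
  and High_zero = add_subgroup_zero[OF High_subgroup]

lemma High_frag_of: "frag_of w \<in> High k \<longleftrightarrow> k \<le> wtl w"
  by (simp add: High_def)

lemma High_mono: "x \<in> High k \<Longrightarrow> j \<le> k \<Longrightarrow> x \<in> High j"
  by (auto simp: High_def intro: le_trans)

lemma High_mult:
  assumes "x \<in> High j" "y \<in> High k" "n \<le> j + k"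
  shows "x * y \<in> High n"
proof -
  have "Poly_Mapping.keys x \<subseteq> {w. j \<le> wtl w}" "Poly_Mapping.keys y \<subseteq> {w. k \<le> wtl w}"
    using assms by (auto simp: High_def)
  then have "x * y \<in> High (j + k)"
  proof (induction x rule: frag_induction)
    case (one u)
    from one(2) show ?case
    proof (induction y rule: frag_induction)
      case (one v)
      then show ?case using \<open>u \<in> _\<close> by (simp add: High_frag_of flip: frag_of_append)
    qed (simp_all add: ring_distribs High_zero High_diff)
  qed (simp_all add: ring_distribs High_zero High_diff)
  then show ?thesis using High_mono assms(3) by blast
qed

text \<open>
  Conjugation by \<open>f\<^sub>i\<close>, that is \<open>1 + t \<mapsto> (1 + t)(1 + x\<^sub>i)\<close>; its leading term is \<open>der i\<close>.
\<close>

definition alpha :: "nat \<Rightarrow> (tsym list \<Rightarrow>\<^sub>0 int) \<Rightarrow> (tsym list \<Rightarrow>\<^sub>0 int)" where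
  "alpha i = ring_ext (\<lambda>l. if l = LT then frag_of [LT] + frag_of [LX i] + frag_of [LT, LX i] else frag_of [l])"

lemma alpha_simps [simp]: "alpha i 0 = 0" "alpha i (x - y) = alpha i x - alpha i y" "alpha i (x + y) = alpha i x + alpha i y"
  "alpha i (x * y) = alpha i x * alpha i y" "alpha i (frag_of []) = frag_of []"
  "alpha i (frag_of [l]) = (if l = LT then frag_of [LT] + frag_of [LX i] + frag_of [LT, LX i] else frag_of [l])"
  by (simp_all add: alpha_def ring_ext_mult) (simp add: ring_ext_simps(4)[of _ "[]", simplified] frag_of_Nil flip: frag_of_Nil)

lemma alpha_Cons: "alpha i (frag_of (l # w)) = alpha i (frag_of [l]) * alpha i (frag_of w)"
  by (simp only: frag_of_Cons[of l w] alpha_simps)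

text \<open>Replacing a \<open>t\<close> by \<open>x\<^sub>i\<close> raises the weight by one, and
  replacing it by \<open>t x\<^sub>i\<close> raises it by two; a single replacement of the first
  kind is the derivation.\<close>

lemma alpha_High:
  "alpha i (frag_of w) \<in> High (wtl w)"
  "alpha i (frag_of w) - frag_of w \<in> High (wtl w + 1)"
  "alpha i (frag_of w) - frag_of w - derw i w \<in> High (wtl w + 2)"
proof (induction w)
  case Nil
  {
    case 1 show ?case by (simp add: High_frag_of)
  next
    case 2 show ?case by (simp add: High_zero)
  next
    case 3 show ?case by (simp add: High_zero)
  }
next
  case (Cons l w)
  let ?A = "alpha i (frag_of w)"
  have l: "frag_of [l] \<in> High (wt l)" by (simp add: High_frag_of)
  \<comment> \<open>\<open>\<delta>\<close> and \<open>\<epsilon>\<close> are the corrections of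
    weight one and two in the image of \<open>t\<close>.\<close>
  define \<delta> where "\<delta> = (if l = LT then frag_of [LX i] else 0)"
  define \<epsilon> where "\<epsilon> = (if l = LT then frag_of [LT, LX i] else 0)"
  have \<delta>: "\<delta> \<in> High (wt l + 1)" by (simp add: \<delta>_def High_frag_of High_zero)
  have \<epsilon>: "\<epsilon> \<in> High (wt l + 2)" by (simp add: \<epsilon>_def High_frag_of High_zero)
  have al: "alpha i (frag_of [l]) = frag_of [l] + \<delta> + \<epsilon>" by (simp add: \<delta>_def \<epsilon>_def)
  have dl: "derw i (l # w) = \<delta> * frag_of w + frag_of [l] * derw i w"
    by (simp add: \<delta>_def flip: frag_of_append)
  have low: "(\<delta> + \<epsilon>) * ?A \<in> High (wtl (l # w) + 1)"
    by (rule High_mult[OF High_add[OF \<delta> High_mono[OF \<epsilon>]] Cons(1)]) simp_all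
  have 2: "alpha i (frag_of (l # w)) - frag_of (l # w) = frag_of [l] * (?A - frag_of w) + (\<delta> + \<epsilon>) * ?A"
    unfolding alpha_Cons[of i l w] al unfolding frag_of_Cons[of l w] by (simp add: algebra_simps del: alpha_simps)
  have 3: "alpha i (frag_of (l # w)) - frag_of (l # w) - derw i (l # w) =
      frag_of [l] * (?A - frag_of w - derw i w) + \<delta> * (?A - frag_of w) + \<epsilon> * ?A"
    unfolding alpha_Cons[of i l w] al dl unfolding frag_of_Cons[of l w] by (simp add: algebra_simps del: alpha_simps)
  {
    case 1
    have "frag_of (l # w) + (alpha i (frag_of (l # w)) - frag_of (l # w)) \<in> High (wtl (l # w))"
      unfolding 2 using High_mult[OF l Cons(2)] High_mono[OF low] by (intro High_add) (auto simp: High_frag_of)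
    then show ?case by simp
  next
    case 2
    show ?case
      unfolding \<open>alpha i (frag_of (l # w)) - frag_of (l # w) = _\<close>
      by (intro High_add low High_mult[OF l Cons(2)]) simp
  next
    case 3
    show ?case
      unfolding \<open>alpha i (frag_of (l # w)) - frag_of (l # w) - derw i (l # w) = _\<close>
      by (intro High_add High_mult[OF l Cons(3)] High_mult[OF \<delta> Cons(2)] High_mult[OF \<epsilon> Cons(1)]) simp_all
  }
qed

lemma derw_High: "derw i w \<in> High (wtl w + 1)"
proof (induction w)
  case (Cons l w)
  have "frag_of [l] * derw i w \<in> High (wtl (l # w) + 1)"
    by (rule High_mult[OF _ Cons, of _ "wt l"]) (simp_all add: High_frag_of)
  then show ?case by (auto simp: High_frag_of intro: High_add)
qed (simp add: High_zero)

definition mulr :: "tsym \<Rightarrow> (tsym list \<Rightarrow>\<^sub>0 int) \<Rightarrow> (tsym list \<Rightarrow>\<^sub>0 int)" where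
  "mulr l m = m + m * frag_of [l]"

fun phi :: "fp_gen \<Rightarrow> (tsym list \<Rightarrow>\<^sub>0 int) \<Rightarrow> (tsym list \<Rightarrow>\<^sub>0 int)" where
  "phi T m = mulr LT m"
| "phi (F i) m = mulr (LY i) (alpha i m)"

lemma mulr_add: "mulr l (x + y) = mulr l x + mulr l y"
  by (simp add: mulr_def algebra_simps)

lemma phi_add: "phi g (x + y) = phi g x + phi g y"
  by (cases g) (simp_all add: mulr_add)

lemma phi_High:
  "phi g (frag_of w) - frag_of w \<in> High (wtl w + 1)"
  "phi g (frag_of w) - frag_of w - gen_act g (frag_of w) \<in> High (wtl w + 2)"
proof -
  have "phi g (frag_of w) - frag_of w \<in> High (wtl w + 1) \<and> phi g (frag_of w) - frag_of w - gen_act g (frag_of w) \<in> High (wtl w + 2)"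
  proof (cases g)
    case (F i)
    let ?A = "alpha i (frag_of w)"
    have Y: "frag_of [LY i] \<in> High 1" by (simp add: High_frag_of)
    have "(?A - frag_of w) + ?A * frag_of [LY i] \<in> High (wtl w + 1)"
      by (intro High_add alpha_High High_mult[OF alpha_High(1) Y]) simp
    moreover have "(?A - frag_of w - derw i w) + (?A - frag_of w) * frag_of [LY i] \<in> High (wtl w + 2)"
      by (intro High_add alpha_High High_mult[OF alpha_High(2) Y]) simp
    ultimately show ?thesis by (simp add: F mulr_def algebra_simps)
  next
    case T
    then show ?thesis by (simp add: mulr_def High_frag_of High_zero flip: frag_of_append)
  qed
  then show "phi g (frag_of w) - frag_of w \<in> High (wtl w + 1)"
    "phi g (frag_of w) - frag_of w - gen_act g (frag_of w) \<in> High (wtl w + 2)" by auto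
qed

lemma gen_act_High: "gen_act g (frag_of w) \<in> High (wtl w + 1)"
  by (cases g) (use derw_High in \<open>auto simp: High_frag_of simp flip: frag_of_append intro!: High_add\<close>)

context partially_commutative
begin

text \<open>The relations involving \<open>LT\<close> survive because \<open>LT\<close> and
  \<open>LX i\<close> both commute with every \<open>LY j\<close>.\<close>

lemma comm_ideal_alpha: "x \<in> comm_ideal \<Longrightarrow> alpha i x \<in> comm_ideal"
proof (induction rule: comm_ideal.induct)
  case (rel a b x y)
  have comm: "frag_of [c, LY j] - frag_of [LY j, c] \<in> comm_ideal" if "\<not> isY c" for c j
    using that by (intro comm_ideal_rel) (cases c; simp)
  have T: "(frag_of [LT] + frag_of [LX i] + frag_of [LT, LX i]) * frag_of [LY j]
      - frag_of [LY j] * (frag_of [LT] + frag_of [LX i] + frag_of [LT, LX i]) \<in> comm_ideal" for j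
  proof -
    have "(frag_of [LT, LY j] - frag_of [LY j, LT]) + (frag_of [LX i, LY j] - frag_of [LY j, LX i])
        + frag_of [LT] * (frag_of [LX i, LY j] - frag_of [LY j, LX i])
        + (frag_of [LT, LY j] - frag_of [LY j, LT]) * frag_of [LX i] \<in> comm_ideal"
      by (intro comm_ideal_add comm_ideal_mult_left comm_ideal_mult_right comm) simp_all
    then show ?thesis by (simp add: algebra_simps flip: frag_of_append)
  qed
  have "alpha i (frag_of [a, b] - frag_of [b, a]) \<in> comm_ideal"
  proof (cases "a = LT \<or> b = LT")
    case True
    then consider j where "a = LT" "b = LY j" | j where "a = LY j" "b = LT"
      using rel by (cases a; cases b) auto
    then show ?thesis
    proof cases
      case 1
      then show ?thesis using T[of j] by (simp add: alpha_Cons[of i _ "[_]"])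
    next
      case 2
      then show ?thesis using add_subgroup_uminus[OF comm_ideal_subgroup T[of j]] by (simp add: alpha_Cons[of i _ "[_]"])
    qed
  next
    case False
    then show ?thesis using comm_ideal_rel[OF rel] by (simp add: alpha_Cons[of i _ "[_]"] flip: frag_of_append)
  qed
  then show ?case using comm_ideal_mult by simp
qed (simp_all add: comm_ideal.zero comm_ideal.diff)

lemma comm_ideal_mulr: "x \<in> comm_ideal \<Longrightarrow> mulr l x \<in> comm_ideal"
  by (simp add: mulr_def comm_ideal_add comm_ideal_mult_right)

lemma comm_ideal_phi: "x \<in> comm_ideal \<Longrightarrow> phi g x \<in> comm_ideal"
  by (cases g) (simp_all add: comm_ideal_mulr comm_ideal_alpha)

text \<open>Functionals on the traces of weight below \<open>k\<close>; the strict bound gives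
  \<open>Fun 0 = {0}\<close>. Bounding the weight here replaces power series in traces.\<close>

definition Fun :: "nat \<Rightarrow> ((tsym list \<Rightarrow>\<^sub>0 int) \<Rightarrow> int) set" where
  "Fun k = {\<xi>. (\<forall>x y. \<xi> (x + y) = \<xi> x + \<xi> y) \<and> (\<forall>x\<in>comm_ideal. \<xi> x = 0) \<and> (\<forall>w. k \<le> wtl w \<longrightarrow> \<xi> (frag_of w) = 0)}"

lemma Fun_add: "\<xi> \<in> Fun k \<Longrightarrow> \<xi> (x + y) = \<xi> x + \<xi> y"
  and Fun_comm: "\<xi> \<in> Fun k \<Longrightarrow> x \<in> comm_ideal \<Longrightarrow> \<xi> x = 0"
  by (simp_all add: Fun_def)

lemma Fun_diff: "\<xi> \<in> Fun k \<Longrightarrow> \<xi> (x - y) = \<xi> x - \<xi> y"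
  using Fun_add[of \<xi> k "x - y" y] by simp

lemma Fun_zero: "\<xi> \<in> Fun k \<Longrightarrow> \<xi> 0 = 0"
  using Fun_diff[of \<xi> k 0 0] by simp

lemma Fun_eqI: "\<xi> \<in> Fun k \<Longrightarrow> x - y \<in> comm_ideal \<Longrightarrow> \<xi> x = \<xi> y"
  using Fun_comm[of \<xi> k "x - y"] Fun_diff[of \<xi> k x y] by simp

lemma Fun_High:
  assumes "\<xi> \<in> Fun k" "x \<in> High k"
  shows "\<xi> x = 0"
proof -
  have "Poly_Mapping.keys x \<subseteq> {w. k \<le> wtl w}" using assms(2) by (auto simp: High_def)
  then show ?thesis
    by (induction x rule: frag_induction) (use assms(1) in \<open>simp_all add: Fun_zero Fun_diff\<close>, simp add: Fun_def)
qed

lemma Fun_filtered: "filtered Fun"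
proof
  show "Fun 0 = {0}"
  proof
    show "Fun 0 \<subseteq> {0}"
      using Fun_High[of _ 0] by (auto simp: High_def fun_eq_iff)
    show "{0} \<subseteq> Fun 0" by (simp add: Fun_def)
  qed
  show "Fun k \<subseteq> Fun (Suc k)" for k by (auto simp: Fun_def)
  show "x - y \<in> Fun k" if "x \<in> Fun k" "y \<in> Fun k" for x y k
    using that by (simp add: Fun_def)
qed

sublocale Fun: filtered Fun
  by (rule Fun_filtered)

text \<open>The transpose reverses composition, so the product of \<open>pull f\<close> and
  \<open>pull g\<close> first applies \<open>f\<close> to the argument: words act in their reading
  order.\<close>

definition pull :: "((tsym list \<Rightarrow>\<^sub>0 int) \<Rightarrow> (tsym list \<Rightarrow>\<^sub>0 int)) \<Rightarrow> ((tsym list \<Rightarrow>\<^sub>0 int) \<Rightarrow> int) \<Rightarrow> ((tsym list \<Rightarrow>\<^sub>0 int) \<Rightarrow> int)" where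
  "pull f \<xi> = (\<lambda>m. \<xi> (f m))"

lemma pull_Fun:
  assumes "\<And>x y. f (x + y) = f x + f y" "\<And>x. x \<in> comm_ideal \<Longrightarrow> f x \<in> comm_ideal"
    and "\<And>w. f (frag_of w) \<in> High (wtl w + d)" "\<xi> \<in> Fun k"
  shows "pull f \<xi> \<in> Fun (k - d)"
proof -
  have "\<xi> (f (frag_of w)) = 0" if "k - d \<le> wtl w" for w
    by (rule Fun_High[OF assms(4) High_mono[OF assms(3)]]) (use that in simp)
  then show ?thesis
    using assms unfolding Fun_def pull_def by simp
qed

lemma pull_additive: "Fun.additive_V (pull f)"
  by (simp add: Fun.additive_V_def pull_def fun_eq_iff)

lemma pull_unip:
  assumes "\<And>x y. f (x + y) = f x + f y" "\<And>x. x \<in> comm_ideal \<Longrightarrow> f x \<in> comm_ideal"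
    and "\<And>w. f (frag_of w) - frag_of w \<in> High (wtl w + 1)"
  shows "Fun.unip 1 (pull f)"
  unfolding Fun.unip_def
proof (intro allI ballI)
  fix k \<xi> assume \<xi>: "\<xi> \<in> Fun k"
  have "pull (\<lambda>x. f x - x) \<xi> \<in> Fun (k - 1)"
    by (rule pull_Fun[OF _ _ assms(3) \<xi>]) (simp_all add: assms(1,2) comm_ideal.diff algebra_simps)
  moreover have "pull (\<lambda>x. f x - x) \<xi> = pull f \<xi> - \<xi>"
    using Fun_diff[OF \<xi>] by (simp add: pull_def fun_eq_iff)
  ultimately show "pull f \<xi> - \<xi> \<in> Fun (k - 1)" by simp
qed

abbreviation "hat f \<equiv> Fun.lift (pull f)"

lemma hat_apply: "\<xi> \<in> Fun.V \<Longrightarrow> hat f \<xi> = (\<lambda>m. \<xi> (f m))"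
  by (simp add: Fun.lift_def pull_def)

lemma hat_phi_UG: "hat (phi g) \<in> carrier Fun.UG"
  by (intro Fun.lift_UG pull_additive pull_unip phi_add comm_ideal_phi phi_High)

lemma hat_mulr_UG: "hat (mulr l) \<in> carrier Fun.UG"
proof (intro Fun.lift_UG pull_additive pull_unip mulr_add comm_ideal_mulr)
  show "mulr l (frag_of w) - frag_of w \<in> High (wtl w + 1)" for w
    using wt_pos[of l] by (simp add: mulr_def High_frag_of flip: frag_of_append)
qed

text \<open>Functionals vanish on \<open>comm_ideal\<close>, so the operators have to agree only
  modulo it.\<close>

lemma hat_comp_eqI:
  assumes UG: "hat f \<in> carrier Fun.UG" "hat g \<in> carrier Fun.UG" "hat f' \<in> carrier Fun.UG" "hat g' \<in> carrier Fun.UG"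
    and eq: "\<And>m. g (f m) - g' (f' m) \<in> comm_ideal"
  shows "hat f \<otimes>\<^bsub>Fun.UG\<^esub> hat g = hat f' \<otimes>\<^bsub>Fun.UG\<^esub> hat g'"
proof (rule Fun.UG_eqI)
  show "hat f \<otimes>\<^bsub>Fun.UG\<^esub> hat g \<in> carrier Fun.UG" "hat f' \<otimes>\<^bsub>Fun.UG\<^esub> hat g' \<in> carrier Fun.UG" using UG by simp_all
  fix \<xi> assume \<xi>: "\<xi> \<in> Fun.V"
  have "hat g \<xi> \<in> Fun.V" "hat g' \<xi> \<in> Fun.V"
    using \<xi> Fun.unip_V[OF Fun.UG_unip] UG by blast+
  moreover obtain k where "\<xi> \<in> Fun k" using \<xi> by (auto simp: Fun.V_def)
  ultimately show "(hat f \<otimes>\<^bsub>Fun.UG\<^esub> hat g) \<xi> = (hat f' \<otimes>\<^bsub>Fun.UG\<^esub> hat g') \<xi>"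
    using \<xi> Fun_eqI[OF _ eq] by (simp add: Fun.UG_simps hat_apply) blast
qed

lemma mulr_commute:
  assumes "commuting a b"
  shows "mulr a (mulr b m) - mulr b (mulr a m) \<in> comm_ideal"
proof -
  have "m * (frag_of [b, a] - frag_of [a, b]) * 1 \<in> comm_ideal"
    by (rule comm_ideal.rel) (rule commuting_sym[OF assms])
  then show ?thesis by (simp add: mulr_def algebra_simps flip: frag_of_append)
qed

lemma alpha_mulr: "l \<noteq> LT \<Longrightarrow> alpha i (mulr l m) = mulr l (alpha i m)"
  by (simp add: mulr_def)

text \<open>The two orders send \<open>1 + t\<close> to
  \<open>(1 + t)(1 + x\<^sub>a)(1 + x\<^sub>b)\<close> and
  \<open>(1 + t)(1 + x\<^sub>b)(1 + x\<^sub>a)\<close>.\<close>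

lemma alpha_commute:
  assumes "(a, b) \<in> \<theta>"
  shows "alpha a (alpha b x) - alpha b (alpha a x) \<in> comm_ideal"
proof (rule add_subgroup_linear[OF comm_ideal_subgroup, where f = "\<lambda>x. alpha a (alpha b x) - alpha b (alpha a x)"])
  fix w
  show "alpha a (alpha b (frag_of w)) - alpha b (alpha a (frag_of w)) \<in> comm_ideal"
  proof (induction w)
    case Nil
    then show ?case by (simp add: comm_ideal.zero)
  next
    case (Cons l w)
    let ?f = "\<lambda>i. alpha i"
    have l: "?f a (?f b (frag_of [l])) - ?f b (?f a (frag_of [l])) \<in> comm_ideal"
    proof (cases "l = LT")
      case True
      have x: "frag_of [LX a, LX b] - frag_of [LX b, LX a] \<in> comm_ideal"
        by (rule comm_ideal_rel) (simp add: assms)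
      have "(frag_of [LX a, LX b] - frag_of [LX b, LX a]) + frag_of [LT] * (frag_of [LX a, LX b] - frag_of [LX b, LX a]) \<in> comm_ideal"
        by (intro comm_ideal_add comm_ideal_mult_left x)
      then show ?thesis using True by (simp add: alpha_Cons[of _ _ "[_]"] algebra_simps flip: frag_of_append)
    next
      case False
      then show ?thesis by (simp add: comm_ideal.zero)
    qed
    have "(?f a (?f b (frag_of [l])) - ?f b (?f a (frag_of [l]))) * ?f a (?f b (frag_of w))
        + ?f b (?f a (frag_of [l])) * (?f a (?f b (frag_of w)) - ?f b (?f a (frag_of w))) \<in> comm_ideal"
      by (intro comm_ideal_add comm_ideal_mult_left comm_ideal_mult_right l Cons)
    then show ?case unfolding frag_of_Cons[of l w] by (simp add: algebra_simps del: alpha_simps(6))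
  qed
qed simp

lemma hat_f_commute:
  assumes "(a, b) \<in> \<theta>"
  shows "commutator Fun.UG (hat (phi (F a))) (hat (phi (F b))) = \<one>\<^bsub>Fun.UG\<^esub>"
  unfolding Fun.UG.commutator_eq_one_iff[OF hat_phi_UG hat_phi_UG]
proof (rule hat_comp_eqI[OF hat_phi_UG hat_phi_UG hat_phi_UG hat_phi_UG])
  fix m
  let ?x = "alpha b (alpha a m)" and ?y = "alpha a (alpha b m)"
  have "mulr (LY b) (mulr (LY a) (?x - ?y)) + (mulr (LY b) (mulr (LY a) ?y) - mulr (LY a) (mulr (LY b) ?y)) \<in> comm_ideal"
    using assms sym by (intro comm_ideal_add comm_ideal_mulr alpha_commute mulr_commute) auto
  then show "phi (F b) (phi (F a) m) - phi (F a) (phi (F b) m) \<in> comm_ideal"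
    by (simp add: alpha_mulr) (simp add: mulr_def algebra_simps)
qed

text \<open>The commutator is the unique solution \<open>x\<close> of
  \<open>f\<^sub>i t x = t f\<^sub>i\<close>, so it suffices that right multiplication with
  \<open>1 + x\<^sub>i\<close> solves this equation.\<close>

lemma hat_x: "commutator Fun.UG (hat (phi T)) (hat (phi (F i))) = hat (mulr (LX i))"
proof -
  let ?t = "hat (phi T)" and ?f = "hat (phi (F i))" and ?x = "hat (mulr (LX i))"
  note UG = hat_phi_UG[of T] hat_phi_UG[of "F i"] hat_mulr_UG[of "LX i"]
  have "phi (F i) (phi T m) - mulr (LX i) (mulr LT (phi (F i) m)) \<in> comm_ideal" for m
  proof -
    let ?n = "alpha i m"
    \<comment> \<open>The two sides are \<open>n (1 + t)(1 + x)(1 + y)\<close> and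
      \<open>n (1 + y)(1 + t)(1 + x)\<close>; moving \<open>y\<close> accounts for these four
      exchanges.\<close>
    have 1: "?n * (frag_of [LT, LY i] - frag_of [LY i, LT]) * 1 \<in> comm_ideal"
      "?n * (frag_of [LT, LY i] - frag_of [LY i, LT]) * frag_of [LX i] \<in> comm_ideal"
      "?n * (frag_of [LX i, LY i] - frag_of [LY i, LX i]) * 1 \<in> comm_ideal"
      "(?n * frag_of [LT]) * (frag_of [LX i, LY i] - frag_of [LY i, LX i]) * 1 \<in> comm_ideal"
      by (rule comm_ideal.rel, simp)+
    from comm_ideal_add[OF comm_ideal_add[OF 1(1,2)] comm_ideal_add[OF 1(3,4)]]
    show ?thesis by (simp add: mulr_def algebra_simps flip: frag_of_append)
  qed
  then have "?f (?t (?x \<xi>)) = ?t (?f \<xi>)" if V: "\<xi> \<in> Fun.V" for \<xi>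
  proof -
    have "?x \<xi> \<in> Fun.V" "?f \<xi> \<in> Fun.V" "?t (?x \<xi>) \<in> Fun.V"
      using V Fun.unip_V[OF Fun.UG_unip] UG by blast+
    then have eq: "?f (?t (?x \<xi>)) = (\<lambda>m. \<xi> (mulr (LX i) (mulr LT (phi (F i) m))))" "?t (?f \<xi>) = (\<lambda>m. \<xi> (phi (F i) (phi T m)))"
      using V by (simp_all add: hat_apply)
    obtain k where "\<xi> \<in> Fun k" using V by (auto simp: Fun.V_def)
    then show ?thesis unfolding eq using Fun_eqI[OF _ \<open>\<And>m. phi (F i) (phi T m) - mulr (LX i) (mulr LT (phi (F i) m)) \<in> comm_ideal\<close>]
      by (intro ext) metis
  qed
  then have "?f \<otimes>\<^bsub>Fun.UG\<^esub> ?t \<otimes>\<^bsub>Fun.UG\<^esub> ?x = ?t \<otimes>\<^bsub>Fun.UG\<^esub> ?f"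
    using UG by (intro Fun.UG_eqI Fun.UG.m_closed) (simp_all add: Fun.UG_simps(2))
  then show ?thesis
    using UG Fun.UG.mult_commutator[OF UG(1,2)] Fun.UG.Units_l_cancel
    by (metis Fun.UG.commutator_closed Fun.UG.m_closed Fun.UG.Units_eq)
qed

lemma hat_xf_commute: "commutator Fun.UG (hat (mulr (LX i))) (hat (phi (F j))) = \<one>\<^bsub>Fun.UG\<^esub>"
  unfolding Fun.UG.commutator_eq_one_iff[OF hat_mulr_UG hat_phi_UG]
proof (rule hat_comp_eqI[OF hat_mulr_UG hat_phi_UG hat_phi_UG hat_mulr_UG])
  show "phi (F j) (mulr (LX i) m) - mulr (LX i) (phi (F j) m) \<in> comm_ideal" for m
    using mulr_commute[of "LY j" "LX i" "alpha j m"] by (simp add: alpha_mulr)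
qed

lemma hat_x_commute:
  "(a, b) \<in> \<theta> \<Longrightarrow> commutator Fun.UG (hat (mulr (LX a))) (hat (mulr (LX b))) = \<one>\<^bsub>Fun.UG\<^esub>"
  unfolding Fun.UG.commutator_eq_one_iff[OF hat_mulr_UG hat_mulr_UG]
  by (rule hat_comp_eqI[OF hat_mulr_UG hat_mulr_UG hat_mulr_UG hat_mulr_UG]) (rule mulr_commute, simp add: sym)

lemma gen_act_add: "gen_act g (x + y) = gen_act g x + gen_act g y"
  by (cases g) (simp_all add: ring_distribs)

lemma lead_phi: "Fun.lead 1 (hat (phi g)) (pull (gen_act g))"
  unfolding Fun.lead_def
proof (intro conjI allI ballI pull_additive)
  fix k \<xi> assume \<xi>: "\<xi> \<in> Fun k"
  show "pull (gen_act g) \<xi> \<in> Fun (k - 1)"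
    by (rule pull_Fun[OF gen_act_add comm_ideal_op gen_act_High \<xi>])
  have "pull (\<lambda>x. phi g x - x - gen_act g x) \<xi> \<in> Fun (k - 2)"
  proof (rule pull_Fun[OF _ _ phi_High(2) \<xi>])
    show "phi g x - x - gen_act g x \<in> comm_ideal" if "x \<in> comm_ideal" for x
      using that by (intro comm_ideal.diff comm_ideal_phi comm_ideal_op)
  qed (simp add: phi_add gen_act_add)
  moreover have "pull (\<lambda>x. phi g x - x - gen_act g x) \<xi> = hat (phi g) \<xi> - \<xi> - pull (gen_act g) \<xi>"
    using Fun_diff[OF \<xi>] Fun.S_V[OF \<xi>] by (simp add: hat_apply pull_def fun_eq_iff)
  ultimately show "hat (phi g) \<xi> - \<xi> - pull (gen_act g) \<xi> \<in> Fun (k - Suc 1)" by (simp add: numeral_2_eq_2)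
qed

end

section \<open>Faithfulness of the representation\<close>

text \<open>\<open>a e k\<close> will be the value of a functional, acted on by the
  \<open>e\<close>-th power of a letter, at a word followed by \<open>k\<close> copies of that
  letter. The recursion gives \<open>a e k\<close> as the sum of
  \<open>binom(e, j) a 0 (k + j)\<close>, and \<open>two\<close> leaves only
  \<open>j = 0, 1\<close>.\<close>

lemma binomial_recursion:
  fixes a :: "int \<Rightarrow> nat \<Rightarrow> int"
  assumes step: "\<And>e k. a (e + 1) k = a e k + a e (Suc k)"
    and vanish: "\<And>e. \<exists>K. \<forall>k\<ge>K. a e k = 0" and two: "\<And>k. k \<ge> 2 \<Longrightarrow> a 0 k = 0"
  shows "a e k = a 0 k + e * a 0 (Suc k)"
proof -
  have two': "a 0 (Suc (Suc k)) = 0" for k using two[of "Suc (Suc k)"] by simp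
  have "\<forall>k. a e k = a 0 k + e * a 0 (Suc k)"
  proof (induction e rule: int_induct[where k = 0])
    case base
    then show ?case by simp
  next
    case (step1 i)
    then show ?case using step[of i] two' by (simp add: algebra_simps)
  next
    case (step2 i)
    \<comment> \<open>For negative exponents the recursion runs downwards in \<open>k\<close>, from
      where both sides vanish.\<close>
    obtain K where K: "\<forall>k\<ge>K. a (i - 1) k = 0" using vanish by blast
    have zero: "a (i - 1) k = a 0 k + (i - 1) * a 0 (Suc k)" if "k \<ge> max K 2" for k
      using K two that by simp
    have "a (i - 1) k = a 0 k + (i - 1) * a 0 (Suc k)" if "k \<le> max K 2" for k
      using that
    proof (induction k rule: inc_induct)
      case base
      then show ?case using zero by blast
    next
      case (step k)
      have "a (i - 1) k = a i k - a (i - 1) (Suc k)" using assms(1)[of "i - 1" k] by simp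
      then show ?case using step2 step.IH two'[of k] by (simp add: algebra_simps)
    qed
    then show ?case using zero by (meson nle_le)
  qed
  then show ?thesis by blast
qed

lemma split_at_count:
  "count_list w a > r \<Longrightarrow> \<exists>p q. w = p @ a # q \<and> count_list p a = r"
proof (induction w arbitrary: r)
  case (Cons b w)
  show ?case
  proof (cases "b = a \<and> r = 0")
    case True
    then show ?thesis by (intro exI[of _ "[]"] exI[of _ w]) simp
  next
    case False
    then have "count_list w a > (if b = a then r - 1 else r)" using Cons.prems by (auto split: if_splits)
    then obtain p q where "w = p @ a # q" "count_list p a = (if b = a then r - 1 else r)" using Cons.IH by blast
    then show ?thesis using False by (intro exI[of _ "b # p"] exI[of _ q]) auto
  qed
qed simp

lemma append_Cons_eq_count:
  "p @ a # q = p' @ a # q' \<Longrightarrow> count_list p a = count_list p' a \<Longrightarrow> p = p' \<and> q = q'"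
proof (induction p arbitrary: p')
  case Nil
  then show ?case by (cases p') auto
next
  case (Cons b p)
  then show ?case by (cases p') (auto split: if_splits)
qed

context partially_commutative
begin

text \<open>
  If the trace of a word is not square-free, two equal letters of the word can be brought
  together. A shortest expression by syllables therefore has a square-free trace.
\<close>

lemma trace_square:
  assumes "trace w = trace (u @ [a, a] @ v)"
  shows "\<exists>p m q. w = p @ a # m @ a # q \<and> (\<forall>b\<in>set m. commuting a b)"
proof -
  \<comment> \<open>The copies of \<open>a\<close> with numbers \<open>r + 1\<close> and
    \<open>r + 2\<close> in \<open>w\<close> are the ones that can be brought together.\<close>
  define r where "r = count_list u a"
  have mset: "mset w = mset (u @ [a, a] @ v)" by (rule trace_mset[OF assms])
  have count: "count_list w a = count_list (u @ [a, a] @ v) a"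
    using mset by (metis count_mset)
  then have "count_list w a > r" by (simp add: r_def)
  then obtain p q where w1: "w = p @ a # q" "count_list p a = r" using split_at_count[of r w a] by blast
  then have "count_list q a > 0" using count by (simp add: r_def)
  then obtain m q' where q: "q = m @ a # q'" "count_list m a = 0" using split_at_count[of 0 q a] by blast
  \<comment> \<open>In the projection of \<open>u @ [a, a] @ v\<close> to a non-commuting pair
    \<open>a\<close>, \<open>b\<close> these two copies are adjacent, so no such \<open>b\<close>
    lies between them in \<open>w\<close>.\<close>
  have "commuting a b" if b: "b \<in> set m" for b
  proof (rule ccontr)
    assume ncm: "\<not> commuting a b"
    let ?f = "filter (\<lambda>l. l = a \<or> l = b)"
    have "?f w = ?f (u @ [a, a] @ v)" using assms ncm unfolding trace_eq_iff by blast
    then have eq: "?f p @ a # (?f m @ a # ?f q') = ?f u @ a # (a # ?f v)" by (simp add: w1 q)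
    have cnt: "count_list (?f z) a = count_list z a" for z by (induction z) auto
    have "?f m @ a # ?f q' = a # ?f v"
      using append_Cons_eq_count[OF eq] w1(2) by (simp add: cnt r_def)
    moreover have "a \<notin> set m" using q(2) by (simp add: count_list_0_iff)
    ultimately have "a \<notin> set (?f m)" "?f m @ a # ?f q' = a # ?f v" by simp_all
    then have "?f m = []" by (cases "?f m") auto
    then show False using b by (auto simp: filter_empty_conv)
  qed
  then show ?thesis using w1 q by blast
qed

definition coef :: "(tsym \<times> tsym \<Rightarrow> tsym list) \<Rightarrow> (tsym list \<Rightarrow>\<^sub>0 int) \<Rightarrow> int" where
  "coef \<tau> x = Poly_Mapping.lookup (trf x) \<tau>"

lemma coef_frag_of: "coef \<tau> (frag_of w) = (if trace w = \<tau> then 1 else 0)"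
  by (simp add: coef_def)

text \<open>Words with the same trace have the same weight, so the coefficient vanishes beyond the
  weight of \<open>w\<close>.\<close>

lemma coef_Fun: "coef (trace w) \<in> Fun (Suc (wtl w))"
  unfolding Fun_def
proof (intro CollectI conjI allI ballI impI)
  show "coef (trace w) (x + y) = coef (trace w) x + coef (trace w) y" for x y by (simp add: coef_def lookup_add)
  show "coef (trace w) x = 0" if "x \<in> comm_ideal" for x using that by (simp add: coef_def comm_ideal_iff)
  show "coef (trace w) (frag_of v) = 0" if "Suc (wtl w) \<le> wtl v" for v
  proof -
    have "trace v \<noteq> trace w"
    proof
      assume "trace v = trace w"
      then have "mset v = mset w" by (rule trace_mset)
      then have "wtl v = wtl w" unfolding wtl_def by (metis mset_map sum_mset_sum_list)
      then show False using that by simp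
    qed
    then show ?thesis by (simp add: coef_frag_of)
  qed
qed

lemma coef_shorter: "length v < length w \<Longrightarrow> coef (trace w) (frag_of v) = 0"
  using trace_mset by (metis coef_frag_of less_irrefl size_mset)

end

text \<open>The expansion of a product of powers when squares are discarded: the \<open>e\<close>-th
  power of \<open>1 + l\<close> becomes \<open>1 + e l\<close>, also for negative
  \<open>e\<close>.\<close>

fun pexp :: "(tsym \<times> int) list \<Rightarrow> (tsym list \<Rightarrow>\<^sub>0 int)" where
  "pexp [] = 1"
| "pexp ((l, e) # s) = (1 + frag_cmul e (frag_of [l])) * pexp s"

definition short :: "nat \<Rightarrow> (tsym list \<Rightarrow>\<^sub>0 int) set" where
  "short n = {x. \<forall>w\<in>Poly_Mapping.keys x. length w < n}"

lemma short_subgroup: "add_subgroup (short n)"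
  using keys_diff by (fastforce simp: add_subgroup_def short_def)

lemma short_Cons: "x \<in> short n \<Longrightarrow> frag_of [l] * x \<in> short (Suc n)"
proof -
  assume "x \<in> short n"
  then have "Poly_Mapping.keys x \<subseteq> {w. length w < n}" by (auto simp: short_def)
  then show ?thesis
  proof (induction x rule: frag_induction)
    case (one w)
    then show ?case by (simp add: short_def flip: frag_of_append)
  qed (simp_all add: ring_distribs add_subgroup_zero[OF short_subgroup] add_subgroup_diff[OF short_subgroup])
qed

text \<open>Every other term of the product omits at least one letter.\<close>

lemma pexp_leading:
  "pexp s - frag_cmul (prod_list (map snd s)) (frag_of (map fst s)) \<in> short (length s)"
proof (induction s rule: pexp.induct)
  case 1
  then show ?case by (simp add: frag_of_Nil add_subgroup_zero[OF short_subgroup])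
next
  case (2 l e s)
  let ?P = "frag_cmul (prod_list (map snd s)) (frag_of (map fst s))"
  have mono: "x \<in> short (length s) \<Longrightarrow> x \<in> short (Suc (length s))" for x by (auto simp: short_def less_SucI)
  have "?P \<in> short (Suc (length s))" by (simp add: short_def)
  then have "pexp s \<in> short (Suc (length s))"
    using add_subgroup_add[OF short_subgroup mono[OF 2]] by fastforce
  moreover have "frag_cmul e (frag_of [l] * (pexp s - ?P)) \<in> short (Suc (length s))"
    by (intro add_subgroup_cmul[OF short_subgroup] short_Cons 2)
  ultimately have "pexp s + frag_cmul e (frag_of [l] * (pexp s - ?P)) \<in> short (Suc (length s))"
    by (rule add_subgroup_add[OF short_subgroup])
  moreover have "frag_cmul e (frag_of [l] * ?P) = frag_cmul (prod_list (map snd ((l, e) # s))) (frag_of (map fst ((l, e) # s)))"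
    by (simp add: frag_cmul_mult_right flip: frag_of_append)
  ultimately show ?case
    by (simp add: right_diff_distrib ring_distribs frag_cmul_diff frag_cmul_mult_left add_diff_eq)
qed

lemma (in group) commute_int_pow:
  assumes "x \<in> carrier G" "y \<in> carrier G" "x \<otimes> y = y \<otimes> x"
  shows "x [^] (e::int) \<otimes> y = y \<otimes> x [^] e"
proof -
  have pow: "x [^] (n::nat) \<otimes> y = y \<otimes> x [^] n" for n
    using group_commutes_pow[OF assms(3,1,2)] .
  show ?thesis
  proof (cases e rule: int_cases2)
    case (nonneg n)
    then show ?thesis using pow by (simp add: int_pow_int)
  next
    case (nonpos n)
    have "inv (x [^] n) \<otimes> y = y \<otimes> inv (x [^] n)"
    proof -
      have "inv (x [^] n) \<otimes> (y \<otimes> x [^] n) \<otimes> inv (x [^] n) = inv (x [^] n) \<otimes> y"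
        using assms by (simp add: m_assoc)
      moreover have "inv (x [^] n) \<otimes> (x [^] n \<otimes> y) \<otimes> inv (x [^] n) = y \<otimes> inv (x [^] n)"
        using assms by (simp flip: m_assoc)
      ultimately show ?thesis using pow[of n] by simp
    qed
    then show ?thesis using nonpos assms by (simp add: int_pow_neg int_pow_int)
  qed
qed

text \<open>What the argument of Magnus uses of the group. Commutation is assumed within one kind of
  letters: \<open>f\<^sub>i\<close> and \<open>t\<close> commute as letters of a trace but not in
  the group.\<close>

locale fp_representation = partially_commutative + K: group K for K (structure) +
  fixes tsym_val :: "tsym \<Rightarrow> 'a" and A :: "tsym set" and r :: "'a \<Rightarrow> (((tsym list \<Rightarrow>\<^sub>0 int) \<Rightarrow> int) \<Rightarrow> ((tsym list \<Rightarrow>\<^sub>0 int) \<Rightarrow> int))"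
  assumes tsym_val: "l \<in> A \<Longrightarrow> tsym_val l \<in> carrier K"
    and r_hom: "r \<in> hom K Fun.UG"
    and r_Y: "LY i \<in> A \<Longrightarrow> r (tsym_val (LY i)) = hat (phi (F i))"
    and r_TX: "l \<in> A \<Longrightarrow> \<not> isY l \<Longrightarrow> r (tsym_val l) = hat (mulr l)"
    and tsym_val_commute: "a \<in> A \<Longrightarrow> b \<in> A \<Longrightarrow> isY a = isY b \<Longrightarrow> commuting a b \<Longrightarrow> tsym_val a \<otimes> tsym_val b = tsym_val b \<otimes> tsym_val a"
begin

sublocale r: group_hom K Fun.UG r
  by unfold_locales (rule r_hom)

fun sval :: "(tsym \<times> int) list \<Rightarrow> 'a" where
  "sval [] = \<one>"
| "sval ((l, e) # s) = tsym_val l [^] e \<otimes> sval s"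

definition ordered :: "(tsym \<times> int) list \<Rightarrow> bool" where
  "ordered s \<longleftrightarrow> fst ` set s \<subseteq> A \<and> sorted_wrt (\<lambda>x y. isY (fst y) \<longrightarrow> isY (fst x)) s"

lemma sval_closed: "fst ` set s \<subseteq> A \<Longrightarrow> sval s \<in> carrier K"
  by (induction s rule: sval.induct) (auto simp: tsym_val)

lemma sval_append: "fst ` set s \<subseteq> A \<Longrightarrow> fst ` set s' \<subseteq> A \<Longrightarrow> sval (s @ s') = sval s \<otimes> sval s'"
  by (induction s rule: sval.induct) (auto simp: tsym_val sval_closed K.m_assoc)

lemma r_V: "g \<in> carrier K \<Longrightarrow> \<xi> \<in> Fun.V \<Longrightarrow> r g \<xi> \<in> Fun.V"
  using Fun.unip_V[OF Fun.UG_unip[OF r.hom_closed]] by blast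

lemma V_add: "\<xi> \<in> Fun.V \<Longrightarrow> \<xi> (x + y) = \<xi> x + \<xi> y"
  using Fun_add by (auto simp: Fun.V_def)

lemma V_cmul:
  assumes "\<xi> \<in> Fun.V"
  shows "\<xi> (frag_cmul e x) = e * \<xi> x"
proof -
  obtain k where k: "\<xi> \<in> Fun k" using assms by (auto simp: Fun.V_def)
  have "\<xi> (frag_cmul (int n) x) = int n * \<xi> x" for n
    by (induction n) (simp_all add: Fun_zero[OF k] Fun_add[OF k] frag_cmul_distrib algebra_simps)
  moreover have "\<xi> (- y) = - \<xi> y" for y using Fun_diff[OF k, of 0 y] Fun_zero[OF k] by simp
  ultimately show ?thesis by (cases e rule: int_cases2) (simp_all flip: minus_frag_cmul)
qed

lemma alpha_Y: "\<forall>l\<in>set m. isY l \<Longrightarrow> alpha i (frag_of m) = frag_of m"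
proof (induction m)
  case (Cons l m)
  then have "l \<noteq> LT" by auto
  then show ?case using Cons by (simp add: alpha_Cons[of i l m] frag_of_Cons[of l m])
qed simp

text \<open>\<open>LY i\<close> acts through the substitution \<open>alpha i\<close> as well, which
  fixes words of letters \<open>LY\<close>. This is why \<open>ordered\<close> puts the
  \<open>LY\<close> syllables first.\<close>

lemma r_letter:
  assumes "l \<in> A" "\<zeta> \<in> Fun.V" "isY l \<longrightarrow> (\<forall>l\<in>set m. isY l)"
  shows "r (tsym_val l) \<zeta> (frag_of m) = \<zeta> (frag_of m) + \<zeta> (frag_of (m @ [l]))"
proof (cases "isY l")
  case True
  then obtain i where l: "l = LY i" by (cases l) auto
  then show ?thesis
    using assms True alpha_Y[of m i] by (simp add: r_Y hat_apply mulr_def V_add frag_of_append)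
next
  case False
  then show ?thesis using assms by (simp add: r_TX hat_apply mulr_def V_add frag_of_append)
qed

text \<open>Since \<open>\<xi>\<close> vanishes on words with two equal neighbours,
  \<open>binomial_recursion\<close> reduces a power of a letter to its linear part.\<close>

lemma r_sval:
  assumes "ordered s" "\<xi> \<in> Fun.V" and square: "\<And>u a v. \<xi> (frag_of (u @ [a, a] @ v)) = 0"
    and "(\<exists>x\<in>set s. isY (fst x)) \<longrightarrow> (\<forall>l\<in>set m. isY l)"
  shows "r (sval s) \<xi> (frag_of m) = \<xi> (frag_of m * pexp s)"
  using assms(1,4)
proof (induction s arbitrary: m rule: sval.induct)
  case 1
  then show ?case by (simp add: Fun.UG_simps)
next
  case (2 l e s)
  have l: "l \<in> A" and s: "ordered s" and lA: "tsym_val l \<in> carrier K" "sval s \<in> carrier K"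
    using 2(2) tsym_val sval_closed by (auto simp: ordered_def)
  have Y: "isY l" if "x \<in> set s" "isY (fst x)" for x using 2(2) that by (auto simp: ordered_def)
  define \<eta> where "\<eta> = r (sval s) \<xi>"
  have \<eta>: "\<eta> \<in> Fun.V" unfolding \<eta>_def using r_V lA assms(2) by blast
  define a where "a e k = r (tsym_val l [^] e) \<eta> (frag_of (m @ replicate k l))" for e :: int and k
  have allowed: "isY l \<longrightarrow> (\<forall>x\<in>set (m @ replicate k l). isY x)" for k
  proof (intro impI ballI)
    fix x assume "isY l" "x \<in> set (m @ replicate k l)"
    then have "x = l \<or> x \<in> set m" by (auto split: if_splits)
    moreover have "\<exists>x\<in>set ((l, e) # s). isY (fst x)" using \<open>isY l\<close> by (intro bexI[of _ "(l, e)"]) simp_all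
    ultimately show "isY x" using 2(3) \<open>isY l\<close> by blast
  qed
  have IH: "\<eta> (frag_of (m @ replicate k l)) = \<xi> (frag_of (m @ replicate k l) * pexp s)" for k
    unfolding \<eta>_def
  proof (rule 2(1)[OF s], intro impI)
    assume "\<exists>x\<in>set s. isY (fst x)"
    then show "\<forall>x\<in>set (m @ replicate k l). isY x" using Y allowed[of k] by blast
  qed
  have "a (e + 1) k = a e k + a e (Suc k)" for e k
  proof -
    have V: "r (tsym_val l [^] e) \<eta> \<in> Fun.V" using r_V lA \<eta> by simp
    have "tsym_val l [^] (e + 1) = tsym_val l \<otimes> tsym_val l [^] e"
      using lA K.int_pow_mult[of "tsym_val l" 1 e] by (simp add: add.commute)
    then have "r (tsym_val l [^] (e + 1)) \<eta> = r (tsym_val l) (r (tsym_val l [^] e) \<eta>)"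
      using lA by (simp add: Fun.UG_simps)
    then show ?thesis
      using r_letter[OF l V allowed[of k]] by (simp add: a_def replicate_append_same)
  qed
  \<comment> \<open>A functional in \<open>Fun.V\<close> has bounded weight, and every letter has
    positive weight.\<close>
  moreover have "\<exists>N. \<forall>k\<ge>N. a e k = 0" for e
  proof -
    have "r (tsym_val l [^] e) \<eta> \<in> Fun.V" using r_V lA \<eta> by simp
    then obtain N where N: "r (tsym_val l [^] e) \<eta> \<in> Fun N" by (auto simp: Fun.V_def)
    have "a e k = 0" if "k \<ge> N" for k
    proof -
      have "k \<le> wtl (replicate k l)" using wt_pos[of l] by (induction k) auto
      then show ?thesis
        unfolding a_def using that by (intro Fun_High[OF N]) (simp add: High_frag_of)
    qed
    then show ?thesis by blast
  qed
  moreover have "a 0 k = 0" if "k \<ge> 2" for k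
  proof -
    obtain k' where k: "k = Suc (Suc k')" using \<open>k \<ge> 2\<close> by (metis add_2_eq_Suc le_Suc_ex)
    obtain j where j: "\<xi> \<in> Fun j" using assms(2) by (auto simp: Fun.V_def)
    have "\<xi> (frag_of (m @ [l, l] @ replicate k' l) * x) = 0" for x
    proof (induction x rule: frag_ind)
      case (one v)
      then show ?case using square[of m l "replicate k' l @ v"] by (simp flip: frag_of_append)
    qed (simp_all add: Fun_zero[OF j] right_diff_distrib Fun_diff[OF j])
    then show ?thesis using IH[of k] by (simp add: a_def k Fun.UG_simps)
  qed
  ultimately have "a e 0 = a 0 0 + e * a 0 1" using binomial_recursion[of a e 0] by simp
  moreover have "a 0 k = \<xi> (frag_of (m @ replicate k l) * pexp s)" for k
    using IH[of k] by (simp add: a_def Fun.UG_simps)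
  ultimately have "a e 0 = \<xi> (frag_of m * pexp s) + e * \<xi> (frag_of (m @ [l]) * pexp s)" by simp
  also have "\<dots> = \<xi> (frag_of m * pexp ((l, e) # s))"
    by (simp add: V_add[OF assms(2)] V_cmul[OF assms(2)] frag_of_append ring_distribs frag_cmul_mult_left
        frag_cmul_mult_right mult.assoc)
  finally show ?case using lA by (simp add: a_def \<eta>_def Fun.UG_simps)
qed

lemma sval_commute:
  assumes "a \<in> A" "fst ` set s \<subseteq> A" "\<forall>x\<in>set s. isY (fst x) = isY a \<and> commuting a (fst x)"
  shows "tsym_val a [^] (e::int) \<otimes> sval s = sval s \<otimes> tsym_val a [^] e"
  using assms(2,3)
proof (induction s rule: sval.induct)
  case 1
  then show ?case using tsym_val[OF assms(1)] by simp
next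
  case (2 l e' s)
  have c: "tsym_val a \<in> carrier K" "tsym_val l \<in> carrier K" "sval s \<in> carrier K" "l \<in> A"
    using tsym_val sval_closed assms(1) 2(2) by auto
  have "tsym_val a \<otimes> tsym_val l = tsym_val l \<otimes> tsym_val a" using tsym_val_commute[OF assms(1) c(4)] 2(3) by simp
  then have "tsym_val l \<otimes> tsym_val a [^] e = tsym_val a [^] e \<otimes> tsym_val l" using K.commute_int_pow c by simp
  then have "tsym_val l [^] e' \<otimes> tsym_val a [^] e = tsym_val a [^] e \<otimes> tsym_val l [^] e'" using K.commute_int_pow c by simp
  moreover have "tsym_val a [^] e \<otimes> sval s = sval s \<otimes> tsym_val a [^] e" using 2 by simp
  ultimately have "tsym_val a [^] e \<otimes> (tsym_val l [^] e' \<otimes> sval s) = tsym_val l [^] e' \<otimes> (sval s \<otimes> tsym_val a [^] e)"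
    using c by (metis K.int_pow_closed K.m_assoc)
  then show ?case using c by (simp add: K.m_assoc)
qed

text \<open>A shortest expression has nonzero exponents and a square-free trace \<open>V\<close>. If
  the element acts trivially, comparing coefficients of \<open>V\<close> at the empty word gives the
  nonzero product of the exponents on one side, which forces \<open>V\<close> to be empty.\<close>

theorem faithful:
  assumes gen: "\<And>g. g \<in> carrier K \<Longrightarrow> \<exists>s. ordered s \<and> g = sval s" and g: "g \<in> carrier K" "r g = \<one>\<^bsub>Fun.UG\<^esub>"
  shows "g = \<one>"
proof -
  obtain s where s: "ordered s" "g = sval s" and minimal: "\<And>s'. ordered s' \<Longrightarrow> g = sval s' \<Longrightarrow> length s \<le> length s'"
    using gen[OF g(1)] ex_has_least_nat[of "\<lambda>s. ordered s \<and> g = sval s" _ length] by metis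
  define V where "V = map fst s"
  have sA: "fst ` set s \<subseteq> A" using s(1) by (simp add: ordered_def)
  have nonzero: "snd x \<noteq> 0" if x: "x \<in> set s" for x
  proof
    assume "snd x = 0"
    obtain p q where pq: "s = p @ x # q" using x by (meson split_list)
    then have "ordered (p @ q)" using s(1) by (auto simp: ordered_def sorted_wrt_append)
    moreover have "g = sval (p @ q)"
      using s(2) sA \<open>snd x = 0\<close> sval_closed[of q] unfolding pq by (cases x) (auto simp: sval_append image_Un)
    ultimately show False using minimal pq by fastforce
  qed
  have square: "trace (u @ [a, a] @ v) \<noteq> trace V" for u a v
  proof
    assume "trace (u @ [a, a] @ v) = trace V"
    then obtain p m q where V: "V = p @ a # m @ a # q" and commuting: "\<forall>b\<in>set m. commuting a b"
      using trace_square[of V u a v] by auto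
    have "\<exists>p' t. s = p' @ t \<and> map fst t = a # m @ a # q"
      using V unfolding V_def map_eq_append_conv by metis
    then obtain p' x t where "s = p' @ x # t" "map fst t = m @ a # q" "fst x = a"
      unfolding map_eq_Cons_conv by blast
    moreover have "\<exists>m' t'. t = m' @ t' \<and> map fst m' = m \<and> map fst t' = a # q"
      using \<open>map fst t = m @ a # q\<close> unfolding map_eq_append_conv by metis
    then obtain m' y q' where "t = m' @ y # q'" "map fst m' = m" "fst y = a"
      unfolding map_eq_Cons_conv by blast
    ultimately have s': "s = p' @ x # m' @ y # q'" "map fst m' = m" "fst x = a" "fst y = a" by simp_all
    obtain e e' where xy: "x = (a, e)" "y = (a, e')" using s' by (cases x; cases y) auto
    have subs: "fst ` set p' \<subseteq> A" "fst ` set m' \<subseteq> A" "fst ` set q' \<subseteq> A" "a \<in> A"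
      using sA unfolding s' xy by auto
    \<comment> \<open>In an ordered expression everything between two syllables of one kind is of
      that kind. Hence the letters of \<open>m\<close> commute with \<open>a\<close> in the group
      and not only in the trace, and the two syllables can be merged.\<close>
    have "isY (fst z) = isY a" if "z \<in> set m'" for z
      using s(1) that unfolding s' xy by (auto simp: ordered_def sorted_wrt_append)
    then have "\<forall>z\<in>set m'. isY (fst z) = isY a \<and> commuting a (fst z)"
      using commuting s'(2) by force
    from sval_commute[OF subs(4,2) this]
    have comm: "tsym_val a [^] e' \<otimes> sval m' = sval m' \<otimes> tsym_val a [^] e'" .
    have c: "sval p' \<in> carrier K" "sval m' \<in> carrier K" "sval q' \<in> carrier K" "tsym_val a \<in> carrier K"
      using subs sval_closed[of p'] sval_closed[of m'] sval_closed[of q'] tsym_val[of a] by simp_all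
    have "g = sval p' \<otimes> (tsym_val a [^] e \<otimes> (sval m' \<otimes> (tsym_val a [^] e' \<otimes> sval q')))"
    proof -
      have "fst ` set ((a, e) # m' @ (a, e') # q') \<subseteq> A" "fst ` set ((a, e') # q') \<subseteq> A" using subs by auto
      then show ?thesis
        using s(2) unfolding s' xy by (simp only: sval_append[OF subs(1)] sval_append[OF subs(2)] sval.simps)
    qed
    also have "sval m' \<otimes> (tsym_val a [^] e' \<otimes> sval q') = tsym_val a [^] e' \<otimes> (sval m' \<otimes> sval q')"
      using comm c by (simp flip: K.m_assoc)
    also have "tsym_val a [^] e \<otimes> (tsym_val a [^] e' \<otimes> (sval m' \<otimes> sval q')) = tsym_val a [^] (e + e') \<otimes> (sval m' \<otimes> sval q')"
      using c by (simp add: K.int_pow_mult flip: K.m_assoc)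
    also have "sval p' \<otimes> (tsym_val a [^] (e + e') \<otimes> (sval m' \<otimes> sval q')) = sval (p' @ (a, e + e') # m' @ q')"
    proof -
      have "fst ` set ((a, e + e') # m' @ q') \<subseteq> A" using subs by auto
      then show ?thesis by (simp only: sval_append[OF subs(1)] sval_append[OF subs(2) subs(3)] sval.simps)
    qed
    finally have "g = sval (p' @ (a, e + e') # m' @ q')" .
    moreover have "ordered (p' @ (a, e + e') # m' @ q')"
      using s(1) unfolding s' xy by (auto simp: ordered_def sorted_wrt_append)
    ultimately show False using minimal[of "p' @ (a, e + e') # m' @ q'"] s' by simp
  qed
  have \<xi>: "coef (trace V) \<in> Fun (Suc (wtl V))" by (rule coef_Fun)
  have "r (sval s) (coef (trace V)) (frag_of []) = coef (trace V) (frag_of [] * pexp s)"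
    using square by (intro r_sval s(1) Fun.S_V[OF \<xi>]) (simp_all add: coef_frag_of)
  then have eq: "coef (trace V) (frag_of []) = coef (trace V) (pexp s)"
    using g(2) s(2) by (simp add: Fun.UG_simps frag_of_Nil)
  define c where "c = prod_list (map snd s)"
  have "coef (trace V) (pexp s - frag_cmul c (frag_of V)) = 0"
  proof -
    have "Poly_Mapping.keys (pexp s - frag_cmul c (frag_of V)) \<subseteq> {w. length w < length V}"
      using pexp_leading[of s] by (auto simp: short_def c_def V_def)
    then show ?thesis
      by (induction rule: frag_induction) (simp_all add: Fun_zero[OF \<xi>] Fun_diff[OF \<xi>] coef_shorter)
  qed
  then have "coef (trace V) (pexp s) = c * coef (trace V) (frag_of V)"
    using V_cmul[OF Fun.S_V[OF \<xi>]] Fun_diff[OF \<xi>] by simp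
  then have "coef (trace V) (frag_of []) = c" using eq by (simp add: coef_frag_of)
  moreover have "c \<noteq> 0" using nonzero by (auto simp: c_def prod_list_zero_iff)
  ultimately have "V = []" using coef_shorter[of "[]" V] by fastforce
  then show ?thesis using s(2) by (simp add: V_def)
qed

end

section \<open>The Formanek--Procesi group\<close>

lemma (in group) normal_closure_normal:
  assumes "S \<subseteq> carrier G"
  shows "normal_closure G S \<lhd> G" "S \<subseteq> normal_closure G S"
proof -
  have ne: "carrier G \<in> {N. N \<lhd> G \<and> S \<subseteq> N}" using assms carrier_normal by simp
  have "subgroup (\<Inter> {N. N \<lhd> G \<and> S \<subseteq> N}) G"
    using ne by (intro subgroups_Inter) (auto intro: normal_imp_subgroup)
  then show "normal_closure G S \<lhd> G"
    unfolding normal_closure_def normal_inv_iff using normal_invE(2) by (auto simp: normal_inv_iff)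
  show "S \<subseteq> normal_closure G S" by (auto simp: normal_closure_def)
qed

lemma (in group) generate_conj:
  assumes "S \<subseteq> carrier G" "f \<in> carrier G" "\<And>s. s \<in> S \<Longrightarrow> f \<otimes> s \<otimes> inv f \<in> generate G S" "x \<in> generate G S"
  shows "f \<otimes> x \<otimes> inv f \<in> generate G S"
  using assms(4)
proof (induction x rule: generate.induct)
  case one
  then show ?case using assms(2) generate.one by simp
next
  case (incl h)
  then show ?case by (rule assms(3))
next
  case (inv h)
  then have "inv (f \<otimes> h \<otimes> inv f) \<in> generate G S"
    using generate_m_inv_closed[OF assms(1) assms(3)] by blast
  then show ?case using inv assms(1,2) by (auto simp: inv_mult_group m_assoc subset_iff)
next
  case (eng a b)
  then have c: "a \<in> carrier G" "b \<in> carrier G" using generate_in_carrier[OF assms(1)] by blast+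
  have "f \<otimes> (a \<otimes> b) \<otimes> inv f = (f \<otimes> a \<otimes> inv f) \<otimes> (f \<otimes> b \<otimes> inv f)"
    using c assms(2) by (simp add: m_assoc cancel_left)
  then show ?case using generate.eng[OF eng.IH] by simp
qed

text \<open>Functionals test a leading term of degree \<open>c\<close> only on traces of weight
  \<open>c\<close>; homogeneity excludes the other weights.\<close>

definition exact :: "nat \<Rightarrow> (tsym list \<Rightarrow>\<^sub>0 int) set" where
  "exact k = {x. \<forall>w\<in>Poly_Mapping.keys x. wtl w = k}"

lemma exact_subgroup: "add_subgroup (exact k)"
  using keys_diff by (fastforce simp: add_subgroup_def exact_def)

lemma exact_frag_of: "frag_of w \<in> exact k \<longleftrightarrow> wtl w = k"
  by (simp add: exact_def)

lemma exact_mult_left: "x \<in> exact k \<Longrightarrow> frag_of [l] * x \<in> exact (wt l + k)"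
proof -
  assume "x \<in> exact k"
  then have "Poly_Mapping.keys x \<subseteq> {w. wtl w = k}" by (auto simp: exact_def)
  then show ?thesis
  proof (induction x rule: frag_induction)
    case (one w)
    then show ?case by (simp add: exact_frag_of flip: frag_of_append)
  qed (simp_all add: ring_distribs add_subgroup_zero[OF exact_subgroup] add_subgroup_diff[OF exact_subgroup])
qed

lemma exact_derw: "derw i w \<in> exact (Suc (wtl w))"
proof (induction w)
  case (Cons l w)
  have "frag_of [l] * derw i w \<in> exact (Suc (wtl (l # w)))" using exact_mult_left[OF Cons, of l] by simp
  then show ?case
    by (auto simp: exact_frag_of intro: add_subgroup_add[OF exact_subgroup])
qed (simp add: add_subgroup_zero[OF exact_subgroup])

lemma exact_op: "x \<in> exact k \<Longrightarrow> gen_act g x \<in> exact (Suc k)"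
proof -
  assume "x \<in> exact k"
  then have "Poly_Mapping.keys x \<subseteq> {w. wtl w = k}" by (auto simp: exact_def)
  then show ?thesis
  proof (induction x rule: frag_induction)
    case (one w)
    then show ?case
      using exact_derw by (cases g) (auto simp: exact_frag_of simp flip: frag_of_append intro!: add_subgroup_add[OF exact_subgroup])
  qed (simp_all add: gen_act_diff add_subgroup_zero[OF exact_subgroup] add_subgroup_diff[OF exact_subgroup], cases g, simp_all add: add_subgroup_zero[OF exact_subgroup])
qed

lemma keys_assoc: "Poly_Mapping.keys (assoc \<tau>) \<subseteq> {w. length w = deg \<tau>}"
proof (induction \<tau>)
  case (Br a b)
  have mult: "Poly_Mapping.keys (x * y) \<subseteq> {w. length w = i + j}"
    if "Poly_Mapping.keys x \<subseteq> {w. length w = i}" "Poly_Mapping.keys y \<subseteq> {w. length w = j}" for x y :: "'a list \<Rightarrow>\<^sub>0 int" and i j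
    using keys_mult[of x y] that by (fastforce simp: plus_list_def)
  show ?case
    using keys_diff[of "assoc a * assoc b" "assoc b * assoc a"] mult[OF Br] mult[OF Br(2,1)] by fastforce
qed simp

lemma exact_ract:
  assumes "\<forall>\<tau>\<in>Poly_Mapping.keys P. deg \<tau> = c"
  shows "ract (assocs P) 1 \<in> exact c"
proof -
  have word: "ract (frag_of w) m \<in> exact (length w + k)" if "m \<in> exact k" for w m k
    using that
  proof (induction w arbitrary: m k)
    case (Cons g w)
    then show ?case using Cons.IH[OF exact_op[OF Cons.prems]] by simp
  qed simp
  have one: "1 \<in> exact 0" using exact_frag_of[of "[]" 0] by (simp add: frag_of_Nil)
  have "ract x 1 \<in> exact c" if "Poly_Mapping.keys x \<subseteq> {w. length w = c}" for x
    using that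
  proof (induction x rule: frag_induction)
    case (one w)
    then show ?case using word[OF \<open>1 \<in> exact 0\<close>, of w] by simp
  qed (simp_all add: add_subgroup_zero[OF exact_subgroup] add_subgroup_diff[OF exact_subgroup])
  moreover have "Poly_Mapping.keys (assocs P) \<subseteq> {w. length w = c}"
    using keys_frag_extend[of assoc P] keys_assoc assms by fastforce
  ultimately show ?thesis by blast
qed

section \<open>The free group, its quotient and their actions\<close>

locale formanek_procesi =
  fixes n :: nat and \<theta> :: "(nat \<times> nat) set"
  assumes pc: "partial_commutation n \<theta>"
begin

sublocale partially_commutative \<theta>
  using pc by unfold_locales (auto simp: partial_commutation_def)

abbreviation "X \<equiv> insert T (F ` {1..n})"
abbreviation "Fr \<equiv> fp_free n"
abbreviation "M \<equiv> fp_normal n \<theta>"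
abbreviation "G \<equiv> FP n \<theta>"
abbreviation "J \<equiv> fp_lie_ideal n \<theta>"

sublocale Fr: group Fr
  by (simp add: fp_free_def group_free_group)

lemma \<theta>_range: "(a, b) \<in> \<theta> \<Longrightarrow> a \<in> {1..n} \<and> b \<in> {1..n} \<and> a \<noteq> b"
  using pc by (auto simp: partial_commutation_def)

lemma gen_closed: "g \<in> X \<Longrightarrow> free_gen g \<in> carrier Fr"
  by (simp add: fp_free_def free_gen_closed)

abbreviation "relators \<equiv> fp_relators (commutator Fr) (\<lambda>i. free_gen (F i)) (free_gen T) n \<theta>"

lemma relators_closed: "relators \<subseteq> carrier Fr"
  using gen_closed \<theta>_range by (auto simp: fp_relators_def)

lemma M_normal: "M \<lhd> Fr" and relators_M: "relators \<subseteq> M"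
  using Fr.normal_closure_normal[OF relators_closed] by (simp_all add: fp_normal_def)

sublocale M: normal M Fr
  by (rule M_normal)

sublocale G: group G
  unfolding FP_def by (rule M.factorgroup_is_group)

definition proj :: "fp_gen letter list \<Rightarrow> fp_gen letter list set" where
  "proj w = M #>\<^bsub>Fr\<^esub> w"

sublocale proj: group_hom Fr G proj
  using M.r_coset_hom_Mod by unfold_locales (simp add: proj_def[abs_def] FP_def)

lemma proj_surj: "proj ` carrier Fr = carrier G"
  by (simp add: proj_def[abs_def] FP_def carrier_FactGroup)

lemma proj_M: "w \<in> M \<Longrightarrow> proj w = \<one>\<^bsub>G\<^esub>"
  using Fr.coset_join2[of w M] M.mem_carrier M.is_subgroup by (simp add: proj_def FP_def)

definition rho :: "fp_gen letter list \<Rightarrow> (((tsym list \<Rightarrow>\<^sub>0 int) \<Rightarrow> int) \<Rightarrow> ((tsym list \<Rightarrow>\<^sub>0 int) \<Rightarrow> int))" where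
  "rho = (SOME h. h \<in> hom Fr Fun.UG \<and> (\<forall>g\<in>X. h (free_gen g) = hat (phi g)))"

lemma rho: "rho \<in> hom Fr Fun.UG" "g \<in> X \<Longrightarrow> rho (free_gen g) = hat (phi g)"
proof -
  have "\<exists>h. h \<in> hom Fr Fun.UG \<and> (\<forall>g\<in>X. h (free_gen g) = hat (phi g))"
    using free_group_extend[OF Fun.UG_group, of X "\<lambda>g. hat (phi g)"] hat_phi_UG unfolding fp_free_def by blast
  from someI_ex[OF this] show "rho \<in> hom Fr Fun.UG" "g \<in> X \<Longrightarrow> rho (free_gen g) = hat (phi g)"
    unfolding rho_def by blast+
qed

sublocale rho: group_hom Fr Fun.UG rho
  by unfold_locales (rule rho)

text \<open>The kernel is normal, so the relators suffice; \<open>hat_x\<close> turns each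
  \<open>[t, f\<^sub>i]\<close> into an explicit operator whose commutations are known.\<close>

lemma rho_M: "w \<in> M \<Longrightarrow> rho w = \<one>\<^bsub>Fun.UG\<^esub>"
proof -
  have x: "rho (commutator Fr (free_gen T) (free_gen (F i))) = hat (mulr (LX i))" if "i \<in> {1..n}" for i
    using that gen_closed rho(2) hat_x by (simp add: rho.hom_commutator)
  have "relators \<subseteq> kernel Fr Fun.UG rho"
  proof
    fix w assume w: "w \<in> relators"
    have "rho w = \<one>\<^bsub>Fun.UG\<^esub>"
      using w gen_closed rho(2) \<theta>_range x hat_f_commute hat_xf_commute hat_x_commute
      by (auto simp: fp_relators_def rho.hom_commutator)
    then show "w \<in> kernel Fr Fun.UG rho" using w relators_closed by (auto simp: kernel_def)
  qed
  moreover assume "w \<in> M"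
  ultimately show ?thesis
    using rho.normal_kernel by (auto simp: fp_normal_def normal_closure_def kernel_def)
qed

definition rbar :: "fp_gen letter list set \<Rightarrow> (((tsym list \<Rightarrow>\<^sub>0 int) \<Rightarrow> int) \<Rightarrow> ((tsym list \<Rightarrow>\<^sub>0 int) \<Rightarrow> int))" where
  "rbar = (SOME h. h \<in> hom G Fun.UG \<and> (\<forall>w\<in>carrier Fr. h (proj w) = rho w))"

lemma rbar: "rbar \<in> hom G Fun.UG" "w \<in> carrier Fr \<Longrightarrow> rbar (proj w) = rho w"
proof -
  have "rho x = rho y" if "x \<in> carrier Fr" "y \<in> carrier Fr" "M #>\<^bsub>Fr\<^esub> x = M #>\<^bsub>Fr\<^esub> y" for x y
  proof -
    have "x \<otimes>\<^bsub>Fr\<^esub> inv\<^bsub>Fr\<^esub> y \<in> M" using Fr.rcos_eq_iff[OF M.is_subgroup that(1,2)] that(3) by simp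
    from rho_M[OF this] show ?thesis
      using that by (simp add: Fun.UG.inv_solve_right')
  qed
  then obtain h where "h \<in> hom (Fr Mod M) Fun.UG" "\<And>x. x \<in> carrier Fr \<Longrightarrow> h (M #>\<^bsub>Fr\<^esub> x) = rho x"
    using FactGroup_universal[OF rho(1) M_normal] by metis
  then have "\<exists>h. h \<in> hom G Fun.UG \<and> (\<forall>w\<in>carrier Fr. h (proj w) = rho w)" by (auto simp: FP_def proj_def)
  from someI_ex[OF this] show "rbar \<in> hom G Fun.UG" "w \<in> carrier Fr \<Longrightarrow> rbar (proj w) = rho w"
    unfolding rbar_def by blast+
qed

abbreviation (input) "t \<equiv> proj (free_gen T)"
abbreviation (input) "f i \<equiv> proj (free_gen (F i))"

fun tsym_val :: "tsym \<Rightarrow> fp_gen letter list set" where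
  "tsym_val LT = t" | "tsym_val (LY i) = f i" | "tsym_val (LX i) = commutator G t (f i)"

definition A :: "tsym set" where
  "A = {LT} \<union> LX ` {1..n} \<union> LY ` {1..n}"

lemma t_closed: "t \<in> carrier G" and f_closed: "i \<in> {1..n} \<Longrightarrow> f i \<in> carrier G"
  using gen_closed proj.hom_closed by simp_all

lemma relator_one: "w \<in> relators \<Longrightarrow> proj w = \<one>\<^bsub>G\<^esub>"
  using relators_M proj_M by blast

lemma f_commute: "(a, b) \<in> \<theta> \<Longrightarrow> f a \<otimes>\<^bsub>G\<^esub> f b = f b \<otimes>\<^bsub>G\<^esub> f a"
proof -
  have *: "f a \<otimes>\<^bsub>G\<^esub> f b = f b \<otimes>\<^bsub>G\<^esub> f a" if "(a, b) \<in> \<theta>" "a > b" for a b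
  proof -
    have "commutator Fr (free_gen (F a)) (free_gen (F b)) \<in> relators" using that by (auto simp: fp_relators_def)
    from relator_one[OF this] show ?thesis
      using that \<theta>_range gen_closed f_closed by (simp add: proj.hom_commutator G.commutator_eq_one_iff)
  qed
  assume "(a, b) \<in> \<theta>"
  then show ?thesis using *[of a b] *[of b a] sym \<theta>_range by (metis linorder_neqE_nat)
qed

lemma x_commute:
  "(a, b) \<in> \<theta> \<Longrightarrow> commutator G t (f a) \<otimes>\<^bsub>G\<^esub> commutator G t (f b) = commutator G t (f b) \<otimes>\<^bsub>G\<^esub> commutator G t (f a)"
proof -
  have *: "commutator G t (f a) \<otimes>\<^bsub>G\<^esub> commutator G t (f b) = commutator G t (f b) \<otimes>\<^bsub>G\<^esub> commutator G t (f a)"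
    if "(a, b) \<in> \<theta>" "a > b" for a b
  proof -
    have "commutator Fr (commutator Fr (free_gen T) (free_gen (F a))) (commutator Fr (free_gen T) (free_gen (F b))) \<in> relators"
      using that by (auto simp: fp_relators_def)
    from relator_one[OF this] show ?thesis
      using that \<theta>_range gen_closed f_closed t_closed by (simp add: proj.hom_commutator G.commutator_eq_one_iff)
  qed
  assume "(a, b) \<in> \<theta>"
  then show ?thesis using *[of a b] *[of b a] sym \<theta>_range by (metis linorder_neqE_nat)
qed

lemma xf_commute:
  assumes "i \<in> {1..n}" "j \<in> {1..n}"
  shows "commutator G t (f i) \<otimes>\<^bsub>G\<^esub> f j = f j \<otimes>\<^bsub>G\<^esub> commutator G t (f i)"
proof -
  have "commutator Fr (commutator Fr (free_gen T) (free_gen (F i))) (free_gen (F j)) \<in> relators"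
    using assms by (auto simp: fp_relators_def)
  from relator_one[OF this] show ?thesis
    using assms gen_closed f_closed t_closed by (simp add: proj.hom_commutator G.commutator_eq_one_iff)
qed

lemma tsym_val_closed: "l \<in> A \<Longrightarrow> tsym_val l \<in> carrier G"
  using t_closed f_closed by (auto simp: A_def)

sublocale rep: fp_representation \<theta> G tsym_val A rbar
proof
  show "tsym_val l \<in> carrier G" if "l \<in> A" for l using that by (rule tsym_val_closed)
  show "rbar \<in> hom G Fun.UG" by (rule rbar)
  show Y: "rbar (tsym_val (LY i)) = hat (phi (F i))" if "LY i \<in> A" for i
    using that gen_closed by (auto simp: A_def rbar(2) rho(2))
  show "rbar (tsym_val l) = hat (mulr l)" if "l \<in> A" "\<not> isY l" for l
  proof -
    interpret rb: group_hom G Fun.UG rbar by unfold_locales (rule rbar)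
    have T: "rbar t = hat (phi T)" using gen_closed by (simp add: rbar(2) rho(2))
    show ?thesis
    proof (cases l)
      case LT
      have "pull (phi T) = pull (mulr LT)" by (simp add: pull_def fun_eq_iff)
      then show ?thesis using T LT by simp
    next
      case (LX i)
      then have "i \<in> {1..n}" using that by (auto simp: A_def)
      then show ?thesis
        using T gen_closed LX t_closed f_closed hat_x[of i] by (simp add: rb.hom_commutator rbar(2) rho(2))
    qed (use that in simp)
  qed
  show "tsym_val a \<otimes>\<^bsub>G\<^esub> tsym_val b = tsym_val b \<otimes>\<^bsub>G\<^esub> tsym_val a" if ab: "a \<in> A" "b \<in> A" "isY a = isY b" "commuting a b" for a b
  proof -
    consider i j where "a = LX i" "b = LX j" "(i, j) \<in> \<theta>" | i j where "a = LY i" "b = LY j" "(i, j) \<in> \<theta>"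
      using ab by (cases a; cases b) auto
    then show ?thesis
    proof cases
      case 1
      then show ?thesis using x_commute[of i j] by (simp only: tsym_val.simps)
    next
      case 2
      then show ?thesis using f_commute[of i j] by (simp only: tsym_val.simps)
    qed
  qed
qed

lemma generate_sval:
  assumes "B \<subseteq> A" "x \<in> generate G (tsym_val ` B)"
  shows "\<exists>s. fst ` set s \<subseteq> B \<and> x = rep.sval s"
  using assms(2)
proof (induction x rule: generate.induct)
  case one
  then show ?case by (intro exI[of _ "[]"]) simp
next
  case (incl h)
  then obtain l where "l \<in> B" "h = tsym_val l" by blast
  then show ?case using tsym_val_closed assms(1) by (intro exI[of _ "[(l, 1)]"]) (auto simp: subset_iff)
next
  case (inv h)
  then obtain l where "l \<in> B" "h = tsym_val l" by blast
  then show ?case using tsym_val_closed assms(1) by (intro exI[of _ "[(l, -1)]"]) (auto simp: subset_iff G.int_pow_neg)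
next
  case (eng a b)
  then obtain s s' where "fst ` set s \<subseteq> B" "a = rep.sval s" "fst ` set s' \<subseteq> B" "b = rep.sval s'" by blast
  then show ?case using assms(1) by (intro exI[of _ "s @ s'"]) (auto simp: rep.sval_append)
qed

section \<open>Factorization into a part in the \<open>f\<^sub>i\<close> and a part in
  \<open>t\<close> and the \<open>x\<^sub>i\<close>\<close>

definition "AY = LY ` {1..n}"
definition "AX = {LT} \<union> LX ` {1..n}"

lemma AYX: "AY \<subseteq> A" "AX \<subseteq> A"
  by (auto simp: AY_def AX_def A_def)

lemma generate_closed: "B \<subseteq> A \<Longrightarrow> tsym_val ` B \<subseteq> carrier G"
  using tsym_val_closed by blast

text \<open>In either direction, conjugation by \<open>f\<^sub>i\<close> multiplies \<open>t\<close>
  by \<open>x\<^sub>i\<close> or its inverse and fixes every \<open>x\<^sub>j\<close>.\<close>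

lemma conj_AX:
  assumes i: "i \<in> {1..n}" and b: "b \<in> generate G (tsym_val ` AX)"
  shows "f i \<otimes>\<^bsub>G\<^esub> b \<otimes>\<^bsub>G\<^esub> inv\<^bsub>G\<^esub> f i \<in> generate G (tsym_val ` AX)"
    "inv\<^bsub>G\<^esub> f i \<otimes>\<^bsub>G\<^esub> b \<otimes>\<^bsub>G\<^esub> f i \<in> generate G (tsym_val ` AX)"
proof -
  let ?x = "commutator G t (f i)"
  note c = t_closed f_closed[OF i]
  have gens: "t \<in> generate G (tsym_val ` AX)" "?x \<in> generate G (tsym_val ` AX)" "inv\<^bsub>G\<^esub> ?x \<in> generate G (tsym_val ` AX)"
    using generate.incl[OF imageI[of LT AX tsym_val]] generate.incl[OF imageI[of "LX i" AX tsym_val]]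
      generate.inv[OF imageI[of "LX i" AX tsym_val]] i by (simp_all add: AX_def)
  have t1: "inv\<^bsub>G\<^esub> f i \<otimes>\<^bsub>G\<^esub> t \<otimes>\<^bsub>G\<^esub> f i = t \<otimes>\<^bsub>G\<^esub> ?x"
    using c by (rule G.conj_eq_mult_commutator)
  have xf: "?x \<otimes>\<^bsub>G\<^esub> f j = f j \<otimes>\<^bsub>G\<^esub> ?x" if "j \<in> {1..n}" for j using xf_commute i that by blast
  have t2: "f i \<otimes>\<^bsub>G\<^esub> t \<otimes>\<^bsub>G\<^esub> inv\<^bsub>G\<^esub> f i = t \<otimes>\<^bsub>G\<^esub> inv\<^bsub>G\<^esub> ?x"
  proof -
    have "t \<otimes>\<^bsub>G\<^esub> f i = f i \<otimes>\<^bsub>G\<^esub> t \<otimes>\<^bsub>G\<^esub> ?x" using G.mult_commutator[OF c] by simp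
    moreover have "inv\<^bsub>G\<^esub> ?x \<otimes>\<^bsub>G\<^esub> f i = f i \<otimes>\<^bsub>G\<^esub> inv\<^bsub>G\<^esub> ?x"
      using G.commute_int_pow[of ?x "f i" "-1"] xf[OF i] c by (simp add: G.int_pow_neg)
    moreover have "f i \<otimes>\<^bsub>G\<^esub> t \<otimes>\<^bsub>G\<^esub> ?x \<otimes>\<^bsub>G\<^esub> inv\<^bsub>G\<^esub> ?x = f i \<otimes>\<^bsub>G\<^esub> t"
      using c by (simp add: G.m_assoc)
    ultimately have "t \<otimes>\<^bsub>G\<^esub> inv\<^bsub>G\<^esub> ?x \<otimes>\<^bsub>G\<^esub> f i = f i \<otimes>\<^bsub>G\<^esub> t"
      using c by (metis G.commutator_closed G.inv_closed G.m_assoc)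
    then show ?thesis using c by (metis G.commutator_closed G.inv_closed G.inv_solve_right G.m_closed)
  qed
  have cent: "g \<otimes>\<^bsub>G\<^esub> commutator G t (f j) \<otimes>\<^bsub>G\<^esub> inv\<^bsub>G\<^esub> g = commutator G t (f j)"
    if "g = f i \<or> g = inv\<^bsub>G\<^esub> f i" "j \<in> {1..n}" for g j
  proof -
    have "f i \<otimes>\<^bsub>G\<^esub> commutator G t (f j) = commutator G t (f j) \<otimes>\<^bsub>G\<^esub> f i" using xf_commute i that(2) by simp
    then have "g \<otimes>\<^bsub>G\<^esub> commutator G t (f j) = commutator G t (f j) \<otimes>\<^bsub>G\<^esub> g"
      using G.commute_int_pow[of "f i" "commutator G t (f j)" "-1"] that c f_closed by (auto simp: G.int_pow_neg)
    then show ?thesis using that c f_closed by (auto simp: G.m_assoc)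
  qed
  have "f i \<otimes>\<^bsub>G\<^esub> s \<otimes>\<^bsub>G\<^esub> inv\<^bsub>G\<^esub> f i \<in> generate G (tsym_val ` AX)" if "s \<in> tsym_val ` AX" for s
    using that t2 cent[of "f i"] generate.eng[OF gens(1,3)] generate.incl[OF that] by (auto simp: AX_def)
  from G.generate_conj[OF generate_closed[OF AYX(2)] c(2) this b]
  show "f i \<otimes>\<^bsub>G\<^esub> b \<otimes>\<^bsub>G\<^esub> inv\<^bsub>G\<^esub> f i \<in> generate G (tsym_val ` AX)" .
  have "inv\<^bsub>G\<^esub> f i \<otimes>\<^bsub>G\<^esub> s \<otimes>\<^bsub>G\<^esub> inv\<^bsub>G\<^esub> (inv\<^bsub>G\<^esub> f i) \<in> generate G (tsym_val ` AX)" if "s \<in> tsym_val ` AX" for s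
    using that t1 cent[of "inv\<^bsub>G\<^esub> f i"] generate.eng[OF gens(1,2)] generate.incl[OF that] c by (auto simp: AX_def)
  from G.generate_conj[OF generate_closed[OF AYX(2)] G.inv_closed[OF c(2)] this b]
  show "inv\<^bsub>G\<^esub> f i \<otimes>\<^bsub>G\<^esub> b \<otimes>\<^bsub>G\<^esub> f i \<in> generate G (tsym_val ` AX)" using c by simp
qed

lemma G_generate: "carrier G = generate G (proj ` free_gen ` X)"
proof -
  have "carrier G = proj ` generate Fr (free_gen ` X)"
    using proj_surj free_group_generate[of X] by (simp add: fp_free_def)
  also have "\<dots> = generate G (proj ` free_gen ` X)"
    by (rule proj.generate_img[symmetric]) (use gen_closed in blast)
  finally show ?thesis .
qed

text \<open>The products \<open>a b\<close> include the identity and are closed under right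
  multiplication by generators: \<open>f\<^sub>i\<close> passes \<open>b\<close> by
  \<open>conj_AX\<close>.\<close>

lemma decompose:
  assumes "g \<in> carrier G"
  shows "\<exists>a\<in>generate G (tsym_val ` AY). \<exists>b\<in>generate G (tsym_val ` AX). g = a \<otimes>\<^bsub>G\<^esub> b"
proof -
  let ?P = "{a \<otimes>\<^bsub>G\<^esub> b | a b. a \<in> generate G (tsym_val ` AY) \<and> b \<in> generate G (tsym_val ` AX)}"
  note inY = G.generate_in_carrier[OF generate_closed[OF AYX(1)]]
  note inX = G.generate_in_carrier[OF generate_closed[OF AYX(2)]]
  have genX: "t \<in> generate G (tsym_val ` AX)" "inv\<^bsub>G\<^esub> t \<in> generate G (tsym_val ` AX)"
    using generate.incl[OF imageI[of LT AX tsym_val]] generate.inv[OF imageI[of LT AX tsym_val]] by (simp_all add: AX_def)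
  have genY: "f i \<in> generate G (tsym_val ` AY)" "inv\<^bsub>G\<^esub> f i \<in> generate G (tsym_val ` AY)" if "i \<in> {1..n}" for i
    using generate.incl[OF imageI[of "LY i" AY tsym_val]] generate.inv[OF imageI[of "LY i" AY tsym_val]] that by (simp_all add: AY_def)
  have stepX: "p \<otimes>\<^bsub>G\<^esub> x \<in> ?P" if p: "p \<in> ?P" and x: "x \<in> generate G (tsym_val ` AX)" for p x
  proof -
    obtain a b where ab: "p = a \<otimes>\<^bsub>G\<^esub> b" "a \<in> generate G (tsym_val ` AY)" "b \<in> generate G (tsym_val ` AX)" using p by blast
    then have "p \<otimes>\<^bsub>G\<^esub> x = a \<otimes>\<^bsub>G\<^esub> (b \<otimes>\<^bsub>G\<^esub> x)" using x inX inY by (simp add: G.m_assoc)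
    then show ?thesis using ab generate.eng[OF ab(3) x] by blast
  qed
  have stepY: "p \<otimes>\<^bsub>G\<^esub> y \<in> ?P"
    if p: "p \<in> ?P" and y: "y \<in> generate G (tsym_val ` AY)" "\<And>b. b \<in> generate G (tsym_val ` AX) \<Longrightarrow> inv\<^bsub>G\<^esub> y \<otimes>\<^bsub>G\<^esub> b \<otimes>\<^bsub>G\<^esub> y \<in> generate G (tsym_val ` AX)" for p y
  proof -
    obtain a b where ab: "p = a \<otimes>\<^bsub>G\<^esub> b" "a \<in> generate G (tsym_val ` AY)" "b \<in> generate G (tsym_val ` AX)" using p by blast
    then have "p \<otimes>\<^bsub>G\<^esub> y = (a \<otimes>\<^bsub>G\<^esub> y) \<otimes>\<^bsub>G\<^esub> (inv\<^bsub>G\<^esub> y \<otimes>\<^bsub>G\<^esub> b \<otimes>\<^bsub>G\<^esub> y)"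
      using y(1) inX inY by (simp add: G.m_assoc G.cancel_left)
    then show ?thesis using generate.eng[OF ab(2) y(1)] y(2)[OF ab(3)] by blast
  qed
  have "\<forall>p\<in>?P. p \<otimes>\<^bsub>G\<^esub> g \<in> ?P" if "g \<in> generate G (proj ` free_gen ` X)" for g
    using that
  proof (induction g rule: generate.induct)
    case one
    have "p \<in> carrier G" if "p \<in> ?P" for p using that inX inY by blast
    then show ?case by auto
  next
    case (incl h)
    then consider "h = t" | i where "i \<in> {1..n}" "h = f i" by auto
    then show ?case
    proof cases
      case 1
      then show ?thesis using stepX genX by blast
    next
      case (2 i)
      then show ?thesis using stepY[of _ h] genY conj_AX(2) by blast
    qed
  next
    case (inv h)
    then consider "h = t" | i where "i \<in> {1..n}" "h = f i" by auto
    then show ?case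
    proof cases
      case 1
      then show ?thesis using stepX genX by blast
    next
      case (2 i)
      have "inv\<^bsub>G\<^esub> (inv\<^bsub>G\<^esub> h) \<otimes>\<^bsub>G\<^esub> b \<otimes>\<^bsub>G\<^esub> inv\<^bsub>G\<^esub> h \<in> generate G (tsym_val ` AX)" if "b \<in> generate G (tsym_val ` AX)" for b
        using conj_AX(1)[OF 2(1) that] f_closed[OF 2(1)] 2(2) by simp
      then show ?thesis using stepY[of _ "inv\<^bsub>G\<^esub> h"] genY[OF 2(1)] 2(2) by blast
    qed
  next
    case (eng h1 h2)
    have c: "h1 \<in> carrier G" "h2 \<in> carrier G" using eng.hyps G_generate by blast+
    have "p \<otimes>\<^bsub>G\<^esub> (h1 \<otimes>\<^bsub>G\<^esub> h2) = p \<otimes>\<^bsub>G\<^esub> h1 \<otimes>\<^bsub>G\<^esub> h2" if "p \<in> ?P" for p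
    proof -
      have "p \<in> carrier G" using that inX inY by blast
      then show ?thesis using c by (simp add: G.m_assoc)
    qed
    then show ?case using eng.IH by auto
  qed
  moreover have "\<one>\<^bsub>G\<^esub> \<in> ?P" using generate.one[of G] G.l_one[OF G.one_closed] by (metis (mono_tags, lifting) mem_Collect_eq)
  ultimately have "\<one>\<^bsub>G\<^esub> \<otimes>\<^bsub>G\<^esub> g \<in> ?P" using assms G_generate by blast
  then show ?thesis using assms by auto
qed

lemma rbar_faithful:
  assumes "g \<in> carrier G" "rbar g = \<one>\<^bsub>Fun.UG\<^esub>"
  shows "g = \<one>\<^bsub>G\<^esub>"
proof (rule rep.faithful[OF _ assms])
  fix g assume "g \<in> carrier G"
  then obtain a b where ab: "a \<in> generate G (tsym_val ` AY)" "b \<in> generate G (tsym_val ` AX)" "g = a \<otimes>\<^bsub>G\<^esub> b"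
    using decompose by blast
  obtain s where s: "fst ` set s \<subseteq> AY" "a = rep.sval s" using generate_sval[OF AYX(1) ab(1)] by blast
  obtain s' where s': "fst ` set s' \<subseteq> AX" "b = rep.sval s'" using generate_sval[OF AYX(2) ab(2)] by blast
  have Y: "\<forall>x\<in>set s. isY (fst x)" using s(1) by (auto simp: AY_def image_subset_iff)
  have X: "\<forall>x\<in>set s'. \<not> isY (fst x)" using s'(1) by (fastforce simp: AX_def image_subset_iff)
  have "fst ` set (s @ s') \<subseteq> A" using s s' AYX by auto
  moreover have "sorted_wrt (\<lambda>x y. isY (fst y) \<longrightarrow> isY (fst x)) s"
    using Y by (induction s) auto
  moreover have "sorted_wrt (\<lambda>x y. isY (fst y) \<longrightarrow> isY (fst x)) s'"
    using X by (induction s') auto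
  ultimately have "rep.ordered (s @ s')" using Y by (simp add: rep.ordered_def sorted_wrt_append)
  moreover have "g = rep.sval (s @ s')" using ab s s' AYX by (simp add: rep.sval_append)
  ultimately show "\<exists>s. rep.ordered s \<and> g = rep.sval s" by blast
qed

section \<open>Leading terms of elements of the free group\<close>

text \<open>
  The relators \<open>fp_trees\<close> have no bound on the indices, so the generators that are not in the free
  group are sent to the identity.
\<close>

definition gen_val :: "fp_gen \<Rightarrow> fp_gen letter list" where
  "gen_val g = (if g \<in> X then free_gen g else \<one>\<^bsub>Fr\<^esub>)"

lemma gen_val_closed: "gen_val g \<in> carrier Fr"
  using gen_closed by (simp add: gen_val_def)

definition E :: "(fp_gen lie_tree \<Rightarrow>\<^sub>0 int) \<Rightarrow> (nat \<Rightarrow> fp_gen letter list set)" where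
  "E = (SOME E. lie_evaluation Fr gen_val E)"

sublocale E: lie_evaluation Fr gen_val E
proof -
  have "\<exists>E. lie_evaluation Fr gen_val E"
    using Fr.lie_eval_exists[of gen_val, OF gen_val_closed] gen_val_closed
    by (metis lie_evaluation.intro lie_evaluation_axioms.intro Fr.is_group)
  then show "lie_evaluation Fr gen_val E" unfolding E_def by (rule someI_ex)
qed

abbreviation "homogeneous P c \<equiv> \<forall>\<tau>\<in>Poly_Mapping.keys P. deg \<tau> = c"

text \<open>One Lie polynomial must describe both the class in the graded Lie ring and the leading
  term of the action; this carries information from the action back to the class.\<close>

definition represents :: "nat \<Rightarrow> (fp_gen lie_tree \<Rightarrow>\<^sub>0 int) \<Rightarrow> fp_gen letter list \<Rightarrow> bool" where
  "represents c P w \<longleftrightarrow> w \<in> lower_central Fr c \<and> homogeneous P c \<and> gr_class Fr c w = E P \<and>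
     Fun.lead c (rho w) (pull (ract (assocs P)))"

lemma representsI:
  assumes "w \<in> lower_central Fr c" "homogeneous P c" "gr_class Fr c w = E P"
    "Fun.lead c (rho w) L" "\<And>\<xi> m. \<xi> \<in> Fun.V \<Longrightarrow> L \<xi> m = \<xi> (ract (assocs P) m)"
  shows "represents c P w"
  unfolding represents_def
proof (intro conjI assms(1-3))
  have "L \<xi> = pull (ract (assocs P)) \<xi>" if "\<xi> \<in> Fun.V" for \<xi>
    using assms(5)[OF that] by (simp add: pull_def fun_eq_iff)
  from Fun.lead_cong[OF assms(4) this] show "Fun.lead c (rho w) (pull (ract (assocs P)))" .
qed

lemma representsD:
  assumes "represents c P w"
  shows "w \<in> carrier Fr" "w \<in> lower_central Fr c" "homogeneous P c" "gr_class Fr c w = E P"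
    "Fun.lead c (rho w) (pull (ract (assocs P)))" "rho w \<in> carrier Fun.UG"
proof -
  show *: "w \<in> carrier Fr" using assms unfolding represents_def by (blast intro: Fr.lower_central_carrier)
  from rho.hom_closed[OF *] show "rho w \<in> carrier Fun.UG" .
qed (use assms in \<open>unfold represents_def, blast+\<close>)

lemma Fun_V:
  assumes "\<xi> \<in> Fun.V"
  shows "\<xi> 0 = 0" "\<xi> (x - y) = \<xi> x - \<xi> y"
  using assms Fun_diff Fun_zero by (auto simp: Fun.V_def)

lemma represents_one: "c \<ge> 1 \<Longrightarrow> represents c 0 \<one>\<^bsub>Fr\<^esub>"
proof (rule representsI)
  show "Fun.lead c (rho \<one>\<^bsub>Fr\<^esub>) (\<lambda>x. 0)"
    using Fun.UG_simps(3) by (simp add: Fun.lead_def Fun.additive_V_def Fun.S_0)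
qed (simp_all add: Fr.lower_central_one Fr.gr_one_class E.E_zero Fun_V)

lemma represents_mult:
  assumes "c \<ge> 1" "represents c P w" "represents c P' w'"
  shows "represents c (P + P') (w \<otimes>\<^bsub>Fr\<^esub> w')"
proof (rule representsI)
  note D = representsD[OF assms(2)] representsD[OF assms(3)]
  show "homogeneous (P + P') c"
    using D(3,9) keys_add[of P P'] by blast
  show "gr_class Fr c (w \<otimes>\<^bsub>Fr\<^esub> w') = E (P + P')"
    using D(2,4,8,10) by (simp add: Fr.gr_class_mult E.E_add)
  show "Fun.lead c (rho (w \<otimes>\<^bsub>Fr\<^esub> w')) (\<lambda>x. pull (ract (assocs P)) x + pull (ract (assocs P')) x)"
    using Fun.lead_mult[OF assms(1) D(5,11)] D(1,7) by simp
  fix \<xi> m assume "\<xi> \<in> Fun.V"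
  then show "(pull (ract (assocs P)) \<xi> + pull (ract (assocs P')) \<xi>) m = \<xi> (ract (assocs (P + P')) m)"
    using Fun_add by (auto simp: Fun.V_def pull_def word_act_def frag_extend_add)
qed (use assms(2,3) Fr.lower_central_mult representsD(2) in blast)

lemma represents_inv:
  assumes "c \<ge> 1" "represents c P w"
  shows "represents c (- P) (inv\<^bsub>Fr\<^esub> w)"
proof (rule representsI)
  note D = representsD[OF assms(2)]
  show "homogeneous (- P) c" using D(3) by simp
  show "gr_class Fr c (inv\<^bsub>Fr\<^esub> w) = E (- P)"
    using D assms(1) by (simp add: Fr.gr_class_inv E.E_uminus)
  show "Fun.lead c (rho (inv\<^bsub>Fr\<^esub> w)) (\<lambda>x. - pull (ract (assocs P)) x)"
    using Fun.lead_inv[OF assms(1) D(5,6)] D(1) by simp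
  fix \<xi> m assume "\<xi> \<in> Fun.V"
  then have "\<xi> (0 - ract (assocs P) m) = - \<xi> (ract (assocs P) m)" by (simp only: Fun_V)
  then show "(- pull (ract (assocs P)) \<xi>) m = \<xi> (ract (assocs (- P)) m)"
    by (simp add: pull_def word_act_def frag_extend_minus)
qed (use assms(2) Fr.lower_central_inv representsD(2) in blast)

lemma represents_commutator:
  assumes "i \<ge> 1" "j \<ge> 1" "represents i P x" "represents j P' y"
  shows "represents (i + j) (lbr P P') (commutator Fr x y)"
proof (rule representsI)
  note D = representsD[OF assms(3)] representsD[OF assms(4)]
  show "commutator Fr x y \<in> lower_central Fr (i + j)"
    using Fr.commutator_lower_central[OF assms(1,2) D(2,8)] .
  show "homogeneous (lbr P P') (i + j)" by (rule deg_keys_lbr[OF D(3,9)])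
  show "gr_class Fr (i + j) (commutator Fr x y) = E (lbr P P')"
    using Fr.lie_bracket_gr_class[OF assms(1,2) D(2,8)] D(4,10) by (simp add: E.E_lbr)
  show "Fun.lead (i + j) (rho (commutator Fr x y)) (\<lambda>\<xi>. pull (ract (assocs P)) (pull (ract (assocs P')) \<xi>) -
      pull (ract (assocs P')) (pull (ract (assocs P)) \<xi>))"
    using Fun.lead_commutator[OF D(6,5,12,11)] D(1,7) by (simp add: rho.hom_commutator)
  fix \<xi> m assume "\<xi> \<in> Fun.V"
  then show "(pull (ract (assocs P)) (pull (ract (assocs P')) \<xi>) -
      pull (ract (assocs P')) (pull (ract (assocs P)) \<xi>)) m = \<xi> (ract (assocs (lbr P P')) m)"
    by (simp add: pull_def assocs_lbr ract_mult Fun_V)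
qed

lemma represents_gen: "g \<in> X \<Longrightarrow> represents 1 (frag_of (Leaf g)) (free_gen g)"
proof (rule representsI)
  assume g: "g \<in> X"
  show "gr_class Fr 1 (free_gen g) = E (frag_of (Leaf g))" using g by (simp add: E.E_of gen_val_def)
  show "Fun.lead 1 (rho (free_gen g)) (pull (gen_act g))" using lead_phi rho(2)[OF g] by simp
qed (use gen_closed in \<open>auto simp: pull_def\<close>)

lemma represents_generate:
  assumes "c \<ge> 1" "\<And>s. s \<in> S \<Longrightarrow> \<exists>P. represents c P s" "w \<in> generate Fr S"
  shows "\<exists>P. represents c P w"
  using assms(3)
proof (induction w rule: generate.induct)
  case one
  then show ?case using represents_one[OF assms(1)] by blast
next
  case (incl h)
  then show ?case by (rule assms(2))
next
  case (inv h)
  then show ?case using assms(2) represents_inv[OF assms(1)] by blast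
next
  case (eng h1 h2)
  then show ?case using represents_mult[OF assms(1)] by blast
qed

text \<open>The invariant holds for the free generators and survives products, inverses and
  commutators, from which the lower central series is built.\<close>

lemma represents_exists: "c \<ge> 1 \<Longrightarrow> w \<in> lower_central Fr c \<Longrightarrow> \<exists>P. represents c P w"
proof (induction c arbitrary: w rule: dec_induct)
  case base
  have 1: "w \<in> generate Fr (free_gen ` X)" if "w \<in> carrier Fr" for w
    using free_group_generate[of X] that unfolding fp_free_def by blast
  have 2: "\<exists>P. represents 1 P s" if "s \<in> free_gen ` X" for s using that represents_gen by blast
  show ?case using represents_generate[OF order_refl 2 1] base by simp
next
  case (step c)
  show ?case
  proof (rule represents_generate)
    show "w \<in> generate Fr {commutator Fr x y | x y. x \<in> lower_central Fr c \<and> y \<in> carrier Fr}"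
      using step Fr.lower_central_Suc by simp
    fix s assume "s \<in> {commutator Fr x y | x y. x \<in> lower_central Fr c \<and> y \<in> carrier Fr}"
    then obtain x y where s: "s = commutator Fr x y" "x \<in> lower_central Fr c" "y \<in> carrier Fr" by blast
    have 1: "y \<in> generate Fr (free_gen ` X)"
      using free_group_generate[of X] s(3) unfolding fp_free_def by blast
    have 2: "\<exists>P. represents 1 P s" if "s \<in> free_gen ` X" for s using that represents_gen by blast
    obtain P where P: "represents 1 P y" using represents_generate[OF order_refl 2 1] by blast
    obtain P' where "represents c P' x" using step.IH s(2) by blast
    from represents_commutator[OF step.hyps(1) order_refl this P] show "\<exists>P. represents (Suc c) P s"
      unfolding s(1) by auto
  qed simp
qed

lemma unip_rho: "c \<ge> 1 \<Longrightarrow> w \<in> lower_central Fr c \<Longrightarrow> Fun.unip c (rho w)"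
  using represents_exists Fun.lead_unip representsD(5) by blast

section \<open>The ideal generated by the Lie relators\<close>

abbreviation "lie_relators \<equiv> fp_relators (bracket (gr Fr)) (\<lambda>i. gr_class Fr 1 (free_gen (F i))) (gr_class Fr 1 (free_gen T)) n \<theta>"

text \<open>Both kinds of relators come from the same bracket expressions, here in degrees 2, 3 and
  4, so \<open>lie_bracket_gr_class\<close> matches them.\<close>

lemma lie_relators_class: "\<rho> \<in> lie_relators \<Longrightarrow> \<exists>c\<ge>1. \<exists>w\<in>relators. w \<in> lower_central Fr c \<and> \<rho> = gr_class Fr c w"
proof -
  have gc: "free_gen g \<in> lower_central Fr 1" if "g \<in> X" for g using gen_closed[OF that] by simp
  have br: "bracket (gr Fr) (gr_class Fr i x) (gr_class Fr j y) = gr_class Fr (i + j) (commutator Fr x y)"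
    "commutator Fr x y \<in> lower_central Fr (i + j)"
    if "x \<in> lower_central Fr i" "y \<in> lower_central Fr j" "i \<ge> 1" "j \<ge> 1" for i j x y
    using Fr.lie_bracket_gr_class[OF that(3,4,1,2)] Fr.commutator_lower_central[OF that(3,4,1,2)] .
  assume "\<rho> \<in> lie_relators"
  then consider (a) a b where "\<rho> = bracket (gr Fr) (gr_class Fr 1 (free_gen (F a))) (gr_class Fr 1 (free_gen (F b)))" "a > b" "(a, b) \<in> \<theta>"
    | (b) i j where "\<rho> = bracket (gr Fr) (bracket (gr Fr) (gr_class Fr 1 (free_gen T)) (gr_class Fr 1 (free_gen (F i)))) (gr_class Fr 1 (free_gen (F j)))" "i \<in> {1..n}" "j \<in> {1..n}"
    | (c) a b where "\<rho> = bracket (gr Fr) (bracket (gr Fr) (gr_class Fr 1 (free_gen T)) (gr_class Fr 1 (free_gen (F a)))) (bracket (gr Fr) (gr_class Fr 1 (free_gen T)) (gr_class Fr 1 (free_gen (F b))))" "a > b" "(a, b) \<in> \<theta>"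
    by (auto simp only: fp_relators_def)
  then show ?thesis
  proof cases
    case a
    then have "F a \<in> X" "F b \<in> X" using \<theta>_range by auto
    note ab = gc[OF this(1)] gc[OF this(2)]
    have "commutator Fr (free_gen (F a)) (free_gen (F b)) \<in> relators" using a by (auto simp: fp_relators_def)
    then show ?thesis using br[OF ab] a(1) by (intro exI[of _ "1 + 1"] conjI bexI) auto
  next
    case b
    then have "T \<in> X" "F i \<in> X" "F j \<in> X" by auto
    note ab = gc[OF this(1)] gc[OF this(2)] gc[OF this(3)]
    have "commutator Fr (commutator Fr (free_gen T) (free_gen (F i))) (free_gen (F j)) \<in> relators" using b by (auto simp: fp_relators_def)
    then show ?thesis using br[OF ab(1,2)] br[OF br(2)[OF ab(1,2)] ab(3)] b(1) by (intro exI[of _ "1 + 1 + 1"] conjI bexI) auto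
  next
    case c
    then have "T \<in> X" "F a \<in> X" "F b \<in> X" using \<theta>_range by auto
    note ab = gc[OF this(1)] gc[OF this(2)] gc[OF this(3)]
    have "commutator Fr (commutator Fr (free_gen T) (free_gen (F a))) (commutator Fr (free_gen T) (free_gen (F b))) \<in> relators" using c by (auto simp: fp_relators_def)
    then show ?thesis using br[OF ab(1,2)] br[OF ab(1,3)] br[OF br(2)[OF ab(1,2)] br(2)[OF ab(1,3)]] c(1) by (intro exI[of _ "1 + 1 + (1 + 1)"] conjI bexI) auto
  qed
qed

lemma J: "lie_ideal J (gr Fr)" "lie_relators \<subseteq> J"
proof -
  have "lie_relators \<subseteq> carrier (gr Fr)"
    using lie_relators_class Fr.gr_class_closed by blast
  from lie_ideal_gen_lie_ideal[OF comm_group.axioms(2)[OF Fr.gr_comm_group] this Fr.lie_bracket_closed]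
  show "lie_ideal J (gr Fr)" "lie_relators \<subseteq> J" by (simp_all add: fp_lie_ideal_def)
qed

lemma J_subgroup: "subgroup J (gr Fr)"
  using J(1) by (simp add: lie_ideal_def)

lemma E_Leaf: "g \<in> X \<Longrightarrow> E (frag_of (Leaf g)) = gr_class Fr 1 (free_gen g)"
  "g \<notin> X \<Longrightarrow> E (frag_of (Leaf g)) = \<one>\<^bsub>gr Fr\<^esub>"
  by (simp_all add: E.E_of gen_val_def Fr.gr_one_class)

lemma E_Br: "E (frag_of (Br a b)) = bracket (gr Fr) (E (frag_of a)) (E (frag_of b))"
  using E.E_lbr[of "frag_of a" "frag_of b"] by simp

lemma E_Br_swap:
  assumes "E (frag_of (Br a b)) \<in> J"
  shows "E (frag_of (Br b a)) \<in> J"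
proof -
  note lc = Fr.tree_val_lower_central[of gen_val, OF gen_val_closed]
  note c = Fr.lower_central_carrier[OF lc[of a]] Fr.lower_central_carrier[OF lc[of b]]
  have "E (frag_of (Br b a)) = inv\<^bsub>gr Fr\<^esub> E (frag_of (Br a b))"
    using Fr.gr_class_inv[OF Fr.deg_pos lc[of "Br a b"]] c by (simp add: E.E_of Fr.inv_commutator add.commute)
  then show ?thesis using subgroup.m_inv_closed[OF J_subgroup assms] by simp
qed

text \<open>A pair in the wrong order is handled by antisymmetry, an index out of range by the
  trivial value of \<open>gen_val\<close>.\<close>

lemma fp_trees_J:
  assumes "\<rho> \<in> fp_trees"
  shows "E (frag_of \<rho>) \<in> J"
proof -
  let ?x = "\<lambda>i. Br (Leaf T) (Leaf (F i))"
  have one: "\<one>\<^bsub>gr Fr\<^esub> \<in> J" by (rule subgroup.one_closed[OF J_subgroup])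
  have 1: "E (frag_of (Br (Leaf (F a)) (Leaf (F b)))) \<in> J" if "(a, b) \<in> \<theta>" "a > b" for a b
  proof -
    have "bracket (gr Fr) (gr_class Fr 1 (free_gen (F a))) (gr_class Fr 1 (free_gen (F b))) \<in> lie_relators"
      using that unfolding fp_relators_def by blast
    then have "bracket (gr Fr) (gr_class Fr 1 (free_gen (F a))) (gr_class Fr 1 (free_gen (F b))) \<in> J" using J(2) by blast
    moreover have "F a \<in> X" "F b \<in> X" using \<theta>_range[OF that(1)] by auto
    ultimately show ?thesis by (simp only: E_Br E_Leaf)
  qed
  have 3: "E (frag_of (Br (?x a) (?x b))) \<in> J" if "(a, b) \<in> \<theta>" "a > b" for a b
  proof -
    let ?b = "\<lambda>i. bracket (gr Fr) (gr_class Fr 1 (free_gen T)) (gr_class Fr 1 (free_gen (F i)))"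
    have "bracket (gr Fr) (?b a) (?b b) \<in> lie_relators"
      using that unfolding fp_relators_def by blast
    then have "bracket (gr Fr) (?b a) (?b b) \<in> J" using J(2) by blast
    moreover have "F a \<in> X" "F b \<in> X" "T \<in> X" using \<theta>_range[OF that(1)] by auto
    ultimately show ?thesis by (simp only: E_Br E_Leaf)
  qed
  have 2: "E (frag_of (Br (?x i) (Leaf (F j)))) \<in> J" for i j
  proof (cases "i \<in> {1..n} \<and> j \<in> {1..n}")
    case True
    let ?b = "bracket (gr Fr) (bracket (gr Fr) (gr_class Fr 1 (free_gen T)) (gr_class Fr 1 (free_gen (F i)))) (gr_class Fr 1 (free_gen (F j)))"
    have "?b \<in> lie_relators"
      using True unfolding fp_relators_def by blast
    then have "?b \<in> J" using J(2) by blast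
    moreover have "F i \<in> X" "F j \<in> X" "T \<in> X" using True by auto
    ultimately show ?thesis by (simp only: E_Br E_Leaf)
  next
    case False
    then have "F i \<notin> X \<or> F j \<notin> X" by auto
    then have "E (frag_of (Leaf (F i))) = \<one>\<^bsub>gr Fr\<^esub> \<or> E (frag_of (Leaf (F j))) = \<one>\<^bsub>gr Fr\<^esub>"
      using E_Leaf(2) by blast
    then have "E (frag_of (Br (?x i) (Leaf (F j)))) = \<one>\<^bsub>gr Fr\<^esub>"
      using Fr.lie_bracket_one E.E_closed Fr.lie_bracket_closed unfolding E_Br by (elim disjE) simp_all
    then show ?thesis using one by simp
  qed
  consider a b where "\<rho> = Br (Leaf (F a)) (Leaf (F b))" "(a, b) \<in> \<theta>"
    | i j where "\<rho> = Br (?x i) (Leaf (F j))"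
    | a b where "\<rho> = Br (?x a) (?x b)" "(a, b) \<in> \<theta>"
    using assms unfolding fp_trees_def by blast
  then show ?thesis
  proof cases
    case (1 a b)
    then have "(b, a) \<in> \<theta>" "a \<noteq> b" using sym \<theta>_range by blast+
    then show ?thesis using 1 \<open>\<And>b a. (a, b) \<in> \<theta> \<Longrightarrow> a > b \<Longrightarrow> E (frag_of (Br (Leaf (F a)) (Leaf (F b)))) \<in> J\<close> E_Br_swap
      by (metis linorder_neqE_nat)
  next
    case (2 i j)
    then show ?thesis using \<open>\<And>i j. E (frag_of (Br (?x i) (Leaf (F j)))) \<in> J\<close> by simp
  next
    case (3 a b)
    then have "(b, a) \<in> \<theta>" "a \<noteq> b" using sym \<theta>_range by blast+
    then show ?thesis using 3 \<open>\<And>b a. (a, b) \<in> \<theta> \<Longrightarrow> a > b \<Longrightarrow> E (frag_of (Br (?x a) (?x b))) \<in> J\<close> E_Br_swap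
      by (metis linorder_neqE_nat)
  qed
qed

text \<open>The hypothesis makes \<open>m\<close> times the leading term of \<open>w\<close> vanish
  on functionals of degree \<open>c\<close>. Evaluation at 1 shows that the polynomial of
  \<open>w\<close> is zero in the trace module, and \<open>lie_span_if_assoc_ideal\<close> makes it
  a consequence of the relators.\<close>

lemma gr_class_J_if_unip:
  assumes c: "c \<ge> 1" and "m > 0" and w: "w \<in> lower_central Fr c"
    and unip: "Fun.unip (Suc c) (rho w [^]\<^bsub>Fun.UG\<^esub> (m::nat))"
  shows "gr_class Fr c w \<in> J"
proof -
  obtain P where "represents c P w" using represents_exists[OF c w] by blast
  note D = representsD[OF this]
  let ?x = "ract (assocs P) 1"
  have coef_zero: "coef (trace v) ?x = 0" if "wtl v = c" for v
  proof -
    \<comment> \<open>An operator that lowers the index by \<open>Suc c\<close> sends this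
      functional to \<open>Fun 0\<close>, that is, to 0.\<close>
    have "coef (trace v) \<in> Fun (Suc c)" using coef_Fun[of v] that by simp
    from Fun.lead_unip_Suc[OF Fun.lead_pow[OF c D(5)] unip this]
    have "(\<Sum>i<m. pull (ract (assocs P)) (coef (trace v))) = 0" by (simp add: Fun.S_zero)
    moreover have "(\<Sum>i<m. pull (ract (assocs P)) (coef (trace v))) 1 = int m * coef (trace v) ?x" for m
      by (induction m) (simp_all add: pull_def ring_distribs)
    ultimately show ?thesis using \<open>m > 0\<close> by (metis mult_eq_0_iff of_nat_0_less_iff less_irrefl zero_fun_apply)
  qed
  have "trf ?x = 0"
  proof (rule poly_mapping_eqI)
    fix \<tau>
    show "Poly_Mapping.lookup (trf ?x) \<tau> = Poly_Mapping.lookup 0 \<tau>"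
    proof (cases "\<tau> \<in> Poly_Mapping.keys (trf ?x)")
      case True
      then obtain v where "v \<in> Poly_Mapping.keys ?x" "\<tau> = trace v"
        using keys_frag_extend[of "\<lambda>w. frag_of (trace w)" ?x] unfolding trf_def by force
      moreover have "?x \<in> exact c" by (rule exact_ract[OF D(3)])
      ultimately show ?thesis using coef_zero by (simp add: exact_def coef_def)
    qed (simp add: in_keys_iff)
  qed
  then have "assocs P \<in> AI" by (simp add: AI_iff comm_ideal_iff)
  from lie_span_if_assoc_ideal[OF AI_torsion_free D(3) this] have P: "P \<in> lie_span fp_trees" .
  have "gr_class Fr (deg \<rho>) (Fr.tree_val gen_val \<rho>) \<in> J" if "\<rho> \<in> fp_trees" for \<rho>
    using fp_trees_J[OF that] by (simp add: E.E_of)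
  from E.lie_span_eval[OF J(1) this P] show ?thesis using D(4) by simp
qed

lemma lower_central_G:
  assumes "x \<in> lower_central G c"
  shows "\<exists>v\<in>lower_central Fr c. x = proj v"
  using proj.hom_lower_central_surj[OF proj_surj, of c] assms by blast

text \<open>The case \<open>m = 1\<close> determines the kernel of the induced map; arbitrary
  \<open>m\<close> gives torsion-freeness.\<close>

lemma gr_class_J:
  assumes c: "c \<ge> 1" and "m > 0" and w: "w \<in> lower_central Fr c"
    and "proj w [^]\<^bsub>G\<^esub> (m::nat) \<in> lower_central G (Suc c)"
  shows "gr_class Fr c w \<in> J"
proof (rule gr_class_J_if_unip[OF c \<open>m > 0\<close> w])
  have wc: "w \<in> carrier Fr" using Fr.lower_central_carrier[OF w] .
  obtain v where v: "v \<in> lower_central Fr (Suc c)" "proj w [^]\<^bsub>G\<^esub> m = proj v"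
    using lower_central_G[OF assms(4)] by blast
  have "proj (w [^]\<^bsub>Fr\<^esub> m) = proj v" using v(2) wc by (simp add: proj.hom_nat_pow)
  \<comment> \<open>\<open>rho\<close> factors through \<open>G\<close> and cannot tell the power of
    \<open>w\<close> from \<open>v\<close>, which lies one term deeper in the free group.\<close>
  then have "rho (w [^]\<^bsub>Fr\<^esub> m) = rho v"
    using rbar(2)[of "w [^]\<^bsub>Fr\<^esub> m"] rbar(2)[of v] wc Fr.lower_central_carrier[OF v(1)] by simp
  then have "rho w [^]\<^bsub>Fun.UG\<^esub> m = rho v" using wc by (simp add: rho.hom_nat_pow)
  then show "Fun.unip (Suc c) (rho w [^]\<^bsub>Fun.UG\<^esub> m)" using unip_rho[OF _ v(1)] by simp
qed

section \<open>The induced map of graded Lie rings and the Magnus property\<close>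

abbreviation "\<pi> \<equiv> gr_map Fr G proj"

sublocale gr_Fr: comm_group "gr Fr"
  by (rule Fr.gr_comm_group)

sublocale gr_G: comm_group "gr G"
  by (rule G.gr_comm_group)

sublocale \<pi>: group_hom "gr Fr" "gr G" \<pi>
  using proj.gr_map_lie_hom by unfold_locales (simp add: lie_hom_def)

lemma \<pi>_bracket:
  "x \<in> carrier (gr Fr) \<Longrightarrow> y \<in> carrier (gr Fr) \<Longrightarrow> \<pi> (bracket (gr Fr) x y) = bracket (gr G) (\<pi> x) (\<pi> y)"
  using proj.gr_map_lie_hom by (simp add: lie_hom_def)

lemma J_kernel: "J \<subseteq> kernel (gr Fr) (gr G) \<pi>"
  unfolding fp_lie_ideal_def gen_lie_ideal_def
proof (rule Inter_lower, intro CollectI conjI subsetI)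
  show "lie_ideal (kernel (gr Fr) (gr G) \<pi>) (gr Fr)"
    using \<pi>.subgroup_kernel G.lie_bracket_one Fr.lie_bracket_closed
    by (simp add: lie_ideal_def kernel_def \<pi>_bracket)
  fix \<rho> assume "\<rho> \<in> lie_relators"
  then obtain c w where w: "c \<ge> 1" "w \<in> relators" "w \<in> lower_central Fr c" "\<rho> = gr_class Fr c w"
    using lie_relators_class by blast
  then show "\<rho> \<in> kernel (gr Fr) (gr G) \<pi>"
    using proj.gr_map_gr_class[OF w(1,3)] relator_one[OF w(2)] G.gr_one_class[OF w(1)] Fr.gr_class_closed[OF w(3)]
    by (simp add: kernel_def)
qed

lemma \<pi>_eq_one_iff:
  assumes "u \<in> carrier (gr Fr)"
  shows "\<pi> u = \<one>\<^bsub>gr G\<^esub> \<longleftrightarrow> u \<in> J"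
proof
  show "u \<in> J \<Longrightarrow> \<pi> u = \<one>\<^bsub>gr G\<^esub>" using J_kernel unfolding kernel_def by blast
  assume one: "\<pi> u = \<one>\<^bsub>gr G\<^esub>"
  show "u \<in> J"
  proof (rule Fr.gr_subgroup_memI[OF J_subgroup assms])
    fix c :: nat assume c: "c \<ge> 1"
    obtain x where x: "x \<in> lower_central Fr c" "u c = lower_central Fr (Suc c) #>\<^bsub>Fr\<^esub> x"
      using Fr.gr_apply_cl[OF assms c] by blast
    have xc: "x \<in> carrier Fr" using Fr.lower_central_carrier[OF x(1)] .
    have "lower_central G (Suc c) #>\<^bsub>G\<^esub> proj x = lower_central G (Suc c)"
      using proj.gr_map_apply[OF c, of u] proj.lcq_map_cl[OF xc, of c] x(2) one G.gr_one_apply[OF c] by simp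
    then have "proj x \<in> lower_central G (Suc c)"
      using G.cl_one_iff[OF proj.hom_closed[OF xc], of c] by blast
    then have "gr_class Fr c x \<in> J"
      using gr_class_J[OF c, of 1 x] x(1) xc by simp
    then show "\<exists>x\<in>lower_central Fr c. u c = lower_central Fr (Suc c) #>\<^bsub>Fr\<^esub> x \<and> gr_class Fr c x \<in> J"
      using x by blast
  qed
qed

lemma residually_nilpotent_G: "residually_nilpotent G"
proof -
  have "x = \<one>\<^bsub>G\<^esub>" if x: "\<And>c. c \<ge> 1 \<Longrightarrow> x \<in> lower_central G c" for x
  proof -
    have xc: "x \<in> carrier G" using x[of 1] by simp
    have unip: "Fun.unip c (rbar x)" if c: "c \<ge> 1" for c
    proof -
      obtain v where v: "v \<in> lower_central Fr c" "x = proj v" using lower_central_G[OF x[OF c]] by blast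
      then show ?thesis using unip_rho[OF c v(1)] rbar(2)[OF Fr.lower_central_carrier[OF v(1)]] by simp
    qed
    have "rbar x = \<one>\<^bsub>Fun.UG\<^esub>"
    proof (rule Fun.UG_eqI)
      show "rbar x \<in> carrier Fun.UG" using rbar(1) xc by (rule hom_in_carrier)
      fix \<xi> assume "\<xi> \<in> Fun.V"
      then obtain k where "\<xi> \<in> Fun k" unfolding Fun.V_def by blast
      \<comment> \<open>The truncated difference \<open>k - Suc k\<close> is 0, so
        \<open>rbar x\<close> fixes the functional.\<close>
      from Fun.unipD[OF unip[of "Suc k"] this] show "rbar x \<xi> = \<one>\<^bsub>Fun.UG\<^esub> \<xi>"
        by (simp add: Fun.S_zero Fun.UG_simps)
    qed simp
    then show ?thesis by (rule rbar_faithful[OF xc])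
  qed
  then show ?thesis using G.lower_central_one unfolding residually_nilpotent_def by blast
qed

lemma torsion_free_G:
  assumes c: "c \<ge> 1"
  shows "torsion_free (lower_central_quotient G c)"
  unfolding torsion_free_def
proof (intro ballI allI impI)
  fix Y and k :: nat
  assume "Y \<in> carrier (lower_central_quotient G c)" and k: "k > 0"
    and Y1: "Y [^]\<^bsub>lower_central_quotient G c\<^esub> k = \<one>\<^bsub>lower_central_quotient G c\<^esub>"
  then obtain x where x: "x \<in> lower_central G c" "Y = lower_central G (Suc c) #>\<^bsub>G\<^esub> x"
    unfolding G.lcq_carrier by blast
  have xc: "x \<in> carrier G" using G.lower_central_carrier[OF x(1)] .
  obtain w where w: "w \<in> lower_central Fr c" "x = proj w" using lower_central_G[OF x(1)] by blast
  have "lower_central G (Suc c) #>\<^bsub>G\<^esub> (x [^]\<^bsub>G\<^esub> k) = lower_central G (Suc c)"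
    using Y1 G.lcq_pow[OF x(1), of k] x(2) by (simp add: G.lcq_one)
  then have "x [^]\<^bsub>G\<^esub> k \<in> lower_central G (Suc c)"
    using G.cl_one_iff[OF G.nat_pow_closed[OF xc], of c k] by blast
  then have "gr_class Fr c w \<in> J" using gr_class_J[OF c k w(1)] w(2) by simp
  then have "gr_class G c x = \<one>\<^bsub>gr G\<^esub>"
    using \<pi>_eq_one_iff[OF Fr.gr_class_closed[OF w(1)]] proj.gr_map_gr_class[OF c w(1)] w(2) by simp
  then have "x \<in> lower_central G (Suc c)" using G.gr_class_eq_one_iff[OF c x(1)] by blast
  then show "Y = \<one>\<^bsub>lower_central_quotient G c\<^esub>"
    using G.cl_one_iff[OF xc, of c] x(2) by (simp only: G.lcq_one)
qed

lemma magnus_G: "magnus_group G"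
  using residually_nilpotent_G torsion_free_G G.is_group by (simp add: magnus_group_def)

end

theorem theorem1p1:
  fixes n :: nat and \<theta> :: "(nat \<times> nat) set"
  assumes "n \<ge> 2" and "partial_commutation n \<theta>" and "\<theta> \<noteq> {}"
  defines "\<pi> \<equiv> gr_map (fp_free n) (FP n \<theta>) (\<lambda>w. fp_normal n \<theta> #>\<^bsub>fp_free n\<^esub> w)"
  shows "\<pi> \<in> lie_hom (gr (fp_free n)) (gr (FP n \<theta>)) \<and>
    (\<exists>\<psi> \<in> lie_iso (lie_quotient (gr (fp_free n)) (fp_lie_ideal n \<theta>)) (gr (FP n \<theta>)).
       \<forall>u \<in> carrier (gr (fp_free n)). \<psi> (fp_lie_ideal n \<theta> #>\<^bsub>gr (fp_free n)\<^esub> u) = \<pi> u) \<and>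
    magnus_group (FP n \<theta>)"
proof -
  interpret FP: formanek_procesi n \<theta> by unfold_locales (rule assms(2))
  have \<pi>: "\<pi> = gr_map (fp_free n) (FP n \<theta>) FP.proj"
    unfolding \<pi>_def FP.proj_def[abs_def] ..
  show ?thesis
    unfolding \<pi>
    using lie_hom_factor[OF FP.Fr.gr_comm_group FP.gr_G.is_group FP.proj.gr_map_lie_hom
        FP.proj.gr_map_surj[OF FP.proj_surj] FP.J_subgroup FP.\<pi>_eq_one_iff FP.Fr.lie_bracket_closed]
      FP.proj.gr_map_lie_hom FP.magnus_G by blast
qed

end
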